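(* Let $k$ be a perfect field of characteristic $p>0$ and let $R$ be a Noetherian $k$-algebra. Then the saturated de Rham--Witt complex $\mathcal{W}\Omega^*_R$ is concentrated in degrees $\big[0,\ \sup_{\eta}\operatorname{tr\,deg}(\kappa(\eta)/k)\big]$, where $\eta$ runs over the generic points of the irreducible components of $\operatorname{Spec}R$ and $\kappa(\eta)$ is the residue field at $\eta$; that is, $\mathcal{W}\Omega^i_R=0$ for every integer $i$ outside this interval.
   Context: Fix a prime $p$. All rings are commutative. A commutative differential graded algebra (cdga) is a graded-commutative differential graded ring in which odd-degree elements square to $0$. A Dieudonné complex is a cochain complex of abelian groups $(M^*,d)$ with a graded group endomorphism $F:M^*\to M^*$ satisfying $dF=pFd$. It is saturated if each $M^n$ is $p$-torsion-free and $F$ induces, for every $n$, a bijection $M^n\to\{x\in M^n: dx\in pM^{n+1}\}$. If $M^*$ is saturated, $V:M^*\to M^*$ denotes the unique graded group endomorphism with $FV=VF=p$; for $r\ge 1$ put $\mathcal{W}_rM^*=M^*/(\operatorname{im}V^r+\operatorname{im}dV^r)$, a quotient complex, and $\mathcal{W}M^*=\varprojlim_r\mathcal{W}_rM^*$ along the quotient maps. A saturated $M^*$ is strict if $M^*\to\mathcal{W}M^*$ is an isomorphism. A Dieudonné algebra is a Dieudonné complex $(A^*,d,F)$ in which $(A^*,d)$ is a cdga, $A^n=0$ for $n<0$, $F$ is a graded ring homomorphism, and $F(x)\equiv x^p \pmod p$ for all $x\in A^0$. It is called strict if its underlying Dieudonné complex is strict. Morphisms of Dieudonné algebras are cdga maps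 commuting with $F$. For an $\mathbb{F}_p$-algebra $R$, the saturated de Rham--Witt complex $\mathcal{W}\Omega^*_R$ is the strict Dieudonné algebra equipped with a ring map $R\to\mathcal{W}\Omega^0_R/V\mathcal{W}\Omega^0_R$ that is universal: for every strict Dieudonné algebra $B^*$, morphisms $\mathcal{W}\Omega^*_R\to B^*$ correspond bijectively to ring maps $R\to B^0/VB^0$. Equivalently, it is the strictification $\mathcal{W}\operatorname{Sat}(\Omega^*_{W(R_{\mathrm{red}})})$ of the absolute algebraic de Rham complex of the $p$-typical Witt vectors $W(R_{\mathrm{red}})$ of the reduction of $R$, where $\operatorname{Sat}$ is the left adjoint to the inclusion of saturated Dieudonné complexes into Dieudonné complexes and $F$ on $\Omega^*_{W(R_{\mathrm{red}})}$ is the graded ring map determined by the Witt vector Frobenius $\varphi$ on $W(R_{\mathrm{red}})$ and $F(dx)=x^{p-1}dx+d\big((\varphi(x)-x^p)/p\big)$. *)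

theory Defs
  imports
    "HOL-Algebra.Algebra"
    "HOL-Analysis.Abstract_Topology"
    "HOL-Library.Extended_Real"
begin

no_notation Sum_Type.Plus (infixr \<open><+>\<close> 65)

section \<open>Dieudonne complexes\<close>

text \<open>
  A graded abelian group (or graded ring) is given by its total group (or ring) together with
  an internal direct sum decomposition into the subgroups \<open>grade M n\<close>.  For Dieudonne complexes
  the multiplicative part of the record is ignored.
\<close>

record 'a dieudonne = "'a ring" +
  grade :: "int \<Rightarrow> 'a set"
  diff :: "'a \<Rightarrow> 'a"
  frob :: "'a \<Rightarrow> 'a"

definition graded_group :: "'a dieudonne \<Rightarrow> bool" where
  "graded_group M \<longleftrightarrow>
     abelian_group M \<and>
     (\<forall>n. subgroup (grade M n) (add_monoid M)) \<and>
     (\<forall>x\<in>carrier M. \<exists>!f. (\<forall>n. f n \<in> grade M n) \<and> finite {n. f n \<noteq> \<zero>\<^bsub>M\<^esub>} \<and>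
        x = finsum M f {n. f n \<noteq> \<zero>\<^bsub>M\<^esub>})"

definition graded_map :: "'a dieudonne \<Rightarrow> int \<Rightarrow> ('a \<Rightarrow> 'a) \<Rightarrow> bool" where
  "graded_map M e T \<longleftrightarrow>
     T \<in> hom (add_monoid M) (add_monoid M) \<and> (\<forall>n. T ` grade M n \<subseteq> grade M (n + e))"

definition dieudonne_complex :: "nat \<Rightarrow> 'a dieudonne \<Rightarrow> bool" where
  "dieudonne_complex p M \<longleftrightarrow>
     graded_group M \<and>
     graded_map M 1 (diff M) \<and>
     (\<forall>x\<in>carrier M. diff M (diff M x) = \<zero>\<^bsub>M\<^esub>) \<and>
     graded_map M 0 (frob M) \<and>
     (\<forall>x\<in>carrier M. diff M (frob M x) = [p] \<cdot>\<^bsub>M\<^esub> frob M (diff M x))"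

definition saturated :: "nat \<Rightarrow> 'a dieudonne \<Rightarrow> bool" where
  "saturated p M \<longleftrightarrow>
     dieudonne_complex p M \<and>
     (\<forall>n. (\<forall>x\<in>grade M n. [p] \<cdot>\<^bsub>M\<^esub> x = \<zero>\<^bsub>M\<^esub> \<longrightarrow> x = \<zero>\<^bsub>M\<^esub>) \<and>
          bij_betw (frob M) (grade M n)
            {x \<in> grade M n. diff M x \<in> (\<lambda>y. [p] \<cdot>\<^bsub>M\<^esub> y) ` grade M (n + 1)})"

definition verschiebung :: "nat \<Rightarrow> 'a dieudonne \<Rightarrow> 'a \<Rightarrow> 'a" where
  "verschiebung p M = (THE V. V \<in> extensional (carrier M) \<and> graded_map M 0 V \<and>
     (\<forall>x\<in>carrier M. frob M (V x) = [p] \<cdot>\<^bsub>M\<^esub> x \<and> V (frob M x) = [p] \<cdot>\<^bsub>M\<^esub> x))"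

definition V_fil :: "nat \<Rightarrow> 'a dieudonne \<Rightarrow> nat \<Rightarrow> 'a set" where
  "V_fil p M r =
     (verschiebung p M ^^ r) ` carrier M <+>\<^bsub>M\<^esub> diff M ` (verschiebung p M ^^ r) ` carrier M"

text \<open>
  \<open>W_deg p M r n\<close> is the degree \<open>n\<close> part of the quotient \<open>M / V_fil p M r\<close>.  The subgroup
  \<open>V_fil p M r\<close> is homogeneous, so this is the quotient of \<open>grade M n\<close> by its intersection with
  \<open>V_fil p M r\<close>.
\<close>

definition W_deg :: "nat \<Rightarrow> 'a dieudonne \<Rightarrow> nat \<Rightarrow> int \<Rightarrow> 'a set set" where
  "W_deg p M r n = (\<lambda>x. V_fil p M r +>\<^bsub>M\<^esub> x) ` grade M n"

text \<open>
  The quotient map from level \<open>Suc r\<close> to level \<open>r\<close> sends a coset \<open>X\<close> to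
  \<open>V_fil p M r <+> X\<close>.
\<close>

definition W_lim :: "nat \<Rightarrow> 'a dieudonne \<Rightarrow> int \<Rightarrow> (nat \<Rightarrow> 'a set) set" where
  "W_lim p M n =
     {s \<in> \<Pi>\<^sub>E r\<in>{1..}. W_deg p M r n. \<forall>r\<ge>1. s r = V_fil p M r <+>\<^bsub>M\<^esub> s (Suc r)}"

definition strict :: "nat \<Rightarrow> 'a dieudonne \<Rightarrow> bool" where
  "strict p M \<longleftrightarrow>
     saturated p M \<and>
     (\<forall>n. bij_betw (\<lambda>x. \<lambda>r\<in>{1..}. V_fil p M r +>\<^bsub>M\<^esub> x) (grade M n) (W_lim p M n))"


section \<open>Dieudonne algebras\<close>

definition cdga :: "'a dieudonne \<Rightarrow> bool" where
  "cdga A \<longleftrightarrow>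
     ring A \<and> graded_group A \<and>
     \<one>\<^bsub>A\<^esub> \<in> grade A 0 \<and>
     (\<forall>m n. \<forall>x\<in>grade A m. \<forall>y\<in>grade A n. x \<otimes>\<^bsub>A\<^esub> y \<in> grade A (m + n)) \<and>
     (\<forall>m n. \<forall>x\<in>grade A m. \<forall>y\<in>grade A n.
        y \<otimes>\<^bsub>A\<^esub> x = (if even (m * n) then x \<otimes>\<^bsub>A\<^esub> y else \<ominus>\<^bsub>A\<^esub> (x \<otimes>\<^bsub>A\<^esub> y))) \<and>
     (\<forall>m. odd m \<longrightarrow> (\<forall>x\<in>grade A m. x \<otimes>\<^bsub>A\<^esub> x = \<zero>\<^bsub>A\<^esub>)) \<and>
     graded_map A 1 (diff A) \<and>
     (\<forall>x\<in>carrier A. diff A (diff A x) = \<zero>\<^bsub>A\<^esub>) \<and>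
     (\<forall>m. \<forall>x\<in>grade A m. \<forall>y\<in>carrier A.
        diff A (x \<otimes>\<^bsub>A\<^esub> y) = (diff A x \<otimes>\<^bsub>A\<^esub> y) \<oplus>\<^bsub>A\<^esub>
          (if even m then x \<otimes>\<^bsub>A\<^esub> diff A y else \<ominus>\<^bsub>A\<^esub> (x \<otimes>\<^bsub>A\<^esub> diff A y)))"

definition dieudonne_algebra :: "nat \<Rightarrow> 'a dieudonne \<Rightarrow> bool" where
  "dieudonne_algebra p A \<longleftrightarrow>
     cdga A \<and> dieudonne_complex p A \<and>
     (\<forall>n<0. grade A n = {\<zero>\<^bsub>A\<^esub>}) \<and>
     frob A \<in> ring_hom A A \<and>
     (\<forall>x\<in>grade A 0. \<exists>y\<in>grade A 0. frob A x = (x [^]\<^bsub>A\<^esub> p) \<oplus>\<^bsub>A\<^esub> ([p] \<cdot>\<^bsub>A\<^esub> y))"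

definition strict_dieudonne_algebra :: "nat \<Rightarrow> 'a dieudonne \<Rightarrow> bool" where
  "strict_dieudonne_algebra p A \<longleftrightarrow> dieudonne_algebra p A \<and> strict p A"

definition dieudonne_hom :: "'a dieudonne \<Rightarrow> 'b dieudonne \<Rightarrow> ('a \<Rightarrow> 'b) set" where
  "dieudonne_hom A B =
     {f \<in> extensional (carrier A) \<inter> ring_hom A B.
        (\<forall>n. f ` grade A n \<subseteq> grade B n) \<and>
        (\<forall>x\<in>carrier A. f (diff A x) = diff B (f x) \<and> f (frob A x) = frob B (f x))}"


section \<open>The saturated de Rham--Witt complex\<close>

definition V_quot :: "nat \<Rightarrow> 'a dieudonne \<Rightarrow> 'a set ring" where
  "V_quot p A = A\<lparr>carrier := grade A 0\<rparr> Quot (verschiebung p A ` grade A 0)"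

text \<open>The map induced by a morphism \<open>f\<close> sends the coset of \<open>x\<close> to the coset of \<open>f x\<close>.\<close>

definition V_quot_map :: "nat \<Rightarrow> 'b dieudonne \<Rightarrow> ('a \<Rightarrow> 'b) \<Rightarrow> 'a set \<Rightarrow> 'b set" where
  "V_quot_map p B f C = (verschiebung p B ` grade B 0) <+>\<^bsub>B\<^esub> (f ` C)"

text \<open>
  Since a formula cannot quantify over types, the universal property is stated for test objects
  \<open>B\<close> whose elements lie in the fixed type \<open>nat \<Rightarrow> 'a + 'r + nat\<close>.  This is equivalent to testing
  against strict Dieudonne algebras on all types: \<open>A\<close> itself has an isomorphic copy on this type,
  and so has the strictification of the saturation of the de Rham complex of
  \<open>W(R\<^sub>r\<^sub>e\<^sub>d)\<close>, whose cardinality is at most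
  \<open>(card R + aleph_0) ^ aleph_0\<close>.  Hence an \<open>A\<close> that is universal for these test objects is
  isomorphic to the latter, compatibly with the maps from \<open>R\<close>.
\<close>

definition saturated_dRW ::
  "nat \<Rightarrow> ('r, 'm) ring_scheme \<Rightarrow> 'a dieudonne \<Rightarrow> ('r \<Rightarrow> 'a set) \<Rightarrow> bool" where
  "saturated_dRW p R A \<rho> \<longleftrightarrow>
     strict_dieudonne_algebra p A \<and>
     \<rho> \<in> ring_hom R (V_quot p A) \<and>
     (\<forall>B :: (nat \<Rightarrow> 'a + 'r + nat) dieudonne. strict_dieudonne_algebra p B \<longrightarrow>
        bij_betw (\<lambda>f. \<lambda>r\<in>carrier R. V_quot_map p B f (\<rho> r))
          (dieudonne_hom A B)
          (extensional (carrier R) \<inter> ring_hom R (V_quot p B)))"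


section \<open>Generic points and residue fields\<close>

definition Spec :: "('r, 'm) ring_scheme \<Rightarrow> 'r set set" where
  "Spec R = {P. primeideal P R}"

definition zariski :: "('r, 'm) ring_scheme \<Rightarrow> 'r set topology" where
  "zariski R = topology (\<lambda>U. \<exists>S\<subseteq>carrier R. U = {P \<in> Spec R. \<not> S \<subseteq> P})"

lemma istopology_zariski:
  fixes R :: "('r, 'm) ring_scheme"
  shows "istopology (\<lambda>U. \<exists>S\<subseteq>carrier R. U = {P \<in> Spec R. \<not> S \<subseteq> P})"
  unfolding istopology_def
proof (intro conjI allI impI)
  fix U1 U2
  assume "\<exists>S\<subseteq>carrier R. U1 = {P \<in> Spec R. \<not> S \<subseteq> P}"
    and "\<exists>S\<subseteq>carrier R. U2 = {P \<in> Spec R. \<not> S \<subseteq> P}"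
  then obtain S1 S2 where S: "S1 \<subseteq> carrier R" "S2 \<subseteq> carrier R"
    and U: "U1 = {P \<in> Spec R. \<not> S1 \<subseteq> P}" "U2 = {P \<in> Spec R. \<not> S2 \<subseteq> P}"
    by blast
  let ?S = "{x \<otimes>\<^bsub>R\<^esub> y | x y. x \<in> S1 \<and> y \<in> S2}"
  have prod: "(\<not> ?S \<subseteq> P) = (\<not> S1 \<subseteq> P \<and> \<not> S2 \<subseteq> P)" if "P \<in> Spec R" for P
  proof -
    interpret primeideal P R using that by (simp add: Spec_def)
    show ?thesis
    proof
      assume "\<not> ?S \<subseteq> P"
      then show "\<not> S1 \<subseteq> P \<and> \<not> S2 \<subseteq> P"
        using S I_l_closed I_r_closed by blast
    next
      assume "\<not> S1 \<subseteq> P \<and> \<not> S2 \<subseteq> P"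
      then obtain x y where "x \<in> S1" "y \<in> S2" "x \<notin> P" "y \<notin> P" by blast
      moreover from this have "x \<otimes>\<^bsub>R\<^esub> y \<notin> P" using S I_prime by blast
      ultimately show "\<not> ?S \<subseteq> P" by blast
    qed
  qed
  show "\<exists>S\<subseteq>carrier R. U1 \<inter> U2 = {P \<in> Spec R. \<not> S \<subseteq> P}"
  proof (cases "Spec R = {}")
    case True
    then show ?thesis using U by auto
  next
    case False
    then obtain P where "primeideal P R" by (auto simp: Spec_def)
    then interpret primeideal P R .
    have "?S \<subseteq> carrier R" using S by blast
    moreover have "U1 \<inter> U2 = {P \<in> Spec R. \<not> ?S \<subseteq> P}" using U prod by blast
    ultimately show ?thesis by blast
  qed
next
  fix K
  assume K: "\<forall>U\<in>K. \<exists>S\<subseteq>carrier R. U = {P \<in> Spec R. \<not> S \<subseteq> P}"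
  then obtain S where S: "\<And>U. U \<in> K \<Longrightarrow> S U \<subseteq> carrier R \<and> U = {P \<in> Spec R. \<not> S U \<subseteq> P}"
    by metis
  have "\<Union>K = {P \<in> Spec R. \<not> (\<Union>U\<in>K. S U) \<subseteq> P}"
    using S by blast
  moreover have "(\<Union>U\<in>K. S U) \<subseteq> carrier R" using S by blast
  ultimately show "\<exists>S\<subseteq>carrier R. \<Union>K = {P \<in> Spec R. \<not> S \<subseteq> P}" by blast
qed

definition irreducible_in :: "'x topology \<Rightarrow> 'x set \<Rightarrow> bool" where
  "irreducible_in T Z \<longleftrightarrow> Z \<subseteq> topspace T \<and> Z \<noteq> {} \<and>
     (\<forall>C D. closedin T C \<and> closedin T D \<and> Z \<subseteq> C \<union> D \<longrightarrow> Z \<subseteq> C \<or> Z \<subseteq> D)"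

definition irreducible_component :: "'x topology \<Rightarrow> 'x set \<Rightarrow> bool" where
  "irreducible_component T Z \<longleftrightarrow> irreducible_in T Z \<and>
     (\<forall>Z'. irreducible_in T Z' \<and> Z \<subseteq> Z' \<longrightarrow> Z' = Z)"

definition generic_points :: "('r, 'm) ring_scheme \<Rightarrow> 'r set set" where
  "generic_points R = {\<eta> \<in> Spec R.
     \<exists>Z. irreducible_component (zariski R) Z \<and> (zariski R) closure_of {\<eta>} = Z}"

definition frac_rel :: "('d, 'm) ring_scheme \<Rightarrow> (('d \<times> 'd) \<times> ('d \<times> 'd)) set" where
  "frac_rel D = {((a, s), (b, t)).
     a \<in> carrier D \<and> b \<in> carrier D \<and> s \<in> carrier D - {\<zero>\<^bsub>D\<^esub>} \<and> t \<in> carrier D - {\<zero>\<^bsub>D\<^esub>} \<and>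
     a \<otimes>\<^bsub>D\<^esub> t = b \<otimes>\<^bsub>D\<^esub> s}"

definition mk_frac :: "('d, 'm) ring_scheme \<Rightarrow> 'd \<Rightarrow> 'd \<Rightarrow> ('d \<times> 'd) set" where
  "mk_frac D a s = frac_rel D `` {(a, s)}"

definition fraction_field :: "('d, 'm) ring_scheme \<Rightarrow> ('d \<times> 'd) set ring" where
  "fraction_field D = \<lparr>
     carrier = {mk_frac D a s | a s. a \<in> carrier D \<and> s \<in> carrier D - {\<zero>\<^bsub>D\<^esub>}},
     monoid.mult = (\<lambda>x y. \<Union>(a, s)\<in>x. \<Union>(b, t)\<in>y. mk_frac D (a \<otimes>\<^bsub>D\<^esub> b) (s \<otimes>\<^bsub>D\<^esub> t)),
     monoid.one = mk_frac D \<one>\<^bsub>D\<^esub> \<one>\<^bsub>D\<^esub>,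
     ring.zero = mk_frac D \<zero>\<^bsub>D\<^esub> \<one>\<^bsub>D\<^esub>,
     ring.add = (\<lambda>x y. \<Union>(a, s)\<in>x. \<Union>(b, t)\<in>y.
       mk_frac D ((a \<otimes>\<^bsub>D\<^esub> t) \<oplus>\<^bsub>D\<^esub> (b \<otimes>\<^bsub>D\<^esub> s)) (s \<otimes>\<^bsub>D\<^esub> t))\<rparr>"

definition residue_field :: "('r, 'm) ring_scheme \<Rightarrow> 'r set \<Rightarrow> ('r set \<times> 'r set) set ring" where
  "residue_field R P = fraction_field (R Quot P)"

definition to_residue_field ::
  "('r, 'm) ring_scheme \<Rightarrow> 'r set \<Rightarrow> 'r \<Rightarrow> ('r set \<times> 'r set) set" where
  "to_residue_field R P a = mk_frac (R Quot P) (P +>\<^bsub>R\<^esub> a) \<one>\<^bsub>R Quot P\<^esub>"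


section \<open>Transcendence degree\<close>

definition eval_indexed ::
  "('k, 'm) ring_scheme \<Rightarrow> ('l, 'n) ring_scheme \<Rightarrow> ('k \<Rightarrow> 'l) \<Rightarrow> ('l multiset \<Rightarrow> 'k) \<Rightarrow> 'l" where
  "eval_indexed k L \<iota> P =
     (\<Oplus>\<^bsub>L\<^esub>m\<in>{m. P m \<noteq> \<zero>\<^bsub>k\<^esub>}. \<iota> (P m) \<otimes>\<^bsub>L\<^esub> (\<Otimes>\<^bsub>L\<^esub>x\<in>set_mset m. x [^]\<^bsub>L\<^esub> count m x))"

definition algebraically_independent ::
  "('k, 'm) ring_scheme \<Rightarrow> ('l, 'n) ring_scheme \<Rightarrow> ('k \<Rightarrow> 'l) \<Rightarrow> 'l set \<Rightarrow> bool" where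
  "algebraically_independent k L \<iota> S \<longleftrightarrow> S \<subseteq> carrier L \<and>
     (\<forall>P \<in> ring.indexed_pset k S (carrier k).
        eval_indexed k L \<iota> P = \<zero>\<^bsub>L\<^esub> \<longrightarrow> P = (\<lambda>m. \<zero>\<^bsub>k\<^esub>))"

text \<open>All infinite transcendence degrees are identified with \<open>\<infinity>\<close>.\<close>

definition tr_deg ::
  "('k, 'm) ring_scheme \<Rightarrow> ('l, 'n) ring_scheme \<Rightarrow> ('k \<Rightarrow> 'l) \<Rightarrow> enat" where
  "tr_deg k L \<iota> = (SUP S\<in>{S. algebraically_independent k L \<iota> S}.
     if finite S then enat (card S) else \<infinity>)"

definition perfect_field :: "nat \<Rightarrow> ('k, 'm) ring_scheme \<Rightarrow> bool" where
  "perfect_field p k \<longleftrightarrow> field k \<and> [p] \<cdot>\<^bsub>k\<^esub> \<one>\<^bsub>k\<^esub> = \<zero>\<^bsub>k\<^esub> \<and>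
     (\<lambda>x. x [^]\<^bsub>k\<^esub> p) ` carrier k = carrier k"

end

theory Submission
  imports Defs "HOL-Library.Fun_Lexorder"
begin

text \<open>
  Write \<open>[r]\<close> for the Teichmueller representative in \<open>A\<^sup>0\<close> of the image of \<open>r \<in> R\<close> in
  \<open>A\<^sup>0 / V A\<^sup>0\<close>: the only lift \<open>a\<close> with \<open>F a = a\<^sup>p\<close>.  Let \<open>n\<close> be larger than all
  transcendence degrees at generic points.  The theorem follows from the single identity
  \<open>d[y\<^sub>0] \<dots> d[y\<^sub>n\<^sub>-\<^sub>1] = 0\<close> for all \<open>y\<^sub>0, \<dots>, y\<^sub>n\<^sub>-\<^sub>1\<close> in \<open>R\<close>, together with the fact that
  \<open>A\<close> is generated by \<open>R\<close>.

  At each generic point the \<open>y\<^sub>j\<close> satisfy a nonzero polynomial over \<open>k\<close>.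
  In a Noetherian ring some product of prime ideals is zero, and each of these primes contains a
  generic point; the product of the corresponding polynomials is a nonzero polynomial \<open>f\<close> with
  \<open>f(y) = 0\<close> in \<open>R\<close> (lemma \<open>zero_dominated_of_tr_deg\<close>).  What is retained of \<open>f \<noteq> 0\<close> is a
  lexicographically dominant monomial \<open>m0\<close>, a property that survives products and powers.

  The relation forces the identity (lemma \<open>form_vanishes\<close>).  Let \<open>x\<^sub>j = [y\<^sub>j]\<close>, let \<open>\<omega> = dx\<^sub>0 \<dots> dx\<^sub>n\<^sub>-\<^sub>1\<close>, and let
  \<open>a\<close> be the sum of the Teichmueller lifts of the terms of \<open>f(y)\<close>; then \<open>a \<in> V A\<^sup>0\<close> and
  \<open>a\<^sup>r \<in> V\<^sup>r A\<^sup>0\<close>.  For vectors \<open>v\<close> of positive exponents put \<open>\<omega>\<^sub>v = x\<^sup>v dlog x\<^sub>0 \<dots> dlog x\<^sub>n\<^sub>-\<^sub>1\<close>, so that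
  \<open>F \<omega>\<^sub>v = \<omega>\<^sub>p\<^sub>v\<close> and \<open>\<omega>\<close> is the form with all exponents \<open>1\<close>.  Multiply \<open>a\<^sup>r\<close> by \<open>\<omega>\<^sub>v\<close> with
  \<open>v = p\<^sup>k - r m0\<close>.  The dominant term becomes \<open>F\<^sup>k\<close> of a unit times \<open>\<omega>\<close>.  Every other term has an
  exponent vector close to \<open>p\<^sup>k\<close> but different from it, which for large \<open>k\<close> is not divisible by
  \<open>p\<^sup>k\<^sup>-\<^sup>r\<close>; such a form is \<open>F\<^sup>e\<close> of an exact form with \<open>e < k - r\<close> and hence lies in
  \<open>F\<^sup>k (dV\<^sup>r A)\<close>.  The total lies in \<open>V\<^sup>r A\<close> and is closed, so it is \<open>p\<^sup>r F\<^sup>k\<close> of something.  Cancelling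
  \<open>F\<^sup>k\<close> gives \<open>\<omega> \<in> V\<^sup>r A + dV\<^sup>r A\<close> for every \<open>r\<close>, that is, \<open>\<omega> = 0\<close>.
  Perfectness of \<open>k\<close> enters through the coefficients: they have \<open>p\<^sup>k\<close>-th roots for all \<open>k\<close> and are
  therefore constants for \<open>d\<close>.

  It remains to pass from the generators to all of \<open>A\<^sup>n\<close>.  Saturation divides by \<open>p\<close> and by \<open>F\<close>, and completion takes limits,
  so the vanishing of products of generators must be spread to a subalgebra closed under all these
  operations.  A bicommutant argument (locale \<open>annihilating_generators\<close>) does this: the set \<open>T\<close> of
  elements that annihilate, in total degree at least \<open>n\<close>, everything that annihilates the products of
  the \<open>dV\<^sup>b[r]\<close> is a subalgebra with the required closure properties, it contains the \<open>[r]\<close>, and it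
  is zero in degrees at least \<open>n\<close>.  Such a subalgebra is itself a strict Dieudonne algebra through
  which \<open>R \<rightarrow> A\<^sup>0 / V A\<^sup>0\<close> factors, so by the universal property it is all of \<open>A\<close> (lemma
  \<open>universal_generation\<close>).
\<close>

section \<open>Graded abelian groups\<close>

inductive_set hspan :: "'a dieudonne \<Rightarrow> (int \<Rightarrow> 'a set) \<Rightarrow> 'a set"
  for M :: "'a dieudonne" and S :: "int \<Rightarrow> 'a set" where
    zero: "\<zero>\<^bsub>M\<^esub> \<in> hspan M S"
  | add: "a \<in> S n \<Longrightarrow> x \<in> hspan M S \<Longrightarrow> a \<oplus>\<^bsub>M\<^esub> x \<in> hspan M S"

locale graded_abelian_group =
  fixes M :: "'a dieudonne" (structure)
  assumes graded: "graded_group M"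
begin

sublocale abelian_group M
  using graded by (simp add: graded_group_def)

abbreviation gr :: "int \<Rightarrow> 'a set" where "gr \<equiv> grade M"

lemma gr_subgroup: "subgroup (gr n) (add_monoid M)"
  using graded by (simp add: graded_group_def)

lemma gr_carrier: "x \<in> gr n \<Longrightarrow> x \<in> carrier M"
  using subgroup.subset[OF gr_subgroup] by auto

lemma gr_zero [simp, intro]: "\<zero> \<in> gr n"
  using subgroup.one_closed[OF gr_subgroup] by simp

lemma gr_add [intro]: "x \<in> gr n \<Longrightarrow> y \<in> gr n \<Longrightarrow> x \<oplus> y \<in> gr n"
  using subgroup.m_closed[OF gr_subgroup] by simp

lemma gr_neg [intro]: "x \<in> gr n \<Longrightarrow> \<ominus> x \<in> gr n"
  using subgroup.m_inv_closed[OF gr_subgroup] by (simp add: a_inv_def)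

lemma gr_minus [intro]: "x \<in> gr n \<Longrightarrow> y \<in> gr n \<Longrightarrow> x \<ominus> y \<in> gr n"
  by (simp add: a_minus_def gr_add gr_neg)

lemma gr_smult [intro]: "x \<in> gr n \<Longrightarrow> [(k::nat)] \<cdot> x \<in> gr n"
  by (induction k) (auto simp: add.nat_pow_Suc)

lemma hspan_closed:
  assumes "\<And>n. S n \<subseteq> gr n" and "x \<in> hspan M S" shows "x \<in> carrier M"
  using assms(2)
proof induction
  case (add a n x)
  have "a \<in> gr n" using add(1) assms(1) by blast
  then show ?case using add.IH gr_carrier by blast
qed (rule zero_closed)

lemma hspan_gr: "hspan M gr = carrier M"
proof
  show "hspan M gr \<subseteq> carrier M" using hspan_closed[of gr] by auto
  show "carrier M \<subseteq> hspan M gr"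
  proof
    fix x assume "x \<in> carrier M"
    then obtain f where f: "\<And>n. f n \<in> gr n" "finite {n. f n \<noteq> \<zero>}"
      "x = finsum M f {n. f n \<noteq> \<zero>}"
      using graded unfolding graded_group_def by metis
    have "finsum M f N \<in> hspan M gr" if "finite N" for N
      using that
    proof (induction N)
      case empty then show ?case by (simp add: hspan.zero)
    next
      case (insert n N)
      have "f \<in> N \<rightarrow> carrier M" "f n \<in> carrier M" using f(1) gr_carrier by auto
      then have "finsum M f (insert n N) = f n \<oplus> finsum M f N"
        using insert by (intro finsum_insert) auto
      then show ?case using insert.IH f(1) hspan.add by metis
    qed
    then show "x \<in> hspan M gr" using f by simp
  qed
qed

lemma homogeneous_induct [consumes 1, case_names zero add]:
  assumes "x \<in> carrier M"
    and "P \<zero>" and "\<And>a n x. a \<in> gr n \<Longrightarrow> x \<in> carrier M \<Longrightarrow> P x \<Longrightarrow> P (a \<oplus> x)"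
  shows "P x"
proof -
  have "x \<in> hspan M gr" using assms(1) by (simp add: hspan_gr)
  then have "P x \<and> x \<in> carrier M"
    by induction (use assms(2,3) gr_carrier in auto)
  then show ?thesis ..
qed

text \<open>
  The decomposition into homogeneous components.  It carries statements about one degree, such as
  the axioms of saturation, to the whole carrier.
\<close>

definition component :: "'a \<Rightarrow> int \<Rightarrow> 'a" where
  "component x = (THE f. (\<forall>n. f n \<in> gr n) \<and> finite {n. f n \<noteq> \<zero>} \<and>
     x = finsum M f {n. f n \<noteq> \<zero>})"

lemma component_spec:
  assumes "x \<in> carrier M"
  shows "component x n \<in> gr n" "finite {n. component x n \<noteq> \<zero>}"
    "x = finsum M (component x) {n. component x n \<noteq> \<zero>}"
proof -
  have "\<exists>!f. (\<forall>n. f n \<in> gr n) \<and> finite {n. f n \<noteq> \<zero>} \<and> x = finsum M f {n. f n \<noteq> \<zero>}"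
    using graded assms unfolding graded_group_def by blast
  from theI'[OF this] show "component x n \<in> gr n" "finite {n. component x n \<noteq> \<zero>}"
    "x = finsum M (component x) {n. component x n \<noteq> \<zero>}"
    unfolding component_def by auto
qed

lemma finsum_support:
  assumes "finite N" "\<And>n. f n \<in> carrier M" "\<And>n. n \<notin> N \<Longrightarrow> f n = \<zero>"
  shows "finsum M f {n. f n \<noteq> \<zero>} = finsum M f N"
  using assms by (intro add.finprod_mono_neutral_cong_left) auto

lemma component_unique:
  assumes "finite N" "\<And>n. f n \<in> gr n" "\<And>n. n \<notin> N \<Longrightarrow> f n = \<zero>" "x = finsum M f N"
  shows "component x = f"
proof -
  have fc: "f n \<in> carrier M" for n using assms(2) gr_carrier by blast
  have x: "x \<in> carrier M" using assms(4) fc by (auto intro!: finsum_closed)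
  have fin: "finite {n. f n \<noteq> \<zero>}"
    by (rule finite_subset[OF _ assms(1)]) (use assms(3) in auto)
  have "x = finsum M f {n. f n \<noteq> \<zero>}"
    using finsum_support[of N f] assms fc by simp
  moreover have "\<exists>!f. (\<forall>n. f n \<in> gr n) \<and> finite {n. f n \<noteq> \<zero>} \<and> x = finsum M f {n. f n \<noteq> \<zero>}"
    using graded x unfolding graded_group_def by blast
  ultimately show ?thesis unfolding component_def
    using fin assms(2) by (intro the1_equality) auto
qed

lemma component_homogeneous:
  assumes "a \<in> gr n" shows "component a = (\<lambda>m. if m = n then a else \<zero>)"
  using assms gr_carrier by (intro component_unique[of "{n}"]) auto

lemma component_zero: "component \<zero> n = \<zero>"
  using component_homogeneous[of \<zero> n] by simp

lemma component_add:
  assumes "x \<in> carrier M" "y \<in> carrier M"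
  shows "component (x \<oplus> y) n = component x n \<oplus> component y n"
proof -
  let ?N = "{n. component x n \<noteq> \<zero>} \<union> {n. component y n \<noteq> \<zero>}"
  have c: "component x n \<in> carrier M" "component y n \<in> carrier M" for n
    using component_spec assms gr_carrier by blast+
  have fin: "finite ?N" using component_spec assms by auto
  have x: "x = finsum M (component x) ?N"
    using component_spec(3)[OF assms(1)] finsum_support[OF fin, of "component x"] c(1) by fastforce
  have y: "y = finsum M (component y) ?N"
    using component_spec(3)[OF assms(2)] finsum_support[OF fin, of "component y"] c(2) by fastforce
  have "finsum M (\<lambda>n. component x n \<oplus> component y n) ?N = finsum M (component x) ?N \<oplus> finsum M (component y) ?N"
    by (rule finsum_addf) (use c in auto)
  then have "x \<oplus> y = finsum M (\<lambda>n. component x n \<oplus> component y n) ?N"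
    using x y by metis
  then have "component (x \<oplus> y) = (\<lambda>n. component x n \<oplus> component y n)"
    using c component_spec(1) assms by (intro component_unique[OF fin]) auto
  then show ?thesis by simp
qed

lemma component_eq_zero_imp:
  assumes "x \<in> carrier M" "\<And>n. component x n = \<zero>" shows "x = \<zero>"
  using component_spec(3)[OF assms(1)] assms(2) by simp

text \<open>
  This makes the span of a family of subgroups \<open>S n\<close> of the graded pieces a graded subgroup again:
  its elements of degree \<open>n\<close> are those of \<open>S n\<close>.
\<close>

lemma component_in_hspan:
  assumes S: "\<And>n. S n \<subseteq> gr n" "\<And>n. \<zero> \<in> S n" "\<And>n x y. x \<in> S n \<Longrightarrow> y \<in> S n \<Longrightarrow> x \<oplus> y \<in> S n"
    and x: "x \<in> hspan M S"
  shows "component x n \<in> S n"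
  using x
proof induction
  case zero then show ?case by (simp add: component_zero S)
next
  case (add a m x)
  have "a \<in> gr m" using add S by auto
  moreover have "x \<in> carrier M" using hspan_closed[OF S(1) add(2)] .
  moreover have "component x n \<in> carrier M" using add.IH S(1) gr_carrier by blast
  ultimately show ?case
    using add S by (auto simp: component_add gr_carrier component_homogeneous)
qed

definition additive :: "('a \<Rightarrow> 'a) \<Rightarrow> bool" where
  "additive T \<longleftrightarrow> (\<forall>x\<in>carrier M. T x \<in> carrier M) \<and>
     (\<forall>x\<in>carrier M. \<forall>y\<in>carrier M. T (x \<oplus> y) = T x \<oplus> T y)"

lemma additive_iff_hom: "additive T \<longleftrightarrow> T \<in> hom (add_monoid M) (add_monoid M)"
  by (auto simp: additive_def hom_def)

lemma additive_closed: "additive T \<Longrightarrow> x \<in> carrier M \<Longrightarrow> T x \<in> carrier M"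
  by (simp add: additive_def)

lemma additive_add:
  "additive T \<Longrightarrow> x \<in> carrier M \<Longrightarrow> y \<in> carrier M \<Longrightarrow> T (x \<oplus> y) = T x \<oplus> T y"
  by (simp add: additive_def)

lemma additive_zero: "additive T \<Longrightarrow> T \<zero> = \<zero>"
  using additive_add[of T \<zero> \<zero>] additive_closed[of T \<zero>] add.l_cancel_one' by fastforce

lemma additive_neg:
  assumes "additive T" "x \<in> carrier M" shows "T (\<ominus> x) = \<ominus> T x"
proof -
  have "T (\<ominus> x) \<oplus> T x = \<zero>"
    using additive_add[OF assms(1), of "\<ominus> x" x] assms by (simp add: l_neg additive_zero)
  then show ?thesis using assms additive_closed minus_equality by fastforce
qed

lemma additive_minus:
  "additive T \<Longrightarrow> x \<in> carrier M \<Longrightarrow> y \<in> carrier M \<Longrightarrow> T (x \<ominus> y) = T x \<ominus> T y"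
  by (simp add: a_minus_def additive_add additive_neg)

lemma additive_smult:
  "additive T \<Longrightarrow> x \<in> carrier M \<Longrightarrow> T ([(k::nat)] \<cdot> x) = [k] \<cdot> T x"
  by (induction k) (auto simp: additive_zero additive_add add.nat_pow_Suc)

lemma additive_funpow: "additive T \<Longrightarrow> additive (T ^^ k)"
  by (induction k) (auto simp: additive_def)

lemma additive_scalar: "additive (\<lambda>x. [(k::nat)] \<cdot> x)"
  by (simp add: additive_def add.nat_pow_distrib)

lemma component_graded_map:
  assumes T: "additive T" "\<And>n x. x \<in> gr n \<Longrightarrow> T x \<in> gr (n + e)" and x: "x \<in> carrier M"
  shows "component (T x) (n + e) = T (component x n)"
  using x
proof (induction x rule: homogeneous_induct)
  case zero then show ?case by (simp add: component_zero additive_zero T)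
next
  case (add a m x)
  have "a \<in> carrier M" using add gr_carrier by blast
  moreover have "component x n \<in> carrier M" using component_spec(1) add gr_carrier by blast
  ultimately show ?case
    using add T(1)
    by (auto simp: component_add additive_add additive_closed component_homogeneous[OF add(1)]
        component_homogeneous[OF T(2)[OF add(1)]] additive_zero)
qed

lemma component_smult: "x \<in> carrier M \<Longrightarrow> component ([(k::nat)] \<cdot> x) n = [k] \<cdot> component x n"
  using component_graded_map[OF additive_scalar, of k 0 x n] by auto

lemma minus_eq_zero_iff: "x \<in> carrier M \<Longrightarrow> y \<in> carrier M \<Longrightarrow> x \<ominus> y = \<zero> \<longleftrightarrow> x = y"
  by (metis a_inv_closed a_minus_def minus_equality minus_minus r_neg)

lemma smult_smult: "x \<in> carrier M \<Longrightarrow> [(a::nat)] \<cdot> ([(b::nat)] \<cdot> x) = [(a * b)] \<cdot> x"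
  by (metis add.nat_pow_pow mult.commute)

lemma add_minus_cancel: "x \<in> carrier M \<Longrightarrow> y \<in> carrier M \<Longrightarrow> y \<oplus> (x \<ominus> y) = x"
  using a_lcomm[of y x "\<ominus> y"] by (simp add: a_minus_def r_neg)

end

section \<open>Saturated Dieudonne complexes\<close>

locale saturated_complex =
  fixes p :: nat and M :: "'a dieudonne" (structure)
  assumes prime_p: "Factorial_Ring.prime p"
    and sat: "saturated p M"
begin

lemma complex: "dieudonne_complex p M"
  using sat by (simp add: saturated_def)

sublocale graded_abelian_group M
  using complex by unfold_locales (simp add: dieudonne_complex_def)

abbreviation "d \<equiv> diff M"
abbreviation "F \<equiv> frob M"
abbreviation "V \<equiv> verschiebung p M"
abbreviation "N \<equiv> V_fil p M"

lemma p_pos: "p > 0" using prime_p by (simp add: prime_gt_0_nat)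

lemma d_additive: "additive d" and F_additive: "additive F"
  using complex by (simp_all add: dieudonne_complex_def graded_map_def additive_iff_hom)

lemma d_gr: "x \<in> gr n \<Longrightarrow> d x \<in> gr (n + 1)"
  using complex unfolding dieudonne_complex_def graded_map_def by blast

lemma F_gr: "x \<in> gr n \<Longrightarrow> F x \<in> gr n"
  using complex unfolding dieudonne_complex_def graded_map_def image_subset_iff by simp

lemmas d_closed = additive_closed[OF d_additive]
lemmas d_add = additive_add[OF d_additive]
lemmas F_closed = additive_closed[OF F_additive]
lemmas F_add = additive_add[OF F_additive]

lemma d_d: "x \<in> carrier M \<Longrightarrow> d (d x) = \<zero>"
  and d_F: "x \<in> carrier M \<Longrightarrow> d (F x) = [p] \<cdot> F (d x)"
  using complex by (auto simp: dieudonne_complex_def)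

lemma torsion_free:
  assumes "x \<in> carrier M" "[p] \<cdot> x = \<zero>" shows "x = \<zero>"
proof (rule component_eq_zero_imp[OF assms(1)])
  fix n
  have "[p] \<cdot> component x n = \<zero>"
    using component_smult[of x p n] assms by (simp add: component_zero)
  then show "component x n = \<zero>"
    using sat component_spec(1)[OF assms(1)] unfolding saturated_def by blast
qed

lemma torsion_free_pow:
  "x \<in> carrier M \<Longrightarrow> [(p ^ k)] \<cdot> x = \<zero> \<Longrightarrow> x = \<zero>"
proof (induction k)
  case (Suc k)
  have "[p] \<cdot> ([(p ^ k)] \<cdot> x) = \<zero>" using Suc.prems by (simp add: smult_smult)
  then have "[(p ^ k)] \<cdot> x = \<zero>" by (rule torsion_free[rotated]) (simp add: Suc.prems)
  then show ?case by (rule Suc.IH[OF Suc.prems(1)])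
qed simp

lemma cancel_p:
  assumes "x \<in> carrier M" "y \<in> carrier M" "[(p ^ k)] \<cdot> x = [(p ^ k)] \<cdot> y" shows "x = y"
  using torsion_free_pow[of "x \<ominus> y" k] assms
  by (simp add: additive_minus[OF additive_scalar] minus_eq_zero_iff)

lemma F_eq_zero:
  assumes "x \<in> carrier M" "F x = \<zero>" shows "x = \<zero>"
proof (rule component_eq_zero_imp[OF assms(1)])
  fix n
  have inj: "inj_on F (gr n)" using sat by (simp add: saturated_def bij_betw_def)
  have "F (component x n) = component (F x) n"
    using component_graded_map[OF F_additive, of 0 x n] F_gr assms(1) by simp
  also have "\<dots> = F \<zero>" using assms(2) by (simp add: component_zero additive_zero[OF F_additive])
  finally show "component x n = \<zero>"
    using inj component_spec(1)[OF assms(1)] by (auto dest: inj_onD)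
qed

lemma F_inj: "inj_on F (carrier M)"
  by (rule inj_onI)
    (metis F_eq_zero additive_minus[OF F_additive] minus_closed minus_eq_zero_iff F_closed)

lemma F_surj:
  assumes "x \<in> gr n" "y \<in> gr (n + 1)" "d x = [p] \<cdot> y"
  obtains z where "z \<in> gr n" "x = F z"
proof -
  have "bij_betw F (gr n) {x \<in> gr n. d x \<in> (\<lambda>y. [p] \<cdot> y) ` gr (n + 1)}"
    using sat by (simp add: saturated_def)
  then have "x \<in> F ` gr n" using assms by (auto simp: bij_betw_def)
  then show ?thesis using that by auto
qed

text \<open>
  The Verschiebung exists because \<open>d (p x)\<close> is divisible by \<open>p\<close>, so that saturation provides an
  \<open>F\<close>-preimage of \<open>p x\<close>.
\<close>

lemma ex_F_preimage_gr:
  assumes "x \<in> gr n" shows "\<exists>z\<in>gr n. F z = [p] \<cdot> x"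
  using F_surj[of "[p] \<cdot> x" n "d x"] assms d_gr gr_smult
  by (metis additive_smult[OF d_additive] gr_carrier)

lemma ex_F_preimage:
  assumes "x \<in> carrier M" shows "\<exists>z\<in>carrier M. F z = [p] \<cdot> x"
  using assms
proof (induction x rule: homogeneous_induct)
  case zero then show ?case using additive_zero[OF F_additive] by force
next
  case (add a n x)
  then obtain z w where "z \<in> carrier M" "F z = [p] \<cdot> x" "w \<in> carrier M" "F w = [p] \<cdot> a"
    using ex_F_preimage_gr gr_carrier by meson
  then show ?case using add gr_carrier
    by (intro bexI[of _ "w \<oplus> z"]) (auto simp: F_add add.nat_pow_distrib)
qed

lemma V_spec:
  "V \<in> extensional (carrier M) \<and> graded_map M 0 V \<and>
     (\<forall>x\<in>carrier M. F (V x) = [p] \<cdot> x \<and> V (F x) = [p] \<cdot> x)"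
proof -
  define W where "W = restrict (\<lambda>x. inv_into (carrier M) F ([p] \<cdot> x)) (carrier M)"
  have W: "W x \<in> carrier M" "F (W x) = [p] \<cdot> x" if "x \<in> carrier M" for x
  proof -
    have "[p] \<cdot> x \<in> F ` carrier M" using ex_F_preimage[OF that] by force
    then show "W x \<in> carrier M" "F (W x) = [p] \<cdot> x"
      using that by (auto simp: W_def inv_into_into f_inv_into_f)
  qed
  have Weq: "W x = z" if "x \<in> carrier M" "z \<in> carrier M" "F z = [p] \<cdot> x" for x z
    using F_inj W that by (metis inj_onD)
  have "W \<in> extensional (carrier M) \<and> graded_map M 0 W \<and>
     (\<forall>x\<in>carrier M. F (W x) = [p] \<cdot> x \<and> W (F x) = [p] \<cdot> x)"
  proof (intro conjI ballI)
    show "W \<in> extensional (carrier M)" by (simp add: W_def)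
    have "additive W"
      unfolding additive_def using W by (auto intro!: Weq simp: F_add add.nat_pow_distrib)
    moreover have "W x \<in> gr n" if x: "x \<in> gr n" for x n
      using ex_F_preimage_gr[OF x] Weq gr_carrier x by blast
    ultimately show "graded_map M 0 W" by (auto simp: graded_map_def additive_iff_hom)
    fix x assume x: "x \<in> carrier M"
    show "F (W x) = [p] \<cdot> x" using W x by simp
    show "W (F x) = [p] \<cdot> x"
      using x by (intro Weq) (auto simp: F_closed additive_smult[OF F_additive])
  qed
  moreover have "U = W" if "U \<in> extensional (carrier M) \<and> graded_map M 0 U \<and>
     (\<forall>x\<in>carrier M. F (U x) = [p] \<cdot> x \<and> U (F x) = [p] \<cdot> x)" for U
  proof (rule extensionalityI[of U "carrier M" W])
    have U: "additive U" using that by (simp add: graded_map_def additive_iff_hom)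
    show "U x = W x" if x: "x \<in> carrier M" for x
      using Weq[OF x additive_closed[OF U x]] \<open>U \<in> _ \<and> _\<close> x by simp
  qed (use that in \<open>simp_all add: W_def\<close>)
  ultimately show ?thesis unfolding verschiebung_def by (rule theI)
qed

lemma V_additive: "additive V"
  using V_spec by (simp add: graded_map_def additive_iff_hom)

lemma V_gr: "x \<in> gr n \<Longrightarrow> V x \<in> gr n"
  using V_spec unfolding graded_map_def image_subset_iff by simp

lemmas V_closed = additive_closed[OF V_additive]
lemmas V_add = additive_add[OF V_additive]

lemma F_V: "x \<in> carrier M \<Longrightarrow> F (V x) = [p] \<cdot> x"
  and V_F: "x \<in> carrier M \<Longrightarrow> V (F x) = [p] \<cdot> x"
  using V_spec by auto

lemma V_eqI: "x \<in> carrier M \<Longrightarrow> z \<in> carrier M \<Longrightarrow> F z = [p] \<cdot> x \<Longrightarrow> V x = z"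
  using F_inj F_V V_closed by (metis inj_onD)

lemma F_d_V: assumes "x \<in> carrier M" shows "F (d (V x)) = d x"
proof (rule cancel_p[of _ _ 1])
  show "[(p ^ 1)] \<cdot> F (d (V x)) = [(p ^ 1)] \<cdot> d x"
    using d_F[of "V x"] assms by (simp add: V_closed F_V additive_smult[OF d_additive])
qed (use assms in \<open>auto simp: d_closed V_closed F_closed\<close>)

lemmas Fk_additive = additive_funpow[OF F_additive]
lemmas Vk_additive = additive_funpow[OF V_additive]
lemmas Fk_closed = additive_closed[OF Fk_additive]
lemmas Vk_closed = additive_closed[OF Vk_additive]

lemma Fk_gr: "x \<in> gr n \<Longrightarrow> (F ^^ k) x \<in> gr n"
  by (induction k) (auto intro: F_gr)

lemma Vk_gr: "x \<in> gr n \<Longrightarrow> (V ^^ k) x \<in> gr n"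
  by (induction k) (auto intro: V_gr)

lemma Fk_inj: "inj_on (F ^^ k) (carrier M)"
proof (induction k)
  case (Suc k)
  show ?case
    using comp_inj_on[OF Suc inj_on_subset[OF F_inj]] Fk_closed
    by (simp add: image_subsetI o_def)
qed simp

lemma Fk_eq_zero: "x \<in> carrier M \<Longrightarrow> (F ^^ k) x = \<zero> \<Longrightarrow> x = \<zero>"
  using Fk_inj[of k] additive_zero[OF Fk_additive] by (metis inj_onD zero_closed)

lemma d_Fk: "x \<in> carrier M \<Longrightarrow> d ((F ^^ k) x) = [(p ^ k)] \<cdot> (F ^^ k) (d x)"
  by (induction k)
    (simp_all add: d_F Fk_closed d_closed additive_smult[OF F_additive] smult_smult F_closed)

lemma Fk_Vk: "x \<in> carrier M \<Longrightarrow> (F ^^ k) ((V ^^ k) x) = [(p ^ k)] \<cdot> x"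
proof (induction k arbitrary: x)
  case (Suc k)
  have "(F ^^ Suc k) ((V ^^ Suc k) x) = (F ^^ k) (F (V ((V ^^ k) x)))"
    by (simp add: funpow_swap1[of F])
  then show ?case using Suc
    by (simp add: F_V Vk_closed additive_smult[OF Fk_additive] smult_smult)
qed simp

lemma Vk_Fk: "x \<in> carrier M \<Longrightarrow> (V ^^ k) ((F ^^ k) x) = [(p ^ k)] \<cdot> x"
proof (induction k arbitrary: x)
  case (Suc k)
  have "(V ^^ Suc k) ((F ^^ Suc k) x) = (V ^^ k) (V (F ((F ^^ k) x)))"
    by (simp add: funpow_swap1[of V])
  then show ?case using Suc
    by (simp add: V_F Fk_closed additive_smult[OF Vk_additive] smult_smult)
qed simp

lemma Fk_d_Vk: "x \<in> carrier M \<Longrightarrow> (F ^^ k) (d ((V ^^ k) x)) = d x"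
proof (induction k arbitrary: x)
  case (Suc k)
  have "(F ^^ Suc k) (d ((V ^^ Suc k) x)) = (F ^^ k) (F (d (V ((V ^^ k) x))))"
    by (simp add: funpow_swap1[of F])
  then show ?case using Suc by (simp add: F_d_V Vk_closed)
qed simp

lemma Vk_d: "x \<in> carrier M \<Longrightarrow> (V ^^ k) (d x) = [(p ^ k)] \<cdot> d ((V ^^ k) x)"
  using Vk_Fk[of "d ((V ^^ k) x)" k] by (simp add: Fk_d_Vk Vk_closed d_closed)

lemma V_F_commute: "x \<in> carrier M \<Longrightarrow> V (F x) = F (V x)"
  by (simp add: V_F F_V)

lemma V_inj: "inj_on V (carrier M)"
  by (rule inj_onI) (metis F_V cancel_p[of _ _ 1] power_one_right)

lemma Vk_inj: "inj_on (V ^^ k) (carrier M)"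
proof (induction k)
  case (Suc k)
  show ?case
    using comp_inj_on[OF Suc inj_on_subset[OF V_inj]] Vk_closed
    by (simp add: image_subsetI o_def)
qed simp

text \<open>
  On closed elements \<open>F\<close> is bijective: zero is divisible by \<open>p\<close>, and the preimage is closed again
  because \<open>p F d = d F\<close> and \<open>F\<close> and \<open>p\<close> are injective.
\<close>

lemma closed_Fk:
  assumes "x \<in> gr n" "d x = \<zero>"
  obtains z where "z \<in> gr n" "d z = \<zero>" "x = (F ^^ k) z"
proof -
  have "\<exists>z\<in>gr n. d z = \<zero> \<and> x = (F ^^ k) z"
  proof (induction k)
    case 0 then show ?case using assms by auto
  next
    case (Suc k)
    then obtain z where z: "z \<in> gr n" "d z = \<zero>" "x = (F ^^ k) z" by auto
    obtain w where w: "w \<in> gr n" "z = F w"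
      using F_surj[of z n \<zero>] z by auto
    have "[p] \<cdot> F (d w) = \<zero>" using z w d_F gr_carrier by metis
    then have "d w = \<zero>"
      using w gr_carrier by (meson F_closed F_eq_zero d_closed torsion_free)
    then show ?case using w z by (auto simp: funpow_Suc_right simp del: funpow.simps)
  qed
  then show ?thesis using that by blast
qed

lemma N_iff: "z \<in> N r \<longleftrightarrow> (\<exists>a\<in>carrier M. \<exists>b\<in>carrier M. z = (V ^^ r) a \<oplus> d ((V ^^ r) b))"
  unfolding V_fil_def set_add_def' by blast

lemma N_closed: "z \<in> N r \<Longrightarrow> z \<in> carrier M"
  by (auto simp: N_iff Vk_closed d_closed)

lemma N_add:
  assumes "x \<in> N r" "y \<in> N r" shows "x \<oplus> y \<in> N r"
proof -
  obtain a b a' b' where ab: "a \<in> carrier M" "b \<in> carrier M" "x = (V ^^ r) a \<oplus> d ((V ^^ r) b)"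
    "a' \<in> carrier M" "b' \<in> carrier M" "y = (V ^^ r) a' \<oplus> d ((V ^^ r) b')"
    using assms unfolding N_iff by blast
  have "x \<oplus> y = (V ^^ r) (a \<oplus> a') \<oplus> d ((V ^^ r) (b \<oplus> b'))"
    using ab by (simp add: additive_add[OF Vk_additive] d_add Vk_closed d_closed a_ac)
  then show ?thesis using ab unfolding N_iff by blast
qed

lemma N_neg:
  assumes "x \<in> N r" shows "\<ominus> x \<in> N r"
proof -
  obtain a b where ab: "a \<in> carrier M" "b \<in> carrier M" "x = (V ^^ r) a \<oplus> d ((V ^^ r) b)"
    using assms unfolding N_iff by blast
  have "\<ominus> x = (V ^^ r) (\<ominus> a) \<oplus> d ((V ^^ r) (\<ominus> b))"
    using ab by (simp add: additive_neg[OF Vk_additive] additive_neg[OF d_additive] minus_add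
        Vk_closed d_closed)
  then show ?thesis using ab unfolding N_iff by blast
qed

lemma N_minus: "x \<in> N r \<Longrightarrow> y \<in> N r \<Longrightarrow> x \<ominus> y \<in> N r"
  by (simp add: a_minus_def N_add N_neg)

lemma N_V: "a \<in> carrier M \<Longrightarrow> (V ^^ r) a \<in> N r"
  unfolding N_iff using additive_zero[OF Vk_additive] additive_zero[OF d_additive]
  by (intro bexI[of _ a] bexI[of _ \<zero>]) (auto simp: Vk_closed)

lemma N_dV: "b \<in> carrier M \<Longrightarrow> d ((V ^^ r) b) \<in> N r"
  unfolding N_iff using additive_zero[OF Vk_additive]
  by (intro bexI[of _ b] bexI[of _ \<zero>]) (auto simp: Vk_closed d_closed)

lemma N_zero: "\<zero> \<in> N r"
  using N_V[of \<zero> r] by (simp add: additive_zero[OF Vk_additive])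

lemma N_0: "N 0 = carrier M"
  using N_V[of _ 0] N_closed by auto

lemma N_p: "a \<in> carrier M \<Longrightarrow> [(p ^ r)] \<cdot> a \<in> N r"
  using N_V[of "(F ^^ r) a" r] by (simp add: Vk_Fk Fk_closed)

lemma N_smult: "x \<in> N r \<Longrightarrow> [(k::nat)] \<cdot> x \<in> N r"
  by (induction k) (auto simp: N_zero N_add add.nat_pow_Suc)

lemma N_mono: assumes "r \<le> s" shows "N s \<subseteq> N r"
proof
  fix x assume "x \<in> N s"
  then obtain a b where ab: "a \<in> carrier M" "b \<in> carrier M" "x = (V ^^ s) a \<oplus> d ((V ^^ s) b)"
    unfolding N_iff by blast
  have "(V ^^ s) c = (V ^^ r) ((V ^^ (s - r)) c)" for c
    using assms by (metis funpow_add le_add_diff_inverse o_apply)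
  then show "x \<in> N r" using ab N_iff Vk_closed by metis
qed

lemma d_N: assumes "x \<in> N r" shows "d x \<in> N r"
proof -
  obtain a b where ab: "a \<in> carrier M" "b \<in> carrier M" "x = (V ^^ r) a \<oplus> d ((V ^^ r) b)"
    using assms unfolding N_iff by blast
  then have "d x = d ((V ^^ r) a)" by (simp add: d_add Vk_closed d_closed d_d)
  then show ?thesis using N_dV ab by simp
qed

lemma Vk_N: assumes "x \<in> N r" shows "(V ^^ k) x \<in> N (k + r)"
proof -
  obtain a b where ab: "a \<in> carrier M" "b \<in> carrier M" "x = (V ^^ r) a \<oplus> d ((V ^^ r) b)"
    using assms unfolding N_iff by blast
  then have "(V ^^ k) x = (V ^^ (k + r)) a \<oplus> [(p ^ k)] \<cdot> d ((V ^^ (k + r)) b)"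
    by (simp add: additive_add[OF Vk_additive] Vk_closed d_closed Vk_d funpow_add)
  then show ?thesis using ab by (simp add: N_add N_V N_smult N_dV)
qed

text \<open>
  \<open>N r\<close> contains \<open>p\<^sup>r M\<close>, since \<open>p\<^sup>r = V\<^sup>r F\<^sup>r\<close>; so Bezout's identity for \<open>w\<close> and \<open>p\<^sup>r\<close> applies.
\<close>

lemma N_coprime:
  assumes "x \<in> carrier M" "[(w::nat)] \<cdot> x \<in> N r" "coprime w p" shows "x \<in> N r"
proof -
  have "\<exists>a b. w * a = Suc (p ^ r * b)"
  proof (cases "p ^ r = 1")
    case True
    have "w \<noteq> 0"
      using assms(3) prime_gt_1_nat[OF prime_p] by (cases "w = 0") auto
    then show ?thesis using True by (intro exI[of _ 1] exI[of _ "w - 1"]) auto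
  next
    case False
    then show ?thesis using coprime_bezout_strong[of w "p ^ r"] assms(3) by auto
  qed
  then obtain a b where eq: "w * a = Suc (p ^ r * b)" by blast
  have "[a] \<cdot> ([w] \<cdot> x) = [b] \<cdot> ([(p ^ r)] \<cdot> x) \<oplus> x"
    using assms(1) eq by (simp add: smult_smult mult.commute add.nat_pow_Suc)
  then have "x = [a] \<cdot> ([w] \<cdot> x) \<ominus> [b] \<cdot> ([(p ^ r)] \<cdot> x)"
    using assms(1) by (simp add: a_minus_def a_ac r_neg1 r_neg)
  moreover have "[a] \<cdot> ([w] \<cdot> x) \<ominus> [b] \<cdot> ([(p ^ r)] \<cdot> x) \<in> N r"
    by (intro N_minus N_smult assms N_p)
  ultimately show ?thesis by simp
qed

text \<open>
  The witnesses of membership in \<open>N r\<close> may be taken homogeneous.  Completeness is only available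
  degree by degree, so series of witnesses can be summed only in this form.
\<close>

lemma N_homogeneous:
  assumes "z \<in> gr n" "z \<in> N r"
  obtains a b where "a \<in> gr n" "b \<in> gr (n - 1)" "z = (V ^^ r) a \<oplus> d ((V ^^ r) b)"
proof -
  obtain a b where ab: "a \<in> carrier M" "b \<in> carrier M" "z = (V ^^ r) a \<oplus> d ((V ^^ r) b)"
    using assms(2) unfolding N_iff by blast
  have "z = component z n" using component_homogeneous[OF assms(1)] by simp
  also have "\<dots> = component ((V ^^ r) a) n \<oplus> component (d ((V ^^ r) b)) n"
    using ab by (simp add: component_add Vk_closed d_closed)
  also have "component ((V ^^ r) a) n = (V ^^ r) (component a n)"
    using component_graded_map[OF Vk_additive[of r], of 0 a n] Vk_gr ab by simp
  also have "component (d ((V ^^ r) b)) n = d (component ((V ^^ r) b) (n - 1))"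
    using component_graded_map[OF d_additive, of 1 "(V ^^ r) b" "n - 1"] d_gr ab by (simp add: Vk_closed)
  also have "component ((V ^^ r) b) (n - 1) = (V ^^ r) (component b (n - 1))"
    using component_graded_map[OF Vk_additive[of r], of 0 b "n - 1"] Vk_gr ab by simp
  finally show ?thesis using that component_spec(1) ab by blast
qed

lemma N_cong_trans:
  assumes "x \<in> carrier M" "y \<in> carrier M" "z \<in> carrier M" "x \<ominus> y \<in> N r" "y \<ominus> z \<in> N r"
  shows "x \<ominus> z \<in> N r"
proof -
  have "(x \<ominus> y) \<oplus> (y \<ominus> z) = x \<ominus> z"
    using assms(1-3) by (simp add: a_minus_def a_assoc r_neg1)
  then show ?thesis using N_add[OF assms(4,5)] by simp
qed

lemma N_cong_add:
  assumes "x \<in> carrier M" "y \<in> carrier M" "x' \<in> carrier M" "y' \<in> carrier M"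
    "x \<ominus> y \<in> N r" "x' \<ominus> y' \<in> N r"
  shows "(x \<oplus> x') \<ominus> (y \<oplus> y') \<in> N r"
proof -
  have "(x \<ominus> y) \<oplus> (x' \<ominus> y') = (x \<oplus> x') \<ominus> (y \<oplus> y')"
    using assms(1-4) by (simp add: a_minus_def minus_add a_ac)
  then show ?thesis using N_add[OF assms(5,6)] by simp
qed

lemma N_abelian_subgroup: "abelian_subgroup (N r) M"
proof (rule abelian_subgroupI3)
  show "additive_subgroup (N r) M"
    by (intro additive_subgroupI subgroup.intro)
      (auto simp: N_closed N_add N_zero N_neg a_inv_def[symmetric])
qed (rule abelian_group_axioms)

lemma N_coset_eq_iff:
  assumes "x \<in> carrier M" "y \<in> carrier M"
  shows "N r +> x = N r +> y \<longleftrightarrow> x \<ominus> y \<in> N r"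
proof -
  interpret S: abelian_subgroup "N r" M by (rule N_abelian_subgroup)
  have "N r +> x = N r +> y \<longleftrightarrow> x \<in> N r +> y"
    using S.a_repr_independence'[of x y] S.a_rcos_self[of x] assms by auto
  then show ?thesis
    using assms S.a_rcos_module[of y x] by (simp add: a_minus_def)
qed

lemma minus_zero_right: "x \<in> carrier M \<Longrightarrow> x \<ominus> \<zero> = x"
  using minus_equality[of \<zero> \<zero>] by (simp add: a_minus_def)

section \<open>Strictness in terms of elements\<close>

text \<open>
  The limit of the quotients of \<open>M\<close> consists of sequences of cosets.  The next lemmas restate strictness with
  sequences of representatives: \<open>N\<close> is separated, and sequences that are Cauchy for \<open>N\<close>
  converge.
\<close>

lemma strict_separated:
  assumes "strict p M" "x \<in> gr n" "\<And>r. r \<ge> 1 \<Longrightarrow> x \<in> N r"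
  shows "x = \<zero>"
proof -
  have "inj_on (\<lambda>x. \<lambda>r\<in>{1..}. N r +> x) (gr n)"
    using assms(1) by (simp add: strict_def bij_betw_def)
  moreover have "(\<lambda>r\<in>{1..}. N r +> x) = (\<lambda>r\<in>{1..}. N r +> \<zero>)"
    using assms(2,3) by (intro restrict_ext) (simp add: N_coset_eq_iff gr_carrier minus_zero_right)
  ultimately show ?thesis using assms(2) by (auto dest: inj_onD)
qed

lemma N_coset_absorb:
  assumes "x \<in> carrier M" shows "N r <+>\<^bsub>M\<^esub> (N (Suc r) +> x) = N r +> x"
proof (intro equalityI subsetI)
  fix y assume "y \<in> N r <+>\<^bsub>M\<^esub> (N (Suc r) +> x)"
  then obtain a b where ab: "a \<in> N r" "b \<in> N (Suc r)" "y = a \<oplus> (b \<oplus> x)"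
    by (auto simp: set_add_def' a_r_coset_def')
  then have "a \<oplus> b \<in> N r" using N_mono[of r "Suc r"] by (auto intro: N_add)
  moreover have "y = (a \<oplus> b) \<oplus> x" using ab assms N_closed by (simp add: a_assoc)
  ultimately show "y \<in> N r +> x" by (auto simp: a_r_coset_def')
next
  fix y assume "y \<in> N r +> x"
  then obtain a where "a \<in> N r" "y = a \<oplus> (\<zero> \<oplus> x)"
    using assms by (auto simp: a_r_coset_def')
  then show "y \<in> N r <+>\<^bsub>M\<^esub> (N (Suc r) +> x)"
    using N_zero[of "Suc r"] by (auto simp: set_add_def' a_r_coset_def')
qed

lemma W_lim_iff:
  "s \<in> W_lim p M n \<longleftrightarrow> s \<in> extensional {1..} \<and> (\<forall>r\<ge>1. \<exists>x\<in>gr n. s r = N r +> x) \<and>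
     (\<forall>r\<ge>1. s r = N r <+>\<^bsub>M\<^esub> s (Suc r))"
proof -
  have "(s \<in> (\<Pi>\<^sub>E r\<in>{1..}. W_deg p M r n)) \<longleftrightarrow>
      s \<in> extensional {1..} \<and> (\<forall>r\<ge>1. \<exists>x\<in>gr n. s r = N r +> x)"
    unfolding W_deg_def PiE_iff image_iff by blast
  then show ?thesis unfolding W_lim_def by blast
qed

lemma strict_complete:
  assumes "strict p M" "\<And>r. b r \<in> gr n" "\<And>r. b (Suc r) \<ominus> b r \<in> N r"
  obtains a where "a \<in> gr n" "\<And>r. a \<ominus> b r \<in> N r"
proof -
  define s where "s = (\<lambda>r\<in>{1..}. N r +> b r)"
  have bc: "b r \<in> carrier M" for r using assms(2) gr_carrier by blast
  have eq: "N r +> b r = N r <+>\<^bsub>M\<^esub> (N (Suc r) +> b (Suc r))" for r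
    using N_coset_absorb[OF bc, of r "Suc r"] N_coset_eq_iff[OF bc bc, of r "Suc r" r] assms(3)
    by simp
  have s: "s r = N r +> b r" if "r \<ge> 1" for r using that by (simp add: s_def)
  have "s \<in> W_lim p M n"
    unfolding W_lim_iff
  proof (intro conjI allI impI)
    fix r :: nat assume r: "1 \<le> r"
    show "\<exists>x\<in>gr n. s r = N r +> x" using s[OF r] assms(2) by blast
    show "s r = N r <+>\<^bsub>M\<^esub> s (Suc r)" using s[OF r] s[of "Suc r"] eq[of r] by (simp only: le_SucI r)
  qed (simp add: s_def)
  moreover have "bij_betw (\<lambda>x. \<lambda>r\<in>{1..}. N r +> x) (gr n) (W_lim p M n)"
    using assms(1) by (simp add: strict_def)
  ultimately obtain a where a: "a \<in> gr n" "s = (\<lambda>r\<in>{1..}. N r +> a)"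
    by (auto simp: bij_betw_def)
  have "a \<ominus> b r \<in> N r" for r
  proof (cases "r = 0")
    case True then show ?thesis using a bc gr_carrier by (auto simp: N_0)
  next
    case False
    then have "N r +> a = N r +> b r" using fun_cong[OF a(2), of r] by (simp add: s_def)
    then show ?thesis using N_coset_eq_iff a(1) gr_carrier bc by blast
  qed
  then show ?thesis using that a(1) by blast
qed

lemma strictI:
  assumes sep: "\<And>n x. x \<in> gr n \<Longrightarrow> (\<And>r. x \<in> N r) \<Longrightarrow> x = \<zero>"
    and complete: "\<And>n b. (\<And>r. b r \<in> gr n) \<Longrightarrow> (\<And>r. b (Suc r) \<ominus> b r \<in> N r) \<Longrightarrow>
      \<exists>a\<in>gr n. \<forall>r. a \<ominus> b r \<in> N r"
  shows "strict p M"
  unfolding strict_def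
proof (intro conjI allI sat)
  fix n
  let ?q = "\<lambda>x. \<lambda>r\<in>{1..}. N r +> x"
  show "bij_betw ?q (gr n) (W_lim p M n)"
    unfolding bij_betw_def
  proof (intro conjI inj_onI equalityI subsetI)
    fix x y assume xy: "x \<in> gr n" "y \<in> gr n" "?q x = ?q y"
    have "x \<ominus> y \<in> N r" for r
    proof (cases "r = 0")
      case True then show ?thesis using xy gr_carrier by (auto simp: N_0)
    next
      case False
      then have "N r +> x = N r +> y" using fun_cong[OF xy(3), of r] by simp
      then show ?thesis using N_coset_eq_iff xy gr_carrier by blast
    qed
    then have "x \<ominus> y = \<zero>" using sep[of "x \<ominus> y" n] xy gr_minus by blast
    then show "x = y" using xy gr_carrier minus_eq_zero_iff by blast
  next
    fix s assume "s \<in> ?q ` gr n"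
    then obtain x where "x \<in> gr n" "s = ?q x" by blast
    then show "s \<in> W_lim p M n"
      using N_coset_absorb[OF gr_carrier, of x n] unfolding W_lim_iff
      by (auto simp del: funpow.simps)
  next
    fix s assume s: "s \<in> W_lim p M n"
    then have "\<forall>r. r \<ge> 1 \<longrightarrow> (\<exists>x\<in>gr n. s r = N r +> x)"
      unfolding W_lim_iff by blast
    then obtain b0 where b0: "\<And>r. r \<ge> 1 \<Longrightarrow> b0 r \<in> gr n" "\<And>r. r \<ge> 1 \<Longrightarrow> s r = N r +> b0 r"
      by metis
    define b where "b r = (if r = 0 then \<zero> else b0 r)" for r
    have b: "b r \<in> gr n" for r using b0 by (simp add: b_def)
    have bc: "b r \<in> carrier M" for r using b gr_carrier by blast
    have step: "b (Suc r) \<ominus> b r \<in> N r" for r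
    proof (cases "r = 0")
      case True then show ?thesis using bc by (auto simp: N_0)
    next
      case False
      then have r: "r \<ge> 1" by simp
      have "s r = N r <+>\<^bsub>M\<^esub> s (Suc r)" using s r unfolding W_lim_iff by blast
      moreover have "s r = N r +> b r" "s (Suc r) = N (Suc r) +> b (Suc r)"
        using b0 r by (simp_all add: b_def)
      ultimately have "N r +> b r = N r <+>\<^bsub>M\<^esub> (N (Suc r) +> b (Suc r))" by metis
      then have "N r +> b (Suc r) = N r +> b r" using N_coset_absorb bc by simp
      then show ?thesis using N_coset_eq_iff bc by blast
    qed
    obtain a where a: "a \<in> gr n" "\<And>r. a \<ominus> b r \<in> N r" using complete[OF b step] by blast
    have "s = ?q a"
    proof (rule extensionalityI[of s "{1..}"])
      show "s \<in> extensional {1..}" using s unfolding W_lim_iff by blast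
      fix r :: nat assume "r \<in> {1..}"
      then have "s r = N r +> b r" using b0 by (simp add: b_def)
      moreover have "N r +> a = N r +> b r"
        using N_coset_eq_iff[OF gr_carrier[OF a(1)] bc] a(2) by blast
      ultimately show "s r = ?q a r" using \<open>r \<in> {1..}\<close> by simp
    qed simp
    then show "s \<in> ?q ` gr n" using a by blast
  qed
qed

end

section \<open>Strict Dieudonne algebras\<close>

lemma (in abelian_group) minus_add_cancel_left:
  assumes "q \<in> carrier G" "x \<in> carrier G" "y \<in> carrier G"
  shows "(q \<oplus> x) \<ominus> (q \<oplus> y) = x \<ominus> y"
proof -
  have "(q \<oplus> x) \<oplus> (\<ominus> q \<oplus> \<ominus> y) = (q \<oplus> \<ominus> q) \<oplus> (x \<oplus> \<ominus> y)"
    using assms by (simp add: a_ac)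
  then show ?thesis using assms by (simp add: a_minus_def minus_add r_neg)
qed

text \<open>
  In the application \<open>Suc n = p\<close> and \<open>v \<otimes> v\<close> is divisible by \<open>p\<close>, so that all terms after the first are.
\<close>

lemma (in cring) binomial_expansion_order_two:
  assumes "u \<in> carrier R" "v \<in> carrier R"
  shows "\<exists>h\<in>carrier R. (u \<oplus> v) [^] Suc n = u [^] Suc n \<oplus> [(Suc n)] \<cdot> (u [^] n \<otimes> v) \<oplus> v \<otimes> v \<otimes> h"
proof (induction n)
  case 0
  then show ?case using assms by (intro bexI[of _ \<zero>]) auto
next
  case (Suc n)
  then obtain h where h: "h \<in> carrier R"
    "(u \<oplus> v) [^] Suc n = u [^] Suc n \<oplus> [(Suc n)] \<cdot> (u [^] n \<otimes> v) \<oplus> v \<otimes> v \<otimes> h" by blast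
  define Y where "Y = [(Suc n)] \<cdot> (u [^] n)"
  have Y: "Y \<in> carrier R" "[(Suc n)] \<cdot> (u [^] n \<otimes> v) = Y \<otimes> v"
    using assms by (simp_all add: Y_def add_pow_ldistr del: add.nat_pow_Suc)
  have Yu: "Y \<otimes> u = [(Suc n)] \<cdot> (u [^] Suc n)"
    using assms unfolding Y_def by (simp add: add_pow_ldistr del: add.nat_pow_Suc)
  define W where "W = u [^] Suc n"
  have W: "W \<in> carrier R" using assms by (simp add: W_def)
  have "(u \<oplus> v) [^] Suc (Suc n) = (W \<oplus> Y \<otimes> v \<oplus> v \<otimes> v \<otimes> h) \<otimes> (u \<oplus> v)"
    using h(2) Y(2) by (simp add: W_def)
  also have "\<dots> = W \<otimes> u \<oplus> (Y \<otimes> u \<otimes> v \<oplus> W \<otimes> v) \<oplus> v \<otimes> v \<otimes> (Y \<oplus> h \<otimes> (u \<oplus> v))"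
    using assms h(1) W Y(1) by (simp add: l_distr r_distr a_ac m_ac)
  also have "Y \<otimes> u \<otimes> v \<oplus> W \<otimes> v = [(Suc (Suc n))] \<cdot> (W \<otimes> v)"
    using assms W unfolding Yu W_def[symmetric] by (simp add: add_pow_ldistr l_distr)
  finally show ?case
    using assms h(1) Y(1) unfolding W_def
    by (intro bexI[of _ "Y \<oplus> h \<otimes> (u \<oplus> v)"]) (simp_all del: add.nat_pow_Suc)
qed

locale strict_algebra = saturated_complex p A
  for p :: nat and A :: "'a dieudonne" (structure) +
  assumes strict_alg: "strict_dieudonne_algebra p A"
begin

lemma dalg: "dieudonne_algebra p A" and strict: "strict p A"
  using strict_alg by (simp_all add: strict_dieudonne_algebra_def)

lemma cdga: "cdga A" using dalg by (simp add: dieudonne_algebra_def)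

sublocale ring A using cdga by (simp add: cdga_def)

lemma one_gr: "\<one> \<in> gr 0" using cdga by (simp add: cdga_def)

lemma mult_gr: "x \<in> gr m \<Longrightarrow> y \<in> gr n \<Longrightarrow> x \<otimes> y \<in> gr (m + n)"
  using cdga unfolding cdga_def by blast

lemma graded_comm:
  "x \<in> gr m \<Longrightarrow> y \<in> gr n \<Longrightarrow> y \<otimes> x = (if even (m * n) then x \<otimes> y else \<ominus> (x \<otimes> y))"
  using cdga unfolding cdga_def by blast

lemma odd_square: "odd m \<Longrightarrow> x \<in> gr m \<Longrightarrow> x \<otimes> x = \<zero>"
  using cdga unfolding cdga_def by blast

lemma leibniz:
  "x \<in> gr m \<Longrightarrow> y \<in> carrier A \<Longrightarrow>
    d (x \<otimes> y) = (d x \<otimes> y) \<oplus> (if even m then x \<otimes> d y else \<ominus> (x \<otimes> d y))"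
  using cdga unfolding cdga_def by blast

lemma gr_negative: "n < 0 \<Longrightarrow> gr n = {\<zero>}"
  using dalg by (simp add: dieudonne_algebra_def)

lemma F_ring_hom: "F \<in> ring_hom A A"
  using dalg by (simp add: dieudonne_algebra_def)

lemma F_mult: "x \<in> carrier A \<Longrightarrow> y \<in> carrier A \<Longrightarrow> F (x \<otimes> y) = F x \<otimes> F y"
  using F_ring_hom by (simp add: ring_hom_mult)

lemma F_one: "F \<one> = \<one>"
  using F_ring_hom by (simp add: ring_hom_one)

lemma F_lift:
  assumes "x \<in> gr 0" obtains y where "y \<in> gr 0" "F x = x [^] p \<oplus> [p] \<cdot> y"
  using dalg assms unfolding dieudonne_algebra_def by blast

lemma Fk_mult: "x \<in> carrier A \<Longrightarrow> y \<in> carrier A \<Longrightarrow> (F ^^ k) (x \<otimes> y) = (F ^^ k) x \<otimes> (F ^^ k) y"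
  by (induction k) (simp_all add: F_mult Fk_closed)

lemma Fk_one: "(F ^^ k) \<one> = \<one>"
  by (induction k) (simp_all add: F_one)

lemma Fk_pow: "x \<in> carrier A \<Longrightarrow> (F ^^ k) (x [^] (n::nat)) = (F ^^ k) x [^] n"
  by (induction n) (simp_all add: Fk_one Fk_mult)

lemma comm0: "x \<in> gr 0 \<Longrightarrow> y \<in> gr n \<Longrightarrow> y \<otimes> x = x \<otimes> y"
  using graded_comm[of x 0 y n] by simp

lemma mult_gr0: "x \<in> gr 0 \<Longrightarrow> y \<in> gr n \<Longrightarrow> x \<otimes> y \<in> gr n"
  using mult_gr[of x 0 y n] by simp

lemma mult_gr0': "x \<in> gr n \<Longrightarrow> y \<in> gr 0 \<Longrightarrow> x \<otimes> y \<in> gr n"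
  using mult_gr[of x n y 0] by simp

lemma leibniz0: "x \<in> gr 0 \<Longrightarrow> y \<in> carrier A \<Longrightarrow> d (x \<otimes> y) = d x \<otimes> y \<oplus> x \<otimes> d y"
  using leibniz[of x 0 y] by simp

lemma d_one: "d \<one> = \<zero>"
proof -
  have "d \<one> = d \<one> \<oplus> d \<one>" using leibniz0[OF one_gr, of \<one>] by (simp add: d_closed)
  then show ?thesis by (metis add.l_cancel_one' d_closed one_closed)
qed

abbreviation A0 :: "'a dieudonne" where "A0 \<equiv> A\<lparr>carrier := gr 0\<rparr>"

lemma A0_cring: "cring A0"
proof (rule cringI)
  show "abelian_group A0"
  proof (rule abelian_groupI)
    fix x assume "x \<in> carrier A0"
    then have x: "x \<in> gr 0" by simp
    show "\<exists>y\<in>carrier A0. y \<oplus>\<^bsub>A0\<^esub> x = \<zero>\<^bsub>A0\<^esub>"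
      using x gr_carrier by (intro bexI[of _ "\<ominus> x"]) (auto simp: l_neg)
  next
    fix x y z assume "x \<in> carrier A0" "y \<in> carrier A0" "z \<in> carrier A0"
    then have "x \<in> carrier A" "y \<in> carrier A" "z \<in> carrier A" using gr_carrier by auto
    then show "x \<oplus>\<^bsub>A0\<^esub> y \<oplus>\<^bsub>A0\<^esub> z = x \<oplus>\<^bsub>A0\<^esub> (y \<oplus>\<^bsub>A0\<^esub> z)"
      "x \<oplus>\<^bsub>A0\<^esub> y = y \<oplus>\<^bsub>A0\<^esub> x"
      by (simp_all add: a_ac)
  qed (use gr_carrier in auto)
  show "comm_monoid A0"
  proof (rule comm_monoidI)
    fix x y assume xy: "x \<in> carrier A0" "y \<in> carrier A0"
    show "x \<otimes>\<^bsub>A0\<^esub> y \<in> carrier A0" using mult_gr0[of x y 0] xy by simp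
    show "x \<otimes>\<^bsub>A0\<^esub> y = y \<otimes>\<^bsub>A0\<^esub> x" using comm0[of y x 0] xy by simp
  qed (use gr_carrier one_gr in \<open>auto simp: m_assoc\<close>)
qed (use gr_carrier in \<open>auto simp: l_distr\<close>)

lemma A0_pow: "x [^]\<^bsub>A0\<^esub> (n::nat) = x [^] n"
  by (simp add: nat_pow_def)

lemma A0_smult: "[(n::nat)] \<cdot>\<^bsub>A0\<^esub> x = [n] \<cdot> x"
  by (simp add: add_pow_def nat_pow_def)

lemma pow_gr0: "x \<in> gr 0 \<Longrightarrow> x [^] (n::nat) \<in> gr 0"
  by (induction n) (auto intro: one_gr mult_gr0)

text \<open>
  The projection formula \<open>V(x) y = V(x F(y))\<close>, seen by applying the injective map \<open>F\<^sup>k\<close>.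
\<close>

lemma Vk_projection:
  assumes "x \<in> carrier A" "y \<in> carrier A"
  shows "(V ^^ k) x \<otimes> y = (V ^^ k) (x \<otimes> (F ^^ k) y)"
proof (rule inj_onD[OF Fk_inj[of k]])
  show "(F ^^ k) ((V ^^ k) x \<otimes> y) = (F ^^ k) ((V ^^ k) (x \<otimes> (F ^^ k) y))"
    using assms by (simp add: Fk_mult Fk_Vk Vk_closed Fk_closed add_pow_ldistr)
qed (use assms in \<open>auto simp: Vk_closed Fk_closed\<close>)

lemma Vk_projection_left:
  assumes "x \<in> carrier A" "y \<in> carrier A"
  shows "y \<otimes> (V ^^ k) x = (V ^^ k) ((F ^^ k) y \<otimes> x)"
proof (rule inj_onD[OF Fk_inj[of k]])
  show "(F ^^ k) (y \<otimes> (V ^^ k) x) = (F ^^ k) ((V ^^ k) ((F ^^ k) y \<otimes> x))"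
    using assms by (simp add: Fk_mult Fk_Vk Vk_closed Fk_closed add_pow_rdistr)
qed (use assms in \<open>auto simp: Vk_closed Fk_closed\<close>)

text \<open>
  For \<open>V\<^sup>r b\<close> this is the projection formula, and \<open>s dV\<^sup>r b\<close> equals
  \<open>d(s V\<^sup>r b) - ds V\<^sup>r b\<close> up to sign.  The factor on the left is the homogeneous one because the
  Leibniz rule needs the degree of its left factor only.
\<close>

lemma N_left_ideal:
  assumes s: "s \<in> gr m" and z: "z \<in> N r" shows "s \<otimes> z \<in> N r"
proof -
  have sc: "s \<in> carrier A" using s gr_carrier by blast
  have V: "t \<otimes> (V ^^ r) a \<in> N r" if "t \<in> carrier A" "a \<in> carrier A" for t a
    using Vk_projection_left[OF that(2,1)] that N_V by (simp add: Fk_closed)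
  obtain a b where ab: "a \<in> carrier A" "b \<in> carrier A" "z = (V ^^ r) a \<oplus> d ((V ^^ r) b)"
    using z unfolding N_iff by blast
  let ?v = "(V ^^ r) b"
  have vc: "?v \<in> carrier A" using ab Vk_closed by simp
  have "s \<otimes> d ?v \<in> N r"
  proof (cases "even m")
    case True
    have "d (s \<otimes> ?v) = d s \<otimes> ?v \<oplus> s \<otimes> d ?v" using leibniz[OF s vc] True by simp
    then have "s \<otimes> d ?v = d (s \<otimes> ?v) \<ominus> d s \<otimes> ?v"
      using sc vc by (simp add: d_closed a_minus_def a_ac r_neg1 r_neg r_neg2)
    then show ?thesis using N_minus[OF d_N[OF V[OF sc ab(2)]] V[OF d_closed[OF sc] ab(2)]] by simp
  next
    case False
    have "d (s \<otimes> ?v) = d s \<otimes> ?v \<oplus> \<ominus> (s \<otimes> d ?v)" using leibniz[OF s vc] False by simp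
    then have "s \<otimes> d ?v = d s \<otimes> ?v \<ominus> d (s \<otimes> ?v)"
      using sc vc by (simp add: d_closed a_minus_def minus_add r_neg1 r_neg2)
    then show ?thesis using N_minus[OF V[OF d_closed[OF sc] ab(2)] d_N[OF V[OF sc ab(2)]]] by simp
  qed
  then show ?thesis using ab sc vc V[OF sc ab(1)] by (simp add: r_distr Vk_closed d_closed N_add)
qed

lemma N_separated: "x \<in> gr n \<Longrightarrow> (\<And>r. x \<in> N r) \<Longrightarrow> x = \<zero>"
  using strict_separated[OF strict] by blast

text \<open>
  In degree \<open>0\<close> the part \<open>dV\<^sup>r\<close> of the filtration comes from degree \<open>-1\<close> and disappears.
\<close>

lemma gr0_N: assumes "x \<in> gr 0" "x \<in> N r" obtains a where "a \<in> gr 0" "x = (V ^^ r) a"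
proof -
  obtain a b where ab: "a \<in> gr 0" "b \<in> gr (- 1)" "x = (V ^^ r) a \<oplus> d ((V ^^ r) b)"
    using N_homogeneous[OF assms] by auto
  then have "b = \<zero>" using gr_negative[of "- 1"] by simp
  then have "x = (V ^^ r) a"
    using ab gr_carrier[OF ab(1)] by (simp add: additive_zero[OF Vk_additive] additive_zero[OF d_additive] Vk_closed)
  then show ?thesis using that ab by blast
qed

section \<open>Teichmueller representatives\<close>

text \<open>
  Changing \<open>u\<close> by \<open>V\<^sup>s\<^sup>+\<^sup>1 w\<close> changes \<open>u\<^sup>p\<close> by \<open>p V\<^sup>s\<^sup>+\<^sup>1 h\<close>, one power of \<open>p\<close> better: the linear term
  carries the binomial coefficient \<open>p\<close>, and a product of two elements of \<open>V\<^sup>s\<^sup>+\<^sup>1 A\<^sup>0\<close> is divisible by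
  \<open>p\<close> in \<open>V\<^sup>s\<^sup>+\<^sup>1 A\<^sup>0\<close> by the projection formula.
\<close>

lemma pow_p_perturb:
  assumes "u \<in> gr 0" "w \<in> gr 0"
  obtains h where "h \<in> gr 0"
    "(u \<oplus> (V ^^ Suc s) w) [^] p = u [^] p \<oplus> [p] \<cdot> (V ^^ Suc s) h"
proof -
  let ?v = "(V ^^ Suc s) w"
  interpret Z: cring A0 by (rule A0_cring)
  obtain n where n: "p = Suc n" using p_pos gr0_conv_Suc by auto
  have v: "?v \<in> gr 0" using assms Vk_gr by blast
  have c: "u \<in> carrier A" "w \<in> carrier A" "?v \<in> carrier A" using assms v gr_carrier by auto
  obtain h where h: "h \<in> gr 0"
    "(u \<oplus> ?v) [^] p = u [^] p \<oplus> [p] \<cdot> (u [^] n \<otimes> ?v) \<oplus> ?v \<otimes> ?v \<otimes> h"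
    using Z.binomial_expansion_order_two[of u ?v n] assms(1) v unfolding n by (auto simp: A0_pow A0_smult simp del: funpow.simps add.nat_pow_Suc nat_pow_Suc Z.nat_pow_Suc Z.add.nat_pow_Suc)
  have hc: "h \<in> carrier A" using h gr_carrier by blast
  have 1: "u [^] n \<otimes> ?v = (V ^^ Suc s) ((F ^^ Suc s) (u [^] n) \<otimes> w)"
    using Vk_projection_left[of w "u [^] n" "Suc s"] c by simp
  have "?v \<otimes> ?v \<otimes> h = (V ^^ Suc s) (w \<otimes> (F ^^ Suc s) (?v \<otimes> h))"
    using Vk_projection[of w "?v \<otimes> h" "Suc s"] c hc by (simp only: m_assoc m_closed)
  also have "(F ^^ Suc s) (?v \<otimes> h) = [p] \<cdot> ([(p ^ s)] \<cdot> (w \<otimes> (F ^^ Suc s) h))"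
    using c hc by (simp only: Fk_mult Fk_Vk add_pow_ldistr Fk_closed smult_smult m_closed power_Suc)
  finally have 2: "?v \<otimes> ?v \<otimes> h = [p] \<cdot> (V ^^ Suc s) (w \<otimes> [(p ^ s)] \<cdot> (w \<otimes> (F ^^ Suc s) h))"
    using c hc by (simp only: add_pow_rdistr Fk_closed m_closed add.nat_pow_closed additive_smult[OF Vk_additive])
  let ?h1 = "(F ^^ Suc s) (u [^] n) \<otimes> w" and ?h2 = "w \<otimes> [(p ^ s)] \<cdot> (w \<otimes> (F ^^ Suc s) h)"
  have g: "?h1 \<in> gr 0" "?h2 \<in> gr 0"
    using assms h(1) by (auto intro!: mult_gr0 gr_smult Fk_gr pow_gr0 simp del: funpow.simps)
  have gc: "?h1 \<in> carrier A" "?h2 \<in> carrier A" using g gr_carrier by auto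
  have "(u \<oplus> ?v) [^] p = u [^] p \<oplus> [p] \<cdot> (V ^^ Suc s) (?h1 \<oplus> ?h2)"
    unfolding h(2) 1 2 additive_add[OF Vk_additive gc]
    using gc c by (simp add: a_assoc add.nat_pow_distrib Vk_closed del: funpow.simps)
  then show ?thesis using that g by blast
qed

text \<open>
  If \<open>a = b + V\<^sup>s\<^sup>+\<^sup>1 w\<close>, then \<open>F a - F b = p V\<^sup>s w\<close> while \<open>a\<^sup>p - b\<^sup>p\<close> lies in \<open>p V\<^sup>s\<^sup>+\<^sup>1 A\<^sup>0\<close>; so \<open>w\<close> is in the
  image of \<open>V\<close>, and \<open>a\<close> and \<open>b\<close> agree to the next order.
\<close>

lemma teichmueller_unique:
  assumes ab: "a \<in> gr 0" "b \<in> gr 0" "F a = a [^] p" "F b = b [^] p" and "a \<ominus> b \<in> V ` gr 0"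
  shows "a = b"
proof -
  have c: "a \<in> carrier A" "b \<in> carrier A" using ab gr_carrier by auto
  have ex: "\<exists>w\<in>gr 0. a = b \<oplus> (V ^^ Suc s) w" for s
  proof (induction s)
    case 0
    obtain w where "w \<in> gr 0" "a \<ominus> b = V w" using assms(5) by blast
    then show ?case using add_minus_cancel[OF c] by (intro bexI[of _ w]) auto
  next
    case (Suc s)
    then obtain w where w: "w \<in> gr 0" "a = b \<oplus> (V ^^ Suc s) w" by blast
    obtain h where h: "h \<in> gr 0" "a [^] p = b [^] p \<oplus> [p] \<cdot> (V ^^ Suc s) h"
      using pow_p_perturb[OF ab(2) w(1)] w(2) by metis
    have wc: "w \<in> carrier A" "h \<in> carrier A" using w h gr_carrier by auto
    have "F a = F b \<oplus> [p] \<cdot> (V ^^ s) w"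
      using w(2) c wc by (simp add: F_add V_closed Vk_closed F_V)
    then have "b [^] p \<oplus> [p] \<cdot> (V ^^ s) w = b [^] p \<oplus> [p] \<cdot> (V ^^ Suc s) h"
      using ab h by simp
    then have "[p] \<cdot> (V ^^ s) w = [p] \<cdot> (V ^^ Suc s) h"
      using c wc by (simp add: Vk_closed V_closed)
    then have "(V ^^ s) w = (V ^^ Suc s) h"
      using cancel_p[of "(V ^^ s) w" "(V ^^ Suc s) h" 1] wc by (simp add: Vk_closed V_closed)
    then have "(V ^^ s) w = (V ^^ s) (V h)" by (simp add: funpow_swap1)
    then have "w = V h" using Vk_inj[of s] wc by (auto dest: inj_onD simp: V_closed)
    then show ?case using w h by (intro bexI[of _ h]) (auto simp: funpow_swap1)
  qed
  have "a \<ominus> b \<in> N (Suc s)" for s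
  proof -
    obtain w where w: "w \<in> gr 0" "a = b \<oplus> (V ^^ Suc s) w" using ex by blast
    have wc: "(V ^^ Suc s) w \<in> carrier A" using w gr_carrier Vk_closed by blast
    have "a \<ominus> b = (V ^^ Suc s) w" unfolding w(2)
      using c wc a_comm[of b "(V ^^ Suc s) w"] by (simp add: a_minus_def a_assoc r_neg del: funpow.simps)
    then show ?thesis using N_V w gr_carrier by metis
  qed
  then have "a \<ominus> b \<in> N s" for s using N_mono[of s "Suc s"] by auto
  then have "a \<ominus> b = \<zero>" using N_separated ab gr_minus by blast
  then show ?thesis using c by (simp add: minus_eq_zero_iff)
qed

text \<open>
  Successive approximation.  If \<open>F a = a\<^sup>p + p V\<^sup>s z\<close>, then subtracting \<open>V\<^sup>s\<^sup>+\<^sup>1 z\<close> from \<open>a\<close> changes \<open>F a\<close> by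
  \<open>-p V\<^sup>s z\<close> and \<open>a\<^sup>p\<close> only by an element of \<open>p V\<^sup>s\<^sup>+\<^sup>1 A\<^sup>0\<close>.  The Frobenius lift provides the
  start \<open>s = 0\<close>.
\<close>

lemma teichmueller_exists:
  assumes x: "x \<in> gr 0"
  obtains a where "a \<in> gr 0" "F a = a [^] p" "a \<ominus> x \<in> V ` gr 0"
proof -
  have step: "\<exists>a'. (a' \<in> gr 0 \<and> (\<exists>z\<in>gr 0. F a' = a' [^] p \<oplus> [p] \<cdot> (V ^^ Suc s) z)) \<and>
      a' \<ominus> a \<in> (V ^^ Suc s) ` gr 0"
    if a: "a \<in> gr 0 \<and> (\<exists>z\<in>gr 0. F a = a [^] p \<oplus> [p] \<cdot> (V ^^ s) z)" for a s
  proof -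
    obtain z where z: "a \<in> gr 0" "z \<in> gr 0" "F a = a [^] p \<oplus> [p] \<cdot> (V ^^ s) z" using a by blast
    have zc: "a \<in> carrier A" "z \<in> carrier A" using z gr_carrier by auto
    let ?a = "a \<oplus> (V ^^ Suc s) (\<ominus> z)"
    have a': "?a \<in> gr 0" using z by (intro gr_add Vk_gr gr_neg)
    obtain h where h: "h \<in> gr 0" "?a [^] p = a [^] p \<oplus> [p] \<cdot> (V ^^ Suc s) h"
      using pow_p_perturb[OF z(1) gr_neg[OF z(2)]] by metis
    have hc: "h \<in> carrier A" using h gr_carrier by blast
    have "F ?a = F a \<oplus> [p] \<cdot> (V ^^ s) (\<ominus> z)"
      using zc by (simp add: F_add V_closed Vk_closed F_V)
    also have "\<dots> = a [^] p \<oplus> [p] \<cdot> ((V ^^ s) z \<oplus> (V ^^ s) (\<ominus> z))"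
      using z zc by (simp add: a_assoc Vk_closed add.nat_pow_distrib)
    also have "\<dots> = a [^] p" using zc by (simp add: additive_neg[OF Vk_additive] Vk_closed r_neg)
    also have "\<dots> = ?a [^] p \<oplus> [p] \<cdot> (V ^^ Suc s) (\<ominus> h)"
    proof -
      have "?a [^] p \<oplus> [p] \<cdot> (V ^^ Suc s) (\<ominus> h) =
          a [^] p \<oplus> ([p] \<cdot> ((V ^^ Suc s) h \<oplus> (V ^^ Suc s) (\<ominus> h)))"
        unfolding h(2) using hc zc by (simp add: a_assoc Vk_closed add.nat_pow_distrib del: funpow.simps)
      then show ?thesis using hc zc by (simp add: additive_neg[OF Vk_additive] Vk_closed r_neg del: funpow.simps)
    qed
    finally have "F ?a = ?a [^] p \<oplus> [p] \<cdot> (V ^^ Suc s) (\<ominus> h)" .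
    moreover have "?a \<ominus> a = (V ^^ Suc s) (\<ominus> z)"
      using zc Vk_closed[of "\<ominus> z" "Suc s"] a_comm[of a "(V ^^ Suc s) (\<ominus> z)"]
      by (simp add: a_minus_def a_assoc r_neg del: funpow.simps)
    ultimately show ?thesis using a' h(1) z(2) gr_neg by blast
  qed
  have start: "x \<in> gr 0 \<and> (\<exists>z\<in>gr 0. F x = x [^] p \<oplus> [p] \<cdot> (V ^^ 0) z)"
    using F_lift[OF x] x by auto
  have "\<exists>f. \<forall>s. (f s \<in> gr 0 \<and> (\<exists>z\<in>gr 0. F (f s) = f s [^] p \<oplus> [p] \<cdot> (V ^^ s) z) \<and> (s = 0 \<longrightarrow> f s = x)) \<and>
      f (Suc s) \<ominus> f s \<in> (V ^^ Suc s) ` gr 0"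
    by (rule dependent_nat_choice) (use start step in auto)
  then obtain f where f: "\<And>s. f s \<in> gr 0" "\<And>s. \<exists>z\<in>gr 0. F (f s) = f s [^] p \<oplus> [p] \<cdot> (V ^^ s) z"
    "f 0 = x" "\<And>s. f (Suc s) \<ominus> f s \<in> (V ^^ Suc s) ` gr 0"
    by metis
  have fs: "f (Suc s) \<ominus> f s \<in> N s" for s
  proof -
    obtain w where "w \<in> gr 0" "f (Suc s) \<ominus> f s = (V ^^ Suc s) w" using f(4)[of s] by blast
    then have "f (Suc s) \<ominus> f s \<in> N (Suc s)" using N_V gr_carrier by metis
    then show ?thesis using N_mono[of s "Suc s"] by auto
  qed
  obtain a where a: "a \<in> gr 0" "\<And>s. a \<ominus> f s \<in> N s"
    using strict_complete[of f 0, OF strict f(1) fs] by blast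
  have ac: "a \<in> carrier A" "f s \<in> carrier A" for s
    using gr_carrier[OF a(1)] gr_carrier[OF f(1)] by auto
  have diff: "\<exists>w\<in>gr 0. a = f s \<oplus> (V ^^ s) w" for s
    using gr0_N[OF gr_minus[OF a(1) f(1)] a(2)] add_minus_cancel[OF ac] by metis
  have "F a \<ominus> a [^] p \<in> N s" for s
  proof -
    obtain w where w: "w \<in> gr 0" "a = f (Suc s) \<oplus> (V ^^ Suc s) w" using diff by blast
    obtain h where h: "h \<in> gr 0" "a [^] p = f (Suc s) [^] p \<oplus> [p] \<cdot> (V ^^ Suc s) h"
      using pow_p_perturb[OF f(1) w(1)] w(2) by metis
    obtain z where z: "z \<in> gr 0" "F (f (Suc s)) = f (Suc s) [^] p \<oplus> [p] \<cdot> (V ^^ Suc s) z"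
      using f(2) by blast
    have c: "w \<in> carrier A" "h \<in> carrier A" "z \<in> carrier A" using w h z gr_carrier by auto
    define q where "q = f (Suc s) [^] p"
    have qc: "q \<in> carrier A" using ac by (simp add: q_def)
    define P Q where "P = [p] \<cdot> (V ^^ Suc s) z \<oplus> [p] \<cdot> (V ^^ s) w" and "Q = [p] \<cdot> (V ^^ Suc s) h"
    have vs: "(V ^^ Suc s) z \<in> N s" "(V ^^ Suc s) h \<in> N s"
      using N_V[OF c(3), of "Suc s"] N_V[OF c(2), of "Suc s"] N_mono[OF le_SucI[OF order.refl], of s]
      by blast+
    have PQ: "P \<in> N s" "Q \<in> N s"
      unfolding P_def Q_def by (intro N_add N_smult vs N_V c)+
    then have PQc: "P \<in> carrier A" "Q \<in> carrier A" using N_closed by auto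
    have "F a = q \<oplus> [p] \<cdot> (V ^^ Suc s) z \<oplus> [p] \<cdot> (V ^^ s) w"
      unfolding w(2) using z(2) ac c by (simp add: F_add V_closed Vk_closed F_V q_def)
    then have "F a = q \<oplus> P"
      using qc c by (simp add: P_def a_assoc V_closed Vk_closed)
    moreover have "a [^] p = q \<oplus> Q" using h(2) by (simp only: q_def Q_def)
    ultimately have "F a \<ominus> a [^] p = P \<ominus> Q"
      using minus_add_cancel_left[OF qc PQc] by simp
    moreover note PQ
    ultimately show ?thesis by (simp add: N_minus)
  qed
  then have "F a \<ominus> a [^] p = \<zero>"
    using N_separated[of "F a \<ominus> a [^] p" 0] a(1) by (simp add: gr_minus F_gr pow_gr0)
  then have "F a = a [^] p" using ac by (simp add: minus_eq_zero_iff F_closed)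
  moreover have "a \<ominus> x \<in> V ` gr 0"
  proof -
    obtain w where w: "w \<in> gr 0" "a = f 1 \<oplus> V w" using diff[of 1] by auto
    obtain u where u: "u \<in> gr 0" "f 1 \<ominus> x = V u" using f(4)[of 0] f(3) by auto
    have "a = x \<oplus> V u \<oplus> V w" using w u add_minus_cancel[of "f 1" x] ac x gr_carrier by metis
    then have "a \<ominus> x = V (u \<oplus> w)"
      using x u(1) w(1) gr_carrier by (simp add: a_minus_def a_ac V_closed V_add r_neg1 r_neg2 r_neg)
    then show ?thesis using u w by blast
  qed
  ultimately show ?thesis using that a by blast
qed

end

section \<open>Sums of monomials with a dominant term\<close>

primrec monomial :: "('a, 'b) ring_scheme \<Rightarrow> (nat \<Rightarrow> 'a) \<Rightarrow> (nat \<Rightarrow> nat) \<Rightarrow> nat \<Rightarrow> 'a" where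
  "monomial R x m 0 = \<one>\<^bsub>R\<^esub>"
| "monomial R x m (Suc n) = monomial R x m n \<otimes>\<^bsub>R\<^esub> (x n [^]\<^bsub>R\<^esub> m n)"

text \<open>
  Sums of terms \<open>c x\<^sup>m\<close> in which \<open>m\<close> is lexicographically smaller than \<open>m0\<close>.  The coefficients come from a set \<open>C\<close> that
  is closed under multiplication only (Teichmueller representatives are not additive), so terms with the
  same monomial cannot be collected; hence the sums are generated term by term.
\<close>

inductive_set lower_terms ::
  "('a, 'b) ring_scheme \<Rightarrow> 'a set \<Rightarrow> (nat \<Rightarrow> 'a) \<Rightarrow> nat \<Rightarrow> (nat \<Rightarrow> nat) \<Rightarrow> 'a set"
  for R :: "('a, 'b) ring_scheme" and C x n m0 where
    zero: "\<zero>\<^bsub>R\<^esub> \<in> lower_terms R C x n m0"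
  | add: "c \<in> C \<Longrightarrow> (\<forall>j\<ge>n. m j = 0) \<Longrightarrow> less_fun m m0 \<Longrightarrow> a \<in> lower_terms R C x n m0 \<Longrightarrow>
      (c \<otimes>\<^bsub>R\<^esub> monomial R x m n) \<oplus>\<^bsub>R\<^esub> a \<in> lower_terms R C x n m0"

text \<open>
  Values of polynomials with a leading term: the substitute for nonzero polynomials.
\<close>

definition dominated :: "('a, 'b) ring_scheme \<Rightarrow> 'a set \<Rightarrow> (nat \<Rightarrow> 'a) \<Rightarrow> nat \<Rightarrow> 'a set" where
  "dominated R C x n = {(c \<otimes>\<^bsub>R\<^esub> monomial R x m0 n) \<oplus>\<^bsub>R\<^esub> b | c m0 b.
     c \<in> C \<and> (\<forall>j\<ge>n. m0 j = 0) \<and> b \<in> lower_terms R C x n m0}"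

lemma less_fun_add_left:
  fixes f g h :: "nat \<Rightarrow> nat"
  assumes "less_fun f g" shows "less_fun (\<lambda>j. h j + f j) (\<lambda>j. h j + g j)"
  using assms by (auto simp: less_fun_def)

lemma less_fun_add_right:
  fixes f g h :: "nat \<Rightarrow> nat"
  assumes "less_fun f g" shows "less_fun (\<lambda>j. f j + h j) (\<lambda>j. g j + h j)"
  using assms by (auto simp: less_fun_def)

locale monomial_sums = cring R for R (structure) +
  fixes C :: "'a set" and x :: "nat \<Rightarrow> 'a" and n :: nat
  assumes C_carrier: "C \<subseteq> carrier R" and C_one: "\<one> \<in> C"
    and C_mult: "a \<in> C \<Longrightarrow> b \<in> C \<Longrightarrow> a \<otimes> b \<in> C"
    and x_carrier: "x j \<in> carrier R"
begin

abbreviation "monomial_of m \<equiv> monomial R x m n"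
abbreviation "lower_sums \<equiv> lower_terms R C x n"
abbreviation "dominated_sums \<equiv> dominated R C x n"

lemma monomial_closed: "monomial R x m k \<in> carrier R"
  by (induction k) (simp_all add: x_carrier)

lemma monomial_add: "monomial R x (\<lambda>j. m j + m' j) k = monomial R x m k \<otimes> monomial R x m' k"
  by (induction k) (simp_all add: x_carrier monomial_closed nat_pow_mult[symmetric] m_ac)

lemma lower_closed: "a \<in> lower_sums m0 \<Longrightarrow> a \<in> carrier R"
  by (induction rule: lower_terms.induct) (use C_carrier monomial_closed in auto)

lemma lower_add: "a \<in> lower_sums m0 \<Longrightarrow> b \<in> lower_sums m0 \<Longrightarrow> a \<oplus> b \<in> lower_sums m0"
proof (induction rule: lower_terms.induct)
  case zero then show ?case by (simp add: lower_closed)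
next
  case (add c m a)
  have "c \<in> carrier R" "a \<in> carrier R" "b \<in> carrier R"
    using add C_carrier lower_closed by auto
  then have "c \<otimes> monomial_of m \<oplus> a \<oplus> b = c \<otimes> monomial_of m \<oplus> (a \<oplus> b)"
    using monomial_closed by (simp add: a_assoc)
  then show ?case using lower_terms.add[OF add(1-3) add.IH[OF add.prems]] by simp
qed

lemma lower_mono:
  assumes "a \<in> lower_sums m0" "less_fun m0 m1" shows "a \<in> lower_sums m1"
  using assms(1)
proof (induction rule: lower_terms.induct)
  case zero show ?case by (rule lower_terms.zero)
next
  case (add c m a)
  then show ?case using less_fun_trans[OF _ assms(2)] by (auto intro: lower_terms.add)
qed

lemma term_mult_lower:
  assumes "a \<in> lower_sums m0" "c \<in> C" "\<forall>j\<ge>n. m j = 0"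
  shows "(c \<otimes> monomial_of m) \<otimes> a \<in> lower_sums (\<lambda>j. m j + m0 j)"
  using assms(1)
proof (induction rule: lower_terms.induct)
  case zero
  have "(c \<otimes> monomial_of m) \<otimes> \<zero> = \<zero>" using assms(2) C_carrier monomial_closed by auto
  then show ?case by (simp add: lower_terms.zero)
next
  case (add c' m' a)
  have cs: "c \<in> carrier R" "c' \<in> carrier R" "a \<in> carrier R"
    using add assms(2) C_carrier lower_closed by auto
  have "(c \<otimes> monomial_of m) \<otimes> (c' \<otimes> monomial_of m' \<oplus> a) =
      (c \<otimes> c') \<otimes> monomial_of (\<lambda>j. m j + m' j) \<oplus> (c \<otimes> monomial_of m) \<otimes> a"
    using cs monomial_closed by (simp add: r_distr monomial_add m_ac)
  moreover have "\<dots> \<in> lower_sums (\<lambda>j. m j + m0 j)"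
    using add assms C_mult by (intro lower_terms.add) (auto intro: less_fun_add_left)
  ultimately show ?case by simp
qed

lemma lower_mult:
  assumes "a \<in> lower_sums m0" "b \<in> lower_sums m1"
  shows "a \<otimes> b \<in> lower_sums (\<lambda>j. m0 j + m1 j)"
  using assms(1)
proof (induction rule: lower_terms.induct)
  case zero
  show ?case using lower_closed[OF assms(2)] by (simp add: lower_terms.zero)
next
  case (add c m a)
  have "c \<in> carrier R" "a \<in> carrier R" "b \<in> carrier R"
    using add assms(2) C_carrier lower_closed by auto
  then have "(c \<otimes> monomial_of m \<oplus> a) \<otimes> b = (c \<otimes> monomial_of m) \<otimes> b \<oplus> a \<otimes> b"
    using monomial_closed by (simp add: l_distr)
  moreover have "(c \<otimes> monomial_of m) \<otimes> b \<in> lower_sums (\<lambda>j. m0 j + m1 j)"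
    using lower_mono[OF term_mult_lower[OF assms(2) add(1,2)] less_fun_add_right[OF add(3)]] .
  ultimately show ?case using lower_add add.IH by simp
qed

lemma dominated_one: "\<one> \<in> dominated_sums"
proof -
  have "monomial R x (\<lambda>_. 0) k = \<one>" for k by (induction k) simp_all
  then have "\<one> = \<one> \<otimes> monomial_of (\<lambda>_. 0) \<oplus> \<zero>" by simp
  then show ?thesis unfolding dominated_def
    using C_one lower_terms.zero[of R C x n "\<lambda>_. 0"] by blast
qed

text \<open>
  The product of the leading terms dominates all the other products, since the lexicographic order is
  compatible with addition of exponents.
\<close>

lemma dominated_mult:
  assumes "a \<in> dominated_sums" "b \<in> dominated_sums" shows "a \<otimes> b \<in> dominated_sums"
proof -
  obtain c m0 s where a: "a = c \<otimes> monomial_of m0 \<oplus> s" "c \<in> C" "\<forall>j\<ge>n. m0 j = 0" "s \<in> lower_sums m0"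
    using assms(1) by (auto simp: dominated_def)
  obtain e m1 t where b: "b = e \<otimes> monomial_of m1 \<oplus> t" "e \<in> C" "\<forall>j\<ge>n. m1 j = 0" "t \<in> lower_sums m1"
    using assms(2) by (auto simp: dominated_def)
  let ?M = "\<lambda>j. m0 j + m1 j"
  have cs: "c \<in> carrier R" "e \<in> carrier R" "s \<in> carrier R" "t \<in> carrier R"
    using a b C_carrier lower_closed by auto
  have eq: "a \<otimes> b = (c \<otimes> e) \<otimes> monomial_of ?M \<oplus> ((c \<otimes> monomial_of m0) \<otimes> t \<oplus> ((e \<otimes> monomial_of m1) \<otimes> s \<oplus> s \<otimes> t))"
    unfolding a(1) b(1) using cs monomial_closed by (simp add: l_distr r_distr monomial_add m_ac a_ac)
  have "(e \<otimes> monomial_of m1) \<otimes> s \<in> lower_sums ?M"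
    using term_mult_lower[OF a(4) b(2,3)] by (simp add: add.commute)
  then have "(c \<otimes> monomial_of m0) \<otimes> t \<oplus> ((e \<otimes> monomial_of m1) \<otimes> s \<oplus> s \<otimes> t) \<in> lower_sums ?M"
    using term_mult_lower[OF b(4) a(2,3)] lower_mult[OF a(4) b(4)] by (intro lower_add)
  then show ?thesis unfolding eq dominated_def using C_mult[OF a(2) b(2)] a(3) b(3)
    by (intro CollectI exI[of _ "c \<otimes> e"] exI[of _ ?M] exI conjI) auto
qed

lemma dominated_pow: "a \<in> dominated_sums \<Longrightarrow> a [^] (k::nat) \<in> dominated_sums"
  by (induction k) (simp_all add: dominated_one dominated_mult)

end

section \<open>Forms in Teichmueller representatives\<close>

context strict_algebra
begin

text \<open>
  \<open>form x v n\<close> is \<open>x\<^sup>v dlog x\<^sub>0 \<dots> dlog x\<^sub>n\<^sub>-\<^sub>1\<close>, written without denominators.  With this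
  normalisation of the exponents \<open>F\<close> multiplies \<open>v\<close> by \<open>p\<close> and multiplication by a
  monomial adds its exponents to \<open>v\<close>, as long as all exponents \<open>v j\<close> are positive.
\<close>

primrec form :: "(nat \<Rightarrow> 'a) \<Rightarrow> (nat \<Rightarrow> nat) \<Rightarrow> nat \<Rightarrow> 'a" where
  "form x v 0 = \<one>"
| "form x v (Suc n) = form x v n \<otimes> (x n [^] (v n - 1) \<otimes> d (x n))"

lemma form_cong:
  "(\<And>j. j < n \<Longrightarrow> x j = y j) \<Longrightarrow> (\<And>j. j < n \<Longrightarrow> u j = v j) \<Longrightarrow> form x u n = form y v n"
  by (induction n) auto

lemma d_gr0: "x \<in> gr 0 \<Longrightarrow> d x \<in> gr 1"
  using d_gr[of x 0] by simp

lemma d_pow: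
  assumes "x \<in> gr 0" shows "d (x [^] (w::nat)) = [w] \<cdot> (x [^] (w - 1) \<otimes> d x)"
proof (induction w)
  case 0 then show ?case by (simp add: d_one)
next
  case (Suc w)
  have c: "x \<in> carrier A" "d x \<in> carrier A" "x [^] w \<in> gr 0"
    using assms gr_carrier d_closed pow_gr0 by auto
  have "d (x [^] Suc w) = d (x [^] w) \<otimes> x \<oplus> x [^] w \<otimes> d x"
    using leibniz0[OF c(3,1)] by simp
  also have "d (x [^] w) \<otimes> x = [w] \<cdot> (x [^] w \<otimes> d x)"
  proof (cases "w = 0")
    case False
    then have w: "x [^] w = x [^] (w - 1) \<otimes> x" by (cases w) simp_all
    have "d x \<otimes> x = x \<otimes> d x" using comm0[OF assms d_gr0[OF assms]] .
    then show ?thesis unfolding Suc.IH using c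
      by (subst w) (simp add: add_pow_ldistr m_assoc)
  qed (use c in \<open>simp add: d_one\<close>)
  finally show ?case using c by simp
qed

lemma eta_gr: "x \<in> gr 0 \<Longrightarrow> x [^] (k::nat) \<otimes> d x \<in> gr 1"
  by (intro mult_gr0 pow_gr0 d_gr0)

lemma eta_closed:
  assumes "x \<in> gr 0" shows "d (x [^] (k::nat) \<otimes> d x) = \<zero>"
proof -
  have c: "x \<in> carrier A" "d x \<in> carrier A" using assms gr_carrier d_closed by auto
  have "d x \<otimes> d x = \<zero>" using odd_square[OF _ d_gr0[OF assms]] by simp
  then show ?thesis
    using leibniz0[OF pow_gr0[OF assms] c(2), of k] c
    by (simp add: d_d d_pow[OF assms] add_pow_ldistr m_assoc)
qed

text \<open>
  \<open>F (dx) = x\<^sup>p\<^sup>-\<^sup>1 dx\<close>, because \<open>p F (dx) = d (F x) = d (x\<^sup>p)\<close> and there is no \<open>p\<close>-torsion.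
\<close>

lemma F_eta:
  assumes "x \<in> gr 0" "F x = x [^] p" "w > 0"
  shows "F (x [^] (w - 1) \<otimes> d x) = x [^] (p * w - 1) \<otimes> d x"
proof -
  have c: "x \<in> carrier A" "d x \<in> carrier A" using assms gr_carrier d_closed by auto
  have "F (d x) = x [^] (p - 1) \<otimes> d x"
  proof (rule cancel_p[of _ _ 1])
    show "[(p ^ 1)] \<cdot> F (d x) = [(p ^ 1)] \<cdot> (x [^] (p - 1) \<otimes> d x)"
      using d_F[OF c(1)] d_pow[OF assms(1), of p] assms(2) by simp
  qed (use c in \<open>auto simp: F_closed\<close>)
  moreover have "F (x [^] (w - 1)) = x [^] (p * (w - 1))"
    using Fk_pow[of x 1 "w - 1"] c assms(2) by (simp add: nat_pow_pow)
  moreover have "p * (w - 1) + (p - 1) = p * w - 1"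
    using assms(3) p_pos by (cases w) (auto simp: algebra_simps)
  ultimately show ?thesis using c by (simp add: F_mult m_assoc[symmetric] nat_pow_mult)
qed

lemma monomial_A0: "monomial A0 x m n = monomial A x m n"
  by (induction n) (simp_all add: A0_pow)

context
  fixes x :: "nat \<Rightarrow> 'a"
  assumes x: "\<And>j. x j \<in> gr 0"
begin

lemma form_gr: "form x v n \<in> gr (int n)"
proof (induction n)
  case (Suc n)
  then show ?case using mult_gr[OF Suc eta_gr[OF x]] by (simp add: add.commute)
qed (simp add: one_gr)

lemma form_closed: "d (form x v n) = \<zero>"
proof (induction n)
  case (Suc n)
  have c: "form x v n \<in> carrier A" "x n [^] (v n - 1) \<otimes> d (x n) \<in> carrier A"
    using gr_carrier form_gr eta_gr[OF x] by blast+
  then show ?case using leibniz[OF form_gr c(2)] Suc eta_closed[OF x] by simp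
qed (simp add: d_one)

lemma monomial_gr0: "monomial A x m n \<in> gr 0"
  by (induction n) (simp_all add: one_gr mult_gr0 pow_gr0 x)

lemma monomial_mult_form:
  assumes "\<And>j. j < n \<Longrightarrow> v j > 0"
  shows "monomial A x m n \<otimes> form x v n = form x (\<lambda>j. m j + v j) n"
  using assms
proof (induction n)
  case (Suc n)
  let ?M = "monomial A x m n" and ?f = "form x v n"
  have c: "?M \<in> carrier A" "?f \<in> carrier A" "x n \<in> carrier A" "d (x n) \<in> carrier A"
    using monomial_gr0 form_gr x gr_carrier d_closed by blast+
  have "x n [^] m n \<otimes> ?f = ?f \<otimes> x n [^] m n" using comm0[OF pow_gr0[OF x] form_gr] by simp
  moreover have "(?M \<otimes> x n [^] m n) \<otimes> (?f \<otimes> (x n [^] (v n - 1) \<otimes> d (x n))) =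
      ?M \<otimes> ((x n [^] m n \<otimes> ?f) \<otimes> (x n [^] (v n - 1) \<otimes> d (x n)))"
    using c by (simp add: m_assoc)
  ultimately have "(?M \<otimes> x n [^] m n) \<otimes> (?f \<otimes> (x n [^] (v n - 1) \<otimes> d (x n))) =
      (?M \<otimes> ?f) \<otimes> ((x n [^] m n \<otimes> x n [^] (v n - 1)) \<otimes> d (x n))"
    using c by (simp add: m_assoc)
  moreover have "m n + (v n - 1) = m n + v n - 1" using Suc.prems[of n] by simp
  ultimately show ?case using Suc c by (simp add: nat_pow_mult)
qed simp

lemma Fk_form:
  assumes "\<And>j. F (x j) = x j [^] p" "\<And>j. j < n \<Longrightarrow> v j > 0"
  shows "(F ^^ k) (form x v n) = form x (\<lambda>j. p ^ k * v j) n"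
proof -
  have 1: "F (form x v n) = form x (\<lambda>j. p * v j) n" if "\<And>j. j < n \<Longrightarrow> v j > 0" for v
    using that
  proof (induction n)
    case (Suc n)
    have "F (form x v (Suc n)) = F (form x v n) \<otimes> F (x n [^] (v n - 1) \<otimes> d (x n))"
      using F_mult gr_carrier form_gr eta_gr[OF x] by (metis form.simps(2))
    then show ?case using Suc F_eta[OF x assms(1)] by simp
  qed (simp add: F_one)
  show ?thesis
  proof (induction k)
    case (Suc k)
    then show ?case using 1[of "\<lambda>j. p ^ k * v j"] assms(2) p_pos by (simp add: mult.assoc)
  qed simp
qed

text \<open>
  The factor \<open>x\<^sub>j\<^sup>v\<^sup>-\<^sup>1 dx\<^sub>j\<close> becomes exact after multiplication by its exponent \<open>v\<close>, and all
  other factors are closed.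
\<close>

lemma form_exact:
  assumes "j < n" "v j > 0"
  shows "\<exists>t\<in>gr (int n - 1). [(v j)] \<cdot> form x v n = d t"
  using assms(1)
proof (induction n)
  case (Suc n)
  let ?f = "form x v n" and ?e = "x n [^] (v n - 1) \<otimes> d (x n)"
  have c: "?f \<in> carrier A" "?e \<in> carrier A" "x n \<in> carrier A"
    using form_gr x eta_gr[OF x] gr_carrier by blast+
  show ?case
  proof (cases "j = n")
    case True
    have y: "x n [^] v n \<in> gr 0" "x n [^] v n \<in> carrier A" using pow_gr0[OF x] gr_carrier by blast+
    have t: "?f \<otimes> x n [^] v n \<in> gr (int n)" using mult_gr0'[OF form_gr y(1)] .
    have s: "[(v n)] \<cdot> form x v (Suc n) = ?f \<otimes> d (x n [^] v n)"
      using c by (simp add: d_pow[OF x] add_pow_rdistr)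
    have l: "d (?f \<otimes> x n [^] v n) =
        (if even n then ?f \<otimes> d (x n [^] v n) else \<ominus> (?f \<otimes> d (x n [^] v n)))"
      using leibniz[OF form_gr y(2), of v n] c y by (simp add: form_closed d_closed)
    show ?thesis
    proof (cases "even n")
      case True
      then show ?thesis using t s l \<open>j = n\<close>
        by (intro bexI[of _ "?f \<otimes> x n [^] v n"]) (simp_all del: form.simps)
    next
      case False
      then have "d (\<ominus> (?f \<otimes> x n [^] v n)) = ?f \<otimes> d (x n [^] v n)"
        using l c y by (simp add: additive_neg[OF d_additive] d_closed)
      then show ?thesis using gr_neg[OF t] s \<open>j = n\<close> by (intro bexI[of _ "\<ominus> (?f \<otimes> x n [^] v n)"])
          (simp_all del: form.simps)
    qed
  next
    case False
    then obtain t where t: "t \<in> gr (int n - 1)" "[(v j)] \<cdot> ?f = d t" using Suc by auto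
    have tc: "t \<in> carrier A" using t gr_carrier by blast
    have "[(v j)] \<cdot> form x v (Suc n) = d t \<otimes> ?e" using c t(2) by (simp add: add_pow_ldistr[symmetric])
    also have "\<dots> = d (t \<otimes> ?e)"
      using leibniz[OF t(1) c(2)] tc c eta_closed[OF x] by (simp add: d_closed)
    finally show ?thesis using mult_gr[OF t(1) eta_gr[OF x[of n], of "v n - 1"]]
      by (intro bexI[of _ "t \<otimes> ?e"]) simp_all
  qed
qed simp

end

end

text \<open>
  The set \<open>C\<close> stands for the Teichmueller representatives of the nonzero elements of a perfect field.
\<close>

locale coefficient_group = strict_algebra +
  fixes C :: "'a set" and x :: "nat \<Rightarrow> 'a" and n :: nat
  assumes C_gr: "C \<subseteq> gr 0" and C_one: "\<one> \<in> C"
    and C_mult: "a \<in> C \<Longrightarrow> b \<in> C \<Longrightarrow> a \<otimes> b \<in> C"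
    and C_root: "c \<in> C \<Longrightarrow> \<exists>b\<in>C. c = F b"
    and C_unit: "c \<in> C \<Longrightarrow> \<exists>b\<in>C. b \<otimes> c = \<one>"
    and x_gr: "\<And>j. x j \<in> gr 0" and F_x: "\<And>j. F (x j) = x j [^] p"
begin

lemma form_grx: "form x v k \<in> gr (int k)"
  using form_gr[of x v k] x_gr by simp

lemma form_car: "form x v k \<in> carrier A"
  using form_grx gr_carrier by blast

lemma monomial_car: "monomial A x m k \<in> carrier A"
  using monomial_gr0[of x m k] x_gr gr_carrier by blast

lemma C_roots: assumes "c \<in> C" shows "\<exists>b\<in>C. c = (F ^^ k) b"
proof (induction k)
  case (Suc k)
  then obtain b where "b \<in> C" "c = (F ^^ k) b" by blast
  moreover obtain b' where "b' \<in> C" "b = F b'" using C_root calculation by blast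
  ultimately show ?case by (auto simp: funpow_swap1)
qed (use assms in auto)

lemma C_carrier: "c \<in> C \<Longrightarrow> c \<in> carrier A"
  using C_gr gr_carrier by blast

text \<open>
  A coefficient is an \<open>F\<^sup>r\<close>-image for every \<open>r\<close>, so its differential is divisible by every \<open>p\<^sup>r\<close>.
\<close>

lemma d_C: assumes "c \<in> C" shows "d c = \<zero>"
proof (rule N_separated)
  show "d c \<in> gr 1" using d_gr0 C_gr assms by blast
  fix r
  obtain b where "b \<in> C" "c = (F ^^ r) b" using C_roots[OF assms] by blast
  then have "d c = [(p ^ r)] \<cdot> (F ^^ r) (d b)" using d_Fk C_carrier by blast
  then show "d c \<in> N r" using N_p Fk_closed d_closed C_carrier[OF \<open>b \<in> C\<close>] by simp
qed

lemma C_form: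
  assumes "c \<in> C" shows "c \<otimes> form x v n \<in> gr (int n)" "d (c \<otimes> form x v n) = \<zero>"
proof -
  have c: "c \<in> gr 0" "form x v n \<in> carrier A"
    using assms C_gr form_car by auto
  show "c \<otimes> form x v n \<in> gr (int n)" using mult_gr0[OF c(1) form_grx] .
  show "d (c \<otimes> form x v n) = \<zero>"
    using leibniz0[OF c] d_C[OF assms] form_closed[OF x_gr] c gr_carrier by simp
qed

text \<open>
  With \<open>w = v j\<close>; the coefficient is a constant for \<open>d\<close> and can be moved under it.
\<close>

lemma monomial_form_exact:
  assumes "c \<in> C" "j < n" "v j > 0" "\<not> p dvd v j"
  shows "\<exists>w. coprime w p \<and> (\<exists>b\<in>gr (int n - 1). [w] \<cdot> (c \<otimes> form x v n) = d b)"
proof -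
  obtain t where t: "t \<in> gr (int n - 1)" "[(v j)] \<cdot> form x v n = d t"
    using form_exact[of x j n v, OF x_gr assms(2,3)] by blast
  have cc: "c \<in> gr 0" "c \<in> carrier A" "t \<in> carrier A" "form x v n \<in> carrier A"
    using assms(1) C_gr C_carrier gr_carrier[OF t(1)] form_car by auto
  have "[(v j)] \<cdot> (c \<otimes> form x v n) = c \<otimes> d t" using cc t(2) by (simp add: add_pow_rdistr[symmetric])
  also have "\<dots> = d (c \<otimes> t)" using leibniz0[OF cc(1,3)] d_C[OF assms(1)] cc by (simp add: d_closed)
  finally have "[(v j)] \<cdot> (c \<otimes> form x v n) = d (c \<otimes> t)" .
  moreover have "coprime (v j) p"
    using assms(4) prime_p by (simp add: coprime_commute prime_imp_coprime)
  ultimately show ?thesis using mult_gr0[OF cc(1) t(1)] by blast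
qed

text \<open>
  Common factors \<open>p\<close> of the exponents can be pulled out as powers of \<open>F\<close>, because coefficients
  have \<open>F\<close>-roots; what remains has an exponent prime to \<open>p\<close> and is exact.
\<close>

lemma monomial_form_F_exact:
  assumes "c \<in> C" "\<And>j. j < n \<Longrightarrow> v j > 0" "i < n" "\<not> p ^ Suc s dvd v i"
  shows "\<exists>e\<le>s. \<exists>w. coprime w p \<and> (\<exists>b\<in>gr (int n - 1). [w] \<cdot> (c \<otimes> form x v n) = (F ^^ e) (d b))"
  using assms
proof (induction s arbitrary: c v i)
  case (0 c v i)
  then show ?case using monomial_form_exact[of c i v] by auto
next
  case (Suc s c v i)
  show ?case
  proof (cases "\<exists>j<n. \<not> p dvd v j")
    case True
    then obtain j where "j < n" "\<not> p dvd v j" by blast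
    then obtain w b where "coprime w p" "b \<in> gr (int n - 1)" "[w] \<cdot> (c \<otimes> form x v n) = (F ^^ 0) (d b)"
      using monomial_form_exact[of c j v] Suc.prems(1,2) by auto
    then show ?thesis by blast
  next
    case False
    define v' where "v' j = v j div p" for j
    have v: "v j = p * v' j" if "j < n" for j using False that by (auto simp: v'_def)
    have v'0: "v' j > 0" if "j < n" for j using v[OF that] Suc.prems(2)[OF that] by (cases "v' j") auto
    obtain b where b: "b \<in> C" "c = F b" using C_root Suc.prems(1) by blast
    have "\<not> p ^ Suc s dvd v' i" using Suc.prems(3,4) v p_pos by auto
    then obtain e w t where e: "e \<le> s" "coprime w p" "t \<in> gr (int n - 1)"
      "[w] \<cdot> (b \<otimes> form x v' n) = (F ^^ e) (d t)"
      using Suc.IH[of b v' i, OF b(1) v'0 Suc.prems(3)] by blast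
    have cc: "b \<in> carrier A" "form x v' n \<in> carrier A"
      using b C_carrier form_car by auto
    have "F (form x v' n) = form x (\<lambda>j. p * v' j) n"
      using Fk_form[of x n v' 1, OF x_gr F_x v'0] by simp
    also have "\<dots> = form x v n" using v by (intro form_cong) simp_all
    finally have "c \<otimes> form x v n = F (b \<otimes> form x v' n)" using b cc by (simp add: F_mult)
    then have "[w] \<cdot> (c \<otimes> form x v n) = (F ^^ Suc e) (d t)"
      using cc e(4) additive_smult[OF F_additive, of "b \<otimes> form x v' n" w] by simp
    then show ?thesis using e by (intro exI[of _ "Suc e"] conjI exI[of _ w]) auto
  qed
qed

text \<open>
  Multiplication by the form with exponents \<open>p\<^sup>k - m0\<close> turns a lower monomial \<open>m\<close> into exponents
  \<open>p\<^sup>k - m0 + m\<close>, one of which differs from \<open>p\<^sup>k\<close> by a number between \<open>1\<close> and \<open>p\<^sup>k\<^sup>-\<^sup>r - 1\<close> once \<open>k\<close> is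
  large.  So they are not all divisible by \<open>p\<^sup>k\<^sup>-\<^sup>r\<close>, the form is essentially \<open>F\<^sup>e (d b)\<close> with
  \<open>e < k - r\<close>, and \<open>F\<^sup>e (d b) = F\<^sup>k (d V\<^sup>k\<^sup>-\<^sup>e b)\<close> with \<open>V\<^sup>k\<^sup>-\<^sup>e b\<close> in the image of \<open>V\<^sup>r\<close>.
\<close>

lemma lower_terms_mult_form:
  assumes m0: "\<forall>j\<ge>n. m0 j = 0" and b: "b \<in> lower_terms A0 C x n m0"
  shows "\<exists>K. \<forall>k\<ge>K. (\<forall>j<n. m0 j < p ^ k) \<longrightarrow>
    (\<exists>t\<in>gr (int n). d t = \<zero> \<and> t \<in> N r \<and> b \<otimes> form x (\<lambda>j. p ^ k - m0 j) n = (F ^^ k) t)"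
  using b
proof (induction rule: lower_terms.induct)
  case zero
  have "\<zero> \<otimes> form x v n = (F ^^ k) \<zero>" for k v
    using gr_carrier[OF form_grx] by (simp add: additive_zero[OF Fk_additive])
  then show ?case using N_zero additive_zero[OF d_additive] by (intro exI[of _ 0]) auto
next
  case (add c m a)
  obtain K where K: "\<And>k. k \<ge> K \<Longrightarrow> (\<forall>j<n. m0 j < p ^ k) \<Longrightarrow>
    (\<exists>t\<in>gr (int n). d t = \<zero> \<and> t \<in> N r \<and> a \<otimes> form x (\<lambda>j. p ^ k - m0 j) n = (F ^^ k) t)"
    using add.IH by blast
  obtain i where i: "m i < m0 i" using add(3) by (auto simp: less_fun_def)
  then have "i < n" using m0 by (metis not_less0 not_le)
  have a: "a \<in> carrier A"
  proof -
    interpret S: monomial_sums A0 C x n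
      using A0_cring C_gr C_one C_mult x_gr
      by (intro monomial_sums.intro monomial_sums_axioms.intro) auto
    show ?thesis using S.lower_closed[OF add(4)] gr_carrier by simp
  qed
  show ?case
  proof (intro exI allI impI)
    fix k assume k: "k \<ge> K + Suc (r + m0 i)" and lt: "\<forall>j<n. m0 j < p ^ k"
    let ?f = "form x (\<lambda>j. p ^ k - m0 j) n"
    define v where "v = (\<lambda>j. m j + (p ^ k - m0 j))"
    define s where "s = k - Suc r"
    have s: "Suc s = k - r" "s < k" "k - s = Suc r" using k by (auto simp: s_def)
    obtain t where t: "t \<in> gr (int n)" "t \<in> N r" "d t = \<zero>" "a \<otimes> ?f = (F ^^ k) t"
      using K[of k] k lt by auto
    have vpos: "v j > 0" if "j < n" for j using lt that by (auto simp: v_def)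
    (* p^k - v i is positive and at most m0 i, hence too small to be divisible by p^(k-r) *)
    have "\<not> p ^ Suc s dvd v i"
    proof
      assume "p ^ Suc s dvd v i"
      moreover have "p ^ Suc s dvd p ^ k" using s by (intro le_imp_power_dvd) auto
      ultimately have "p ^ Suc s dvd p ^ k - v i" by (rule dvd_diff_nat[rotated])
      moreover have "p ^ k - v i = m0 i - m i" using i lt \<open>i < n\<close> by (auto simp: v_def)
      ultimately have "p ^ Suc s \<le> m0 i" using i by (auto dest!: dvd_imp_le)
      moreover have "m0 i < p ^ m0 i" using prime_gt_1_nat[OF prime_p] by (simp add: power_gt_expt)
      moreover have "p ^ m0 i \<le> p ^ Suc s" using k s p_pos by (intro power_increasing) auto
      ultimately show False by simp
    qed
    then obtain e w b where e: "e \<le> s" "coprime w p" "b \<in> gr (int n - 1)"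
      "[w] \<cdot> (c \<otimes> form x v n) = (F ^^ e) (d b)"
      using monomial_form_F_exact[of c v i s, OF add(1) vpos \<open>i < n\<close>] by blast
    have bc: "b \<in> carrier A" using e gr_carrier by blast
    obtain t' where t': "t' \<in> gr (int n)" "c \<otimes> form x v n = (F ^^ k) t'" "d t' = \<zero>"
      using closed_Fk[OF C_form[OF add(1)]] by metis
    have tc: "t' \<in> carrier A" "t \<in> carrier A" using t' t gr_carrier by blast+
    have "(F ^^ k) ([w] \<cdot> t') = (F ^^ e) (d b)"
      using e(4) t'(2) tc additive_smult[OF Fk_additive, of t' k w] by simp
    also have "\<dots> = (F ^^ e) ((F ^^ (k - e)) (d ((V ^^ (k - e)) b)))" using Fk_d_Vk[OF bc] by simp
    also have "\<dots> = (F ^^ k) (d ((V ^^ (k - e)) b))"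
      using e s by (metis funpow_add le_add_diff_inverse less_imp_le le_trans o_apply)
    finally have "[w] \<cdot> t' = d ((V ^^ (k - e)) b)"
      using Fk_inj[of k] tc bc by (auto dest: inj_onD simp: d_closed Vk_closed)
    then have "[w] \<cdot> t' \<in> N r"
    proof -
      have "r \<le> k - e" using e(1) s(3) by linarith
      then show ?thesis using \<open>[w] \<cdot> t' = _\<close> N_dV[OF bc, of "k - e"] N_mono[of r "k - e"] by auto
    qed
    then have t'N: "t' \<in> N r" using N_coprime tc e by blast
    have mf: "monomial A0 x m n \<otimes> ?f = form x v n"
      unfolding monomial_A0 v_def using lt by (intro monomial_mult_form[OF x_gr]) auto
    have cc: "c \<in> carrier A" "monomial A0 x m n \<in> carrier A" "?f \<in> carrier A"
      using add(1) C_carrier monomial_car form_car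
      unfolding monomial_A0 by auto
    have "(c \<otimes> monomial A0 x m n \<oplus> a) \<otimes> ?f = c \<otimes> form x v n \<oplus> a \<otimes> ?f"
      using cc a mf by (simp add: l_distr m_assoc)
    then have "(c \<otimes> monomial A0 x m n \<oplus> a) \<otimes> ?f = (F ^^ k) (t' \<oplus> t)"
      using t'(2) t(4) tc by (simp add: additive_add[OF Fk_additive])
    then show "\<exists>t\<in>gr (int n). d t = \<zero> \<and> t \<in> N r \<and>
        ((c \<otimes>\<^bsub>A0\<^esub> monomial A0 x m n) \<oplus>\<^bsub>A0\<^esub> a) \<otimes> ?f = (F ^^ k) t"
      using t t' t'N N_add gr_add tc by (intro bexI[of _ "t' \<oplus> t"]) (auto simp: d_add)
  qed
qed

lemma V_pow:
  assumes "a \<in> V ` gr 0" shows "\<exists>y\<in>gr 0. a [^] r = (V ^^ r) y"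
proof (induction r)
  case (Suc r)
  then obtain y where y: "y \<in> gr 0" "a [^] r = (V ^^ r) y" by blast
  obtain z where z: "z \<in> gr 0" "a = V z" using assms by blast
  have c: "y \<in> carrier A" "z \<in> carrier A" using y z gr_carrier by auto
  have "a [^] Suc r = (V ^^ r) (y \<otimes> (F ^^ r) (V z))"
    using y z c Vk_projection[of y "V z" r] by (simp add: V_closed)
  also have "(F ^^ r) (V z) = V ((F ^^ r) z)"
    using c by (induction r) (simp_all add: V_F_commute Fk_closed)
  also have "y \<otimes> V ((F ^^ r) z) = V (F y \<otimes> (F ^^ r) z)"
    using Vk_projection_left[of "(F ^^ r) z" y 1] c by (simp add: Fk_closed)
  finally have "a [^] Suc r = (V ^^ Suc r) (F y \<otimes> (F ^^ r) z)" by (simp add: funpow_swap1)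
  then show ?case using y z by (intro bexI[of _ "F y \<otimes> (F ^^ r) z"] mult_gr0 F_gr Fk_gr)
qed (auto intro: one_gr)

text \<open>
  The heart of the proof.  Membership in \<open>N r\<close> is shown for every \<open>r\<close>, by computing \<open>a\<^sup>r\<close> times the form
  with exponents \<open>p\<^sup>k - m0\<close> in two ways, where \<open>m0\<close> is the dominant monomial of \<open>a\<^sup>r\<close>: term by term it
  is \<open>F\<^sup>k u\<close> with \<open>u\<close> equal to a unit times the form in question plus an element of \<open>N r\<close>, and as a
  multiple of \<open>a\<^sup>r\<close> it is \<open>V\<^sup>r \<alpha>\<close>.  Both sides are closed, so \<open>\<alpha>\<close> has an \<open>F\<^sup>r\<^sup>+\<^sup>k\<close>-preimage and
  \<open>u\<close> is divisible by \<open>p\<^sup>r\<close>.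
\<close>

theorem form_vanishes:
  assumes "a \<in> dominated A0 C x n" "a \<in> V ` gr 0"
  shows "form x (\<lambda>_. 1) n = \<zero>"
proof (rule N_separated[OF form_grx])
  fix r :: nat
  interpret S: monomial_sums A0 C x n
    using A0_cring C_gr C_one C_mult x_gr
    by (intro monomial_sums.intro monomial_sums_axioms.intro) auto
  let ?\<omega> = "form x (\<lambda>_. 1) n"
  obtain c m0 b where b: "a [^] r = c \<otimes> monomial A x m0 n \<oplus> b" "c \<in> C" "\<forall>j\<ge>n. m0 j = 0"
    "b \<in> lower_terms A0 C x n m0"
    using S.dominated_pow[OF assms(1), of r] by (auto simp: dominated_def A0_pow monomial_A0)
  have bc: "b \<in> carrier A" using S.lower_closed[OF b(4)] gr_carrier by simp
  obtain K where K: "\<And>k. k \<ge> K \<Longrightarrow> (\<forall>j<n. m0 j < p ^ k) \<Longrightarrow>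
    (\<exists>t\<in>gr (int n). d t = \<zero> \<and> t \<in> N r \<and> b \<otimes> form x (\<lambda>j. p ^ k - m0 j) n = (F ^^ k) t)"
    using lower_terms_mult_form[OF b(3,4), of r] by blast
  define k where "k = K + (\<Sum>j<n. m0 j)"
  have lt: "m0 j < p ^ k" if "j < n" for j
  proof -
    have "m0 j \<le> k" using that member_le_sum[of j "{..<n}" m0] by (auto simp: k_def)
    also have "k < p ^ k" using prime_gt_1_nat[OF prime_p] by (simp add: power_gt_expt)
    finally show ?thesis .
  qed
  let ?f = "form x (\<lambda>j. p ^ k - m0 j) n"
  obtain t where t: "t \<in> gr (int n)" "t \<in> N r" "d t = \<zero>" "b \<otimes> ?f = (F ^^ k) t"
    using K[of k] lt by (auto simp: k_def)
  obtain c' where c': "c' \<in> C" "c = (F ^^ k) c'" using C_roots b(2) by blast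
  have cc: "c \<in> carrier A" "c' \<in> carrier A" "?f \<in> carrier A" "?\<omega> \<in> carrier A" "t \<in> carrier A"
    "monomial A x m0 n \<in> carrier A"
    using b c' C_carrier form_car gr_carrier[OF t(1)] monomial_car by auto
  have "monomial A x m0 n \<otimes> ?f = form x (\<lambda>j. m0 j + (p ^ k - m0 j)) n"
    using lt by (intro monomial_mult_form[OF x_gr]) auto
  also have "\<dots> = form x (\<lambda>j. p ^ k * 1) n"
    using lt by (intro form_cong) (simp_all add: less_imp_le)
  also have "\<dots> = (F ^^ k) ?\<omega>" using Fk_form[of x n "\<lambda>_. 1" k, OF x_gr F_x] by simp
  finally have lead: "monomial A x m0 n \<otimes> ?f = (F ^^ k) ?\<omega>" .
  define u where "u = c' \<otimes> ?\<omega> \<oplus> t"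
  have u: "u \<in> gr (int n)" "u \<in> carrier A"
    using gr_add[OF C_form(1)[OF c'(1), of "\<lambda>_. 1"] t(1)] gr_carrier unfolding u_def by auto
  have Fu: "a [^] r \<otimes> ?f = (F ^^ k) u"
    using b(1) cc bc lead c'(2) t(4)
    by (simp add: u_def l_distr m_assoc additive_add[OF Fk_additive] Fk_mult)
  obtain y where y: "y \<in> gr 0" "a [^] r = (V ^^ r) y" using V_pow[OF assms(2)] by blast
  define \<alpha> where "\<alpha> = y \<otimes> (F ^^ r) ?f"
  have \<alpha>: "\<alpha> \<in> gr (int n)"
    unfolding \<alpha>_def by (rule mult_gr0[OF y(1) Fk_gr[OF form_grx]])
  have \<alpha>c: "\<alpha> \<in> carrier A" by (rule gr_carrier[OF \<alpha>])
  have V\<alpha>: "(V ^^ r) \<alpha> = (F ^^ k) u"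
    using Vk_projection[of y ?f r] y gr_carrier cc Fu by (simp add: \<alpha>_def)
  have "d u = \<zero>"
    unfolding u_def using cc C_form[OF c'(1)] t gr_carrier by (simp add: d_add)
  then have "d ((F ^^ k) u) = \<zero>"
    using d_Fk[OF u(2)] by (simp add: additive_zero[OF Fk_additive])
  then have "d \<alpha> = \<zero>"
    using Fk_d_Vk[OF \<alpha>c, of r] V\<alpha> by (simp add: additive_zero[OF Fk_additive])
  then obtain \<beta> where \<beta>: "\<beta> \<in> gr (int n)" "\<alpha> = (F ^^ (r + k)) \<beta>"
    using closed_Fk[OF \<alpha>] by metis
  have \<beta>c: "\<beta> \<in> carrier A" using \<beta> gr_carrier by blast
  have "(F ^^ k) u = (V ^^ r) ((F ^^ r) ((F ^^ k) \<beta>))" using V\<alpha> \<beta>(2) by (simp add: funpow_add)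
  also have "\<dots> = (F ^^ k) ([(p ^ r)] \<cdot> \<beta>)"
    using Vk_Fk[of "(F ^^ k) \<beta>" r] \<beta>c additive_smult[OF Fk_additive] by (simp add: Fk_closed)
  finally have "u = [(p ^ r)] \<cdot> \<beta>" using Fk_inj[of k] u(2) \<beta>c by (auto dest: inj_onD)
  then have "u \<in> N r" using N_p \<beta>c by simp
  moreover have "c' \<otimes> ?\<omega> = u \<ominus> t"
    using cc by (simp add: u_def a_minus_def a_assoc r_neg)
  ultimately have c\<omega>: "c' \<otimes> ?\<omega> \<in> N r" using t(2) N_minus by simp
  obtain e where e: "e \<in> C" "e \<otimes> c' = \<one>" using C_unit c'(1) by blast
  have "e \<otimes> (c' \<otimes> ?\<omega>) = ?\<omega>" using e C_carrier cc by (simp add: m_assoc[symmetric])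
  then show "?\<omega> \<in> N r" using N_left_ideal[OF _ c\<omega>, of e 0] e C_gr by auto
qed

end

section \<open>Closed subalgebras and the bicommutant\<close>

text \<open>
  A graded subalgebra closed under the operations of saturation (\<open>F\<close>-preimages and division by \<open>p\<close>) and of
  completion (limits).  Closure under \<open>V\<close> follows, since \<open>F (V z) = p z\<close>.
\<close>

locale closed_subalgebra = strict_algebra +
  fixes T :: "int \<Rightarrow> 'a set"
  assumes T_gr: "z \<in> T n \<Longrightarrow> z \<in> gr n"
    and T_zero: "\<zero> \<in> T n"
    and T_add: "y \<in> T n \<Longrightarrow> z \<in> T n \<Longrightarrow> y \<oplus> z \<in> T n"
    and T_neg: "z \<in> T n \<Longrightarrow> \<ominus> z \<in> T n"
    and T_one: "\<one> \<in> T 0"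
    and T_mult: "y \<in> T m \<Longrightarrow> z \<in> T n \<Longrightarrow> y \<otimes> z \<in> T (m + n)"
    and T_d: "z \<in> T n \<Longrightarrow> d z \<in> T (n + 1)"
    and T_F: "z \<in> T n \<Longrightarrow> F z \<in> T n"
    and T_F_inv: "z \<in> gr n \<Longrightarrow> F z \<in> T n \<Longrightarrow> z \<in> T n"
    and T_p_div: "z \<in> gr n \<Longrightarrow> [p] \<cdot> z \<in> T n \<Longrightarrow> z \<in> T n"
    and T_limit: "z \<in> gr n \<Longrightarrow> (\<And>r. \<exists>t\<in>T n. z \<ominus> t \<in> N r) \<Longrightarrow> z \<in> T n"

text \<open>
  \<open>Theta m\<close> consists of the products of \<open>m\<close> differentials of elements of \<open>G\<close>.  Closure of \<open>G\<close> under \<open>V\<close>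
  makes every such product an \<open>F\<close>-image, since \<open>d g = F (d (V g))\<close>; the last assumption bounds the
  \<open>F\<close>-image of such a product by a multiple of another one.
\<close>

locale annihilating_generators = strict_algebra +
  fixes G :: "'a set" and i :: int
  assumes G_gr: "g \<in> G \<Longrightarrow> g \<in> gr 0"
    and G_V: "g \<in> G \<Longrightarrow> V g \<in> G"
    and G_F: "g \<in> G \<Longrightarrow> \<exists>a\<in>gr 0. \<exists>g'\<in>G. F (d g) = a \<otimes> d g'"
begin

primrec Theta :: "nat \<Rightarrow> 'a set" where
  "Theta 0 = {\<one>}"
| "Theta (Suc m) = {t \<otimes> d g | t g. t \<in> Theta m \<and> g \<in> G}"

text \<open>
  \<open>S\<close> annihilates \<open>Theta\<close> in total degree at least \<open>i\<close>, and \<open>T\<close> annihilates \<open>S\<close> in total degree at least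
  \<open>i\<close>; in both cases the differential is required to do the same, to make the families stable under \<open>d\<close>.
  There is no reason for \<open>S\<close> to be closed under multiplication, but \<open>T\<close> is, because \<open>S\<close> is a
  module over \<open>T\<close>.
\<close>

definition S :: "int \<Rightarrow> 'a set" where
  "S n = {s \<in> gr n. \<forall>m. \<forall>t\<in>Theta m.
     (n + int m \<ge> i \<longrightarrow> s \<otimes> t = \<zero>) \<and> (n + 1 + int m \<ge> i \<longrightarrow> d s \<otimes> t = \<zero>)}"

definition T :: "int \<Rightarrow> 'a set" where
  "T n = {z \<in> gr n. \<forall>m. \<forall>s\<in>S m.
     (m + n \<ge> i \<longrightarrow> s \<otimes> z = \<zero>) \<and> (m + n + 1 \<ge> i \<longrightarrow> s \<otimes> d z = \<zero>)}"

lemma G_car: "g \<in> G \<Longrightarrow> g \<in> carrier A"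
  using G_gr gr_carrier by blast

lemma Theta_gr: "t \<in> Theta m \<Longrightarrow> t \<in> gr (int m)"
proof (induction m arbitrary: t)
  case (Suc m)
  then obtain t' g where t: "t = t' \<otimes> d g" "t' \<in> Theta m" "g \<in> G" by auto
  then show ?case using mult_gr[OF Suc.IH d_gr0[OF G_gr]] by (auto simp: add.commute)
qed (simp add: one_gr)

lemma Theta_car: "t \<in> Theta m \<Longrightarrow> t \<in> carrier A"
  using Theta_gr gr_carrier by blast

lemma d_Theta: "t \<in> Theta m \<Longrightarrow> d t = \<zero>"
proof (induction m arbitrary: t)
  case (Suc m)
  then obtain t' g where t: "t = t' \<otimes> d g" "t' \<in> Theta m" "g \<in> G" by auto
  then show ?case
    using leibniz[OF Theta_gr, of t' m "d g"] Suc.IH Theta_car G_car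
    by (simp add: d_closed d_d)
qed (simp add: d_one)

lemma Theta_mult: "s \<in> Theta l \<Longrightarrow> t \<in> Theta m \<Longrightarrow> s \<otimes> t \<in> Theta (l + m)"
proof (induction m arbitrary: t)
  case 0 then show ?case using Theta_car by simp
next
  case (Suc m)
  then obtain t' g where t: "t = t' \<otimes> d g" "t' \<in> Theta m" "g \<in> G" by auto
  then have "s \<otimes> t = (s \<otimes> t') \<otimes> d g"
    using Theta_car[OF Suc.prems(1)] Theta_car[OF t(2)] G_car by (simp add: m_assoc d_closed)
  then show ?case using Suc.IH[OF Suc.prems(1) t(2)] t(3) by auto
qed

lemma Theta_F_surj: "t \<in> Theta m \<Longrightarrow> \<exists>t'\<in>Theta m. t = F t'"
proof (induction m arbitrary: t)
  case 0 then show ?case by (simp add: F_one)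
next
  case (Suc m)
  then obtain t0 g where t: "t = t0 \<otimes> d g" "t0 \<in> Theta m" "g \<in> G" by auto
  then obtain t' where t': "t' \<in> Theta m" "t0 = F t'" using Suc.IH by blast
  have "t = F (t' \<otimes> d (V g))"
    using t t' Theta_car G_car by (simp add: F_mult F_d_V d_closed V_closed)
  then show ?case using t' G_V[OF t(3)] by auto
qed

lemma Theta_F: "t \<in> Theta m \<Longrightarrow> \<exists>a\<in>gr 0. \<exists>t'\<in>Theta m. F t = a \<otimes> t'"
proof (induction m arbitrary: t)
  case 0 then show ?case using one_gr by (intro bexI[of _ \<one>]) (auto simp: F_one)
next
  case (Suc m)
  then obtain t0 g where t: "t = t0 \<otimes> d g" "t0 \<in> Theta m" "g \<in> G" by auto
  obtain a t' where t': "a \<in> gr 0" "t' \<in> Theta m" "F t0 = a \<otimes> t'" using Suc.IH t(2) by blast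
  obtain b g' where g': "b \<in> gr 0" "g' \<in> G" "F (d g) = b \<otimes> d g'" using G_F t(3) by blast
  have c: "a \<in> carrier A" "b \<in> carrier A" "t' \<in> carrier A" "d g' \<in> carrier A"
    using t' g' Theta_car G_car gr_carrier d_closed by auto
  have "F t = (a \<otimes> t') \<otimes> (b \<otimes> d g')"
    using t t' g' Theta_car G_car by (simp add: F_mult d_closed)
  also have "\<dots> = a \<otimes> ((t' \<otimes> b) \<otimes> d g')" using c by (simp add: m_assoc)
  also have "t' \<otimes> b = b \<otimes> t'" by (rule comm0[OF g'(1) Theta_gr[OF t'(2)]])
  finally have "F t = (a \<otimes> b) \<otimes> (t' \<otimes> d g')" using c by (simp add: m_assoc)
  moreover have "t' \<otimes> d g' \<in> Theta (Suc m)" using t' g' by auto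
  ultimately show ?case using mult_gr0[OF t'(1) g'(1)] by blast
qed

lemma S_gr: "s \<in> S n \<Longrightarrow> s \<in> gr n" by (simp add: S_def)
lemma S_car: "s \<in> S n \<Longrightarrow> s \<in> carrier A" using S_gr gr_carrier by blast
lemma S_ann: "s \<in> S n \<Longrightarrow> t \<in> Theta m \<Longrightarrow> n + int m \<ge> i \<Longrightarrow> s \<otimes> t = \<zero>"
  by (simp add: S_def)
lemma S_ann_d: "s \<in> S n \<Longrightarrow> t \<in> Theta m \<Longrightarrow> n + 1 + int m \<ge> i \<Longrightarrow> d s \<otimes> t = \<zero>"
  by (simp add: S_def)

lemma S_I:
  assumes "s \<in> gr n" "\<And>m t. t \<in> Theta m \<Longrightarrow> n + int m \<ge> i \<Longrightarrow> s \<otimes> t = \<zero>"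
    "\<And>m t. t \<in> Theta m \<Longrightarrow> n + 1 + int m \<ge> i \<Longrightarrow> d s \<otimes> t = \<zero>"
  shows "s \<in> S n"
  using assms by (simp add: S_def)

lemma S_d: assumes "s \<in> S n" shows "d s \<in> S (n + 1)"
proof (rule S_I)
  show "d s \<in> gr (n + 1)" using d_gr S_gr assms by blast
  fix m t assume t: "t \<in> Theta m"
  show "d s \<otimes> t = \<zero>" if "n + 1 + int m \<ge> i" using S_ann_d[OF assms t that] .
  show "d (d s) \<otimes> t = \<zero>" using d_d[OF S_car[OF assms]] Theta_car[OF t] by simp
qed

lemma S_Theta: assumes "s \<in> S n" "t \<in> Theta m" shows "s \<otimes> t \<in> S (n + int m)"
proof (rule S_I)
  note c = S_car[OF assms(1)] Theta_car[OF assms(2)]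
  show "s \<otimes> t \<in> gr (n + int m)" by (rule mult_gr[OF S_gr[OF assms(1)] Theta_gr[OF assms(2)]])
  fix l u assume u: "u \<in> Theta l"
  note uc = Theta_car[OF u] and tu = Theta_mult[OF assms(2) u]
  show "(s \<otimes> t) \<otimes> u = \<zero>" if "n + int m + int l \<ge> i"
    using S_ann[OF assms(1) tu] that c uc by (simp add: m_assoc add.assoc)
  have "d (s \<otimes> t) = d s \<otimes> t"
    using leibniz[OF S_gr[OF assms(1)] c(2)] d_Theta[OF assms(2)] c by (simp add: d_closed)
  then show "d (s \<otimes> t) \<otimes> u = \<zero>" if "n + int m + 1 + int l \<ge> i"
    using S_ann_d[OF assms(1) tu] that c uc by (simp add: m_assoc add_ac d_closed)
qed

text \<open>
  As \<open>t = F u\<close> with \<open>u\<close> in \<open>Theta m\<close>, the product \<open>F s t\<close> is \<open>F (s u)\<close>.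
\<close>

lemma S_F: assumes "s \<in> S n" shows "F s \<in> S n"
proof (rule S_I)
  note c = S_car[OF assms]
  show "F s \<in> gr n" by (rule F_gr[OF S_gr[OF assms]])
  fix m t assume t: "t \<in> Theta m"
  obtain u where u: "u \<in> Theta m" "t = F u" using Theta_F_surj t by blast
  note uc = Theta_car[OF u(1)]
  show "F s \<otimes> t = \<zero>" if "n + int m \<ge> i"
    using S_ann[OF assms u(1) that] u(2) c uc
    by (simp add: F_mult[symmetric] additive_zero[OF F_additive])
  show "d (F s) \<otimes> t = \<zero>" if "n + 1 + int m \<ge> i"
    using S_ann_d[OF assms u(1) that] u(2) c uc
    by (simp add: d_F add_pow_ldistr F_closed d_closed F_mult[symmetric] additive_zero[OF F_additive])
qed

text \<open>
  Annihilation can be tested after applying the injective map \<open>F\<close>, which turns \<open>V s t\<close> into \<open>p s F t\<close> and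
  \<open>d (V s) t\<close> into \<open>d s F t\<close>; and \<open>F t\<close> is a multiple of an element of \<open>Theta m\<close>.
\<close>

lemma S_V: assumes "s \<in> S n" shows "V s \<in> S n"
proof (rule S_I)
  note c = S_car[OF assms]
  show "V s \<in> gr n" by (rule V_gr[OF S_gr[OF assms]])
  fix m t assume t: "t \<in> Theta m"
  obtain a u where u: "a \<in> gr 0" "u \<in> Theta m" "F t = a \<otimes> u" using Theta_F t by blast
  note uc = Theta_car[OF u(2)] gr_carrier[OF u(1)] Theta_car[OF t]
  show "V s \<otimes> t = \<zero>" if i: "n + int m \<ge> i"
  proof (rule F_eq_zero)
    have "s \<otimes> F t = (s \<otimes> a) \<otimes> u" using u(3) c uc by (simp add: m_assoc)
    also have "s \<otimes> a = a \<otimes> s" by (rule comm0[OF u(1) S_gr[OF assms]])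
    finally have "s \<otimes> F t = \<zero>" using S_ann[OF assms u(2) i] c uc by (simp add: m_assoc)
    then show "F (V s \<otimes> t) = \<zero>" using c uc by (simp add: F_mult V_closed F_V add_pow_ldistr F_closed)
  qed (use c uc in \<open>simp add: V_closed\<close>)
  show "d (V s) \<otimes> t = \<zero>" if i: "n + 1 + int m \<ge> i"
  proof (rule F_eq_zero)
    have dc: "d s \<in> carrier A" using c d_closed by blast
    have "d s \<otimes> F t = (d s \<otimes> a) \<otimes> u" using u(3) dc uc by (simp add: m_assoc)
    also have "d s \<otimes> a = a \<otimes> d s" by (rule comm0[OF u(1) d_gr[OF S_gr[OF assms]]])
    finally have "d s \<otimes> F t = \<zero>" using S_ann_d[OF assms u(2) i] dc uc by (simp add: m_assoc)
    then show "F (d (V s) \<otimes> t) = \<zero>" using c uc by (simp add: F_mult V_closed F_d_V d_closed)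
  qed (use c uc in \<open>simp add: V_closed d_closed\<close>)
qed

lemma T_gr: "z \<in> T n \<Longrightarrow> z \<in> gr n" by (simp add: T_def)
lemma T_car: "z \<in> T n \<Longrightarrow> z \<in> carrier A" using T_gr gr_carrier by blast
lemma T_ann: "z \<in> T n \<Longrightarrow> s \<in> S m \<Longrightarrow> m + n \<ge> i \<Longrightarrow> s \<otimes> z = \<zero>"
  by (simp add: T_def)
lemma T_ann_d: "z \<in> T n \<Longrightarrow> s \<in> S m \<Longrightarrow> m + n + 1 \<ge> i \<Longrightarrow> s \<otimes> d z = \<zero>"
  by (simp add: T_def)

lemma T_I:
  assumes "z \<in> gr n" "\<And>m s. s \<in> S m \<Longrightarrow> m + n \<ge> i \<Longrightarrow> s \<otimes> z = \<zero>"
    "\<And>m s. s \<in> S m \<Longrightarrow> m + n + 1 \<ge> i \<Longrightarrow> s \<otimes> d z = \<zero>"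
  shows "z \<in> T n"
  using assms by (simp add: T_def)

lemma T_d: assumes "z \<in> T n" shows "d z \<in> T (n + 1)"
proof (rule T_I)
  show "d z \<in> gr (n + 1)" using d_gr T_gr assms by blast
  fix m s assume s: "s \<in> S m"
  show "s \<otimes> d z = \<zero>" if "m + (n + 1) \<ge> i" using T_ann_d[OF assms s] that by (simp add: add.assoc)
  show "s \<otimes> d (d z) = \<zero>" using d_d[OF T_car[OF assms]] S_car[OF s] by simp
qed

lemma swap_right_zero:
  assumes "s \<in> gr m" "z \<in> gr n" "t \<in> gr l" "(s \<otimes> t) \<otimes> z = \<zero>" shows "(s \<otimes> z) \<otimes> t = \<zero>"
proof -
  have c: "s \<in> carrier A" "z \<in> carrier A" "t \<in> carrier A" using assms gr_carrier by auto
  have "s \<otimes> (z \<otimes> t) = (if even (l * n) then s \<otimes> (t \<otimes> z) else \<ominus> (s \<otimes> (t \<otimes> z)))"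
    using graded_comm[OF assms(3,2)] c by (simp add: r_minus)
  then show ?thesis using assms(4) c by (simp add: m_assoc)
qed

text \<open>
  The module property: up to sign \<open>s z t = (s t) z\<close>, and \<open>s t\<close> is again in \<open>S\<close>.
\<close>

lemma S_T: assumes "s \<in> S m" "z \<in> T n" shows "s \<otimes> z \<in> S (m + n)"
proof (rule S_I)
  note g = S_gr[OF assms(1)] T_gr[OF assms(2)] and c = S_car[OF assms(1)] T_car[OF assms(2)]
  show "s \<otimes> z \<in> gr (m + n)" by (rule mult_gr[OF g])
  fix l t assume t: "t \<in> Theta l"
  note st = S_Theta[OF assms(1) t] and tc = Theta_car[OF t]
  show "(s \<otimes> z) \<otimes> t = \<zero>" if "m + n + int l \<ge> i"
    by (rule swap_right_zero[OF g Theta_gr[OF t] T_ann[OF assms(2) st]]) (use that in simp)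
  show "d (s \<otimes> z) \<otimes> t = \<zero>" if i: "m + n + 1 + int l \<ge> i"
  proof -
    have dst: "d s \<otimes> t \<in> S (m + 1 + int l)" by (rule S_Theta[OF S_d[OF assms(1)] t])
    have "(d s \<otimes> z) \<otimes> t = \<zero>"
      by (rule swap_right_zero[OF d_gr[OF g(1)] g(2) Theta_gr[OF t] T_ann[OF assms(2) dst]]) (use i in simp)
    moreover have "(s \<otimes> d z) \<otimes> t = \<zero>"
      by (rule swap_right_zero[OF g(1) d_gr[OF g(2)] Theta_gr[OF t] T_ann_d[OF assms(2) st]]) (use i in simp)
    ultimately show ?thesis
      using leibniz[OF g(1) c(2)] c tc by (simp add: l_distr l_minus d_closed)
  qed
qed

lemma T_mult: assumes "y \<in> T m" "z \<in> T n" shows "y \<otimes> z \<in> T (m + n)"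
proof (rule T_I)
  note c = T_car[OF assms(1)] T_car[OF assms(2)]
  show "y \<otimes> z \<in> gr (m + n)" by (rule mult_gr[OF T_gr[OF assms(1)] T_gr[OF assms(2)]])
  fix l s assume s: "s \<in> S l"
  note sc = S_car[OF s] and sy = S_T[OF s assms(1)] and sdy = S_T[OF s T_d[OF assms(1)]]
  show "s \<otimes> (y \<otimes> z) = \<zero>" if "l + (m + n) \<ge> i"
    using T_ann[OF assms(2) sy] that c sc by (simp add: m_assoc add.assoc)
  show "s \<otimes> d (y \<otimes> z) = \<zero>" if i: "l + (m + n) + 1 \<ge> i"
  proof -
    have 1: "s \<otimes> (d y \<otimes> z) = \<zero>"
      using T_ann[OF assms(2) sdy] i c sc by (simp add: m_assoc d_closed)
    have 2: "s \<otimes> (y \<otimes> d z) = \<zero>"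
      using T_ann_d[OF assms(2) sy] i c sc by (simp add: m_assoc d_closed)
    show ?thesis
      using 1 2 leibniz[OF T_gr[OF assms(1)] c(2)] c sc by (simp add: r_distr r_minus d_closed)
  qed
qed

lemma T_F: assumes "z \<in> T n" shows "F z \<in> T n"
proof (rule T_I)
  note c = T_car[OF assms]
  show "F z \<in> gr n" by (rule F_gr[OF T_gr[OF assms]])
  fix m s assume s: "s \<in> S m"
  note sc = S_car[OF s]
  have key: "s \<otimes> F w = \<zero>" if "V s \<otimes> w = \<zero>" "w \<in> carrier A" for w
  proof (rule torsion_free)
    have "[p] \<cdot> (s \<otimes> F w) = F (V s \<otimes> w)"
      using that(2) sc by (simp add: F_mult V_closed F_V add_pow_ldistr F_closed)
    then show "[p] \<cdot> (s \<otimes> F w) = \<zero>" using that(1) by (simp add: additive_zero[OF F_additive])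
  qed (use that sc F_closed in simp)
  show "s \<otimes> F z = \<zero>" if "m + n \<ge> i" by (rule key[OF T_ann[OF assms S_V[OF s] that] c])
  show "s \<otimes> d (F z) = \<zero>" if "m + n + 1 \<ge> i"
    using key[OF T_ann_d[OF assms S_V[OF s] that]] c sc
    by (simp add: d_F add_pow_rdistr F_closed d_closed)
qed

text \<open>
  An explicit description of a subalgebra by generators would not show this closure property.  For
  an annihilator it is immediate: \<open>F (s z) = F s F z = 0\<close> implies \<open>s z = 0\<close>.
\<close>

lemma T_F_inv: assumes "z \<in> gr n" "F z \<in> T n" shows "z \<in> T n"
proof (rule T_I)
  note c = gr_carrier[OF assms(1)]
  show "z \<in> gr n" by fact
  fix m s assume s: "s \<in> S m"
  note sc = S_car[OF s]
  show "s \<otimes> z = \<zero>" if "m + n \<ge> i"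
    by (rule F_eq_zero) (use T_ann[OF assms(2) S_F[OF s] that] c sc in \<open>simp_all add: F_mult\<close>)
  show "s \<otimes> d z = \<zero>" if "m + n + 1 \<ge> i"
  proof (rule F_eq_zero)
    have "[p] \<cdot> (F s \<otimes> F (d z)) = \<zero>"
      using T_ann_d[OF assms(2) S_F[OF s] that] c sc
      by (simp add: d_F add_pow_rdistr F_closed d_closed)
    then show "F (s \<otimes> d z) = \<zero>"
      using torsion_free[of "F s \<otimes> F (d z)"] c sc by (simp add: F_mult F_closed d_closed)
  qed (use c sc d_closed in simp)
qed

lemma T_limit:
  assumes "z \<in> gr n" "\<And>r. \<exists>t\<in>T n. z \<ominus> t \<in> N r" shows "z \<in> T n"
proof (rule T_I)
  note c = gr_carrier[OF assms(1)]
  show "z \<in> gr n" by fact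
  fix m s assume s: "s \<in> S m"
  note sc = S_car[OF s]
  show "s \<otimes> z = \<zero>" if i: "m + n \<ge> i"
  proof (rule N_separated[OF mult_gr[OF S_gr[OF s] assms(1)]])
    fix r
    obtain t where t: "t \<in> T n" "z \<ominus> t \<in> N r" using assms(2) by blast
    have "s \<otimes> (z \<ominus> t) = s \<otimes> z"
      using T_ann[OF t(1) s i] c sc T_car[OF t(1)] by (simp add: a_minus_def r_distr r_minus)
    then show "s \<otimes> z \<in> N r" using N_left_ideal[OF S_gr[OF s] t(2)] by simp
  qed
  show "s \<otimes> d z = \<zero>" if i: "m + n + 1 \<ge> i"
  proof (rule N_separated[OF mult_gr[OF S_gr[OF s] d_gr[OF assms(1)]]])
    fix r
    obtain t where t: "t \<in> T n" "z \<ominus> t \<in> N r" using assms(2) by blast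
    have "s \<otimes> d (z \<ominus> t) = s \<otimes> d z"
      unfolding additive_minus[OF d_additive c T_car[OF t(1)]]
      using T_ann_d[OF t(1) s i] c sc T_car[OF t(1)]
      by (simp add: a_minus_def r_distr r_minus d_closed)
    then show "s \<otimes> d z \<in> N r" using N_left_ideal[OF S_gr[OF s] d_N[OF t(2)]] by simp
  qed
qed

text \<open>
  \<open>Theta 0\<close> contains \<open>\<one>\<close>.
\<close>

lemma S_high: assumes "s \<in> S m" "m \<ge> i" shows "s = \<zero>"
  using S_ann[OF assms(1), of \<one> 0] assms(2) S_car[OF assms(1)] by simp

lemma G_T: assumes "g \<in> G" shows "g \<in> T 0"
proof (rule T_I)
  show "g \<in> gr 0" by (rule G_gr[OF assms])
  fix m s assume s: "s \<in> S m"
  show "s \<otimes> g = \<zero>" if "m + 0 \<ge> i"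
    using S_high[OF s] that G_car[OF assms] by simp
  have "d g \<in> Theta 1" using assms G_car d_closed by (force intro: exI[of _ \<one>])
  then show "s \<otimes> d g = \<zero>" if "m + 0 + 1 \<ge> i"
    using S_ann[OF s] that by fastforce
qed

sublocale T: closed_subalgebra p A T
proof
  show "\<one> \<in> T 0"
  proof (rule T_I[OF one_gr])
    fix m s assume s: "s \<in> S m"
    show "s \<otimes> \<one> = \<zero>" if "m + 0 \<ge> i" using S_high[OF s] that by simp
    show "s \<otimes> d \<one> = \<zero>" using S_car[OF s] by (simp add: d_one)
  qed
  fix n
  show "\<zero> \<in> T n"
    using S_car by (intro T_I) (auto simp: additive_zero[OF d_additive])
  fix z assume z: "z \<in> gr n" "[p] \<cdot> z \<in> T n"
  show "z \<in> T n"
  proof (rule T_I[OF z(1)])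
    note c = gr_carrier[OF z(1)]
    fix m s assume s: "s \<in> S m"
    note sc = S_car[OF s]
    show "s \<otimes> z = \<zero>" if "m + n \<ge> i"
      using T_ann[OF z(2) s that] torsion_free[of "s \<otimes> z"] c sc by (simp add: add_pow_rdistr)
    show "s \<otimes> d z = \<zero>" if "m + n + 1 \<ge> i"
      using T_ann_d[OF z(2) s that] torsion_free[of "s \<otimes> d z"] c sc
      by (simp add: add_pow_rdistr additive_smult[OF d_additive] d_closed)
  qed
next
  fix n y z assume yz: "y \<in> T n" "z \<in> T n"
  note c = T_car[OF yz(1)] T_car[OF yz(2)]
  show "y \<oplus> z \<in> T n"
  proof (rule T_I[OF gr_add[OF T_gr[OF yz(1)] T_gr[OF yz(2)]]])
    fix m s assume s: "s \<in> S m"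
    show "s \<otimes> (y \<oplus> z) = \<zero>" if "m + n \<ge> i"
      using T_ann[OF yz(1) s that] T_ann[OF yz(2) s that] c S_car[OF s] by (simp add: r_distr)
    show "s \<otimes> d (y \<oplus> z) = \<zero>" if "m + n + 1 \<ge> i"
      using T_ann_d[OF yz(1) s that] T_ann_d[OF yz(2) s that] c S_car[OF s]
      by (simp add: r_distr d_add d_closed)
  qed
next
  fix n z assume z: "z \<in> T n"
  note c = T_car[OF z]
  show "\<ominus> z \<in> T n"
  proof (rule T_I[OF gr_neg[OF T_gr[OF z]]])
    fix m s assume s: "s \<in> S m"
    show "s \<otimes> \<ominus> z = \<zero>" if "m + n \<ge> i"
      using T_ann[OF z s that] c S_car[OF s] by (simp add: r_minus)
    show "s \<otimes> d (\<ominus> z) = \<zero>" if "m + n + 1 \<ge> i"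
      using T_ann_d[OF z s that] c S_car[OF s]
      by (simp add: r_minus additive_neg[OF d_additive] d_closed)
  qed
qed (fact T_gr T_mult T_d T_F T_F_inv T_limit)+

text \<open>
  If all products of \<open>i\<close> or more differentials vanish, then \<open>\<one>\<close> belongs to \<open>S 0\<close>, and so \<open>T\<close> must
  annihilate it.
\<close>

lemma T_vanishes:
  assumes van: "\<And>m t. t \<in> Theta m \<Longrightarrow> int m \<ge> i \<Longrightarrow> t = \<zero>" and n: "n \<ge> i"
  shows "T n = {\<zero>}"
proof -
  have one: "\<one> \<in> S 0"
    by (rule S_I[OF one_gr]) (use van Theta_car in \<open>auto simp: d_one\<close>)
  show ?thesis using T_ann[OF _ one] n T_car T.T_zero by auto
qed

end

section \<open>Closed subalgebras are strict Dieudonne algebras\<close>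

context closed_subalgebra
begin

lemma T_car: "z \<in> T n \<Longrightarrow> z \<in> carrier A" using T_gr gr_carrier by blast

lemma T_V: assumes "z \<in> T n" shows "V z \<in> T n"
proof (rule T_F_inv)
  show "V z \<in> gr n" by (rule V_gr[OF T_gr[OF assms]])
  have "[(k::nat)] \<cdot> z \<in> T n" for k
    by (induction k) (simp_all add: T_zero T_add assms)
  then show "F (V z) \<in> T n" by (simp add: F_V T_car[OF assms])
qed

lemma T_Vk: "z \<in> T n \<Longrightarrow> (V ^^ k) z \<in> T n"
  by (induction k) (auto intro: T_V)

lemma T_V_inv: assumes "z \<in> gr n" "V z \<in> T n" shows "z \<in> T n"
  using T_p_div[OF assms(1)] T_F[OF assms(2)] F_V[OF gr_carrier[OF assms(1)]] by simp

abbreviation H :: "'a set" where "H \<equiv> hspan A T"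

lemma H_car: "x \<in> H \<Longrightarrow> x \<in> carrier A"
  using hspan_closed[of T] T_gr by blast

lemma T_H: "z \<in> T n \<Longrightarrow> z \<in> H"
  using hspan.add[of z T n \<zero> A] hspan.zero[of A T] T_car by fastforce

lemma H_induct [consumes 1, case_names zero add]:
  assumes "x \<in> H" "P \<zero>" "\<And>a n x. a \<in> T n \<Longrightarrow> x \<in> H \<Longrightarrow> P x \<Longrightarrow> P (a \<oplus> x)"
  shows "P x"
  using assms(1) by induction (use assms in auto)

lemma H_add: "x \<in> H \<Longrightarrow> y \<in> H \<Longrightarrow> x \<oplus> y \<in> H"
proof (induction x rule: H_induct)
  case zero then show ?case using H_car by simp
next
  case (add a n x)
  then have "a \<oplus> x \<oplus> y = a \<oplus> (x \<oplus> y)" using T_car H_car by (intro a_assoc) auto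
  then show ?case using add hspan.add by metis
qed

lemma H_additive:
  assumes "additive U" "\<And>n z. z \<in> T n \<Longrightarrow> \<exists>m. U z \<in> T m" "x \<in> H" shows "U x \<in> H"
  using assms(3)
proof (induction x rule: H_induct)
  case zero then show ?case using assms(1) by (simp add: additive_zero hspan.zero)
next
  case (add a n x)
  then obtain m where "U a \<in> T m" using assms(2) by blast
  moreover have "U (a \<oplus> x) = U a \<oplus> U x" using add assms(1) T_car H_car by (intro additive_add) auto
  ultimately show ?case using add hspan.add by metis
qed

lemma H_neg: "x \<in> H \<Longrightarrow> \<ominus> x \<in> H"
  by (rule H_additive[of "\<lambda>x. \<ominus> x"]) (auto simp: additive_def minus_add a_comm intro: T_neg)

lemma H_d: "x \<in> H \<Longrightarrow> d x \<in> H"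
  by (rule H_additive[OF d_additive]) (auto intro: T_d)

lemma H_F: "x \<in> H \<Longrightarrow> F x \<in> H"
  by (rule H_additive[OF F_additive]) (auto intro: T_F)

lemma H_V: "x \<in> H \<Longrightarrow> V x \<in> H"
  by (rule H_additive[OF V_additive]) (auto intro: T_V)

lemma H_mult: assumes "x \<in> H" "y \<in> H" shows "x \<otimes> y \<in> H"
  using assms(1)
proof (induction x rule: H_induct)
  case zero then show ?case using H_car[OF assms(2)] by (simp add: hspan.zero)
next
  case (add a n x)
  have "a \<otimes> y \<in> H"
    using T_car[OF add(1)] T_mult[OF add(1)] assms(2)
    by (intro H_additive[of "\<lambda>y. a \<otimes> y"]) (auto simp: additive_def r_distr)
  moreover have "(a \<oplus> x) \<otimes> y = a \<otimes> y \<oplus> x \<otimes> y"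
    using T_car[OF add(1)] H_car add assms by (intro l_distr) auto
  ultimately show ?case using add H_add by simp
qed

lemma H_component: "x \<in> H \<Longrightarrow> component x n \<in> T n"
  by (rule component_in_hspan) (auto intro: T_zero T_add T_gr)

lemma H_gr: "x \<in> H \<Longrightarrow> x \<in> gr n \<Longrightarrow> x \<in> T n"
  using H_component[of x n] component_homogeneous[of x n] by simp

primrec V_sum :: "(nat \<Rightarrow> 'a) \<Rightarrow> nat \<Rightarrow> 'a" where
  "V_sum c 0 = \<zero>"
| "V_sum c (Suc t) = V_sum c t \<oplus> (V ^^ t) (c t)"

lemma V_sum_T: "(\<And>s. c s \<in> T n) \<Longrightarrow> V_sum c t \<in> T n"
  by (induction t) (auto intro: T_zero T_add T_Vk)

lemma V_series:
  assumes "\<And>s. c s \<in> T n"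
  obtains u where "u \<in> T n" "\<And>t. u \<ominus> V_sum c t \<in> N t"
proof -
  have sT: "V_sum c t \<in> T n" for t by (rule V_sum_T[OF assms])
  then have g: "V_sum c t \<in> gr n" for t using T_gr by blast
  have car: "V_sum c t \<in> carrier A" "c t \<in> carrier A" for t using g gr_carrier assms T_car by blast+
  have "V_sum c (Suc t) \<ominus> V_sum c t \<in> N t" for t
  proof -
    have "V_sum c (Suc t) \<ominus> V_sum c t = (V ^^ t) (c t)"
      using car a_comm[of "V_sum c t" "(V ^^ t) (c t)"] Vk_closed[of "c t" t]
      by (simp add: a_minus_def a_assoc r_neg)
    then show ?thesis using N_V car by simp
  qed
  then obtain u where u: "u \<in> gr n" "\<And>t. u \<ominus> V_sum c t \<in> N t"
    using strict_complete[of "V_sum c" n, OF strict g] by blast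
  then have "u \<in> T n" using sT by (intro T_limit) blast+
  then show ?thesis using that u by blast
qed

text \<open>
  A closed subalgebra is complete for its own filtration, which may be finer than the one
  induced from \<open>A\<close>.  The limit \<open>a\<close> is taken in \<open>A\<close>.  The remainder \<open>a - b r\<close> is the sum over \<open>s \<ge> r\<close> of
  \<open>V\<^sup>s (y s) + d V\<^sup>s (z s)\<close>; here \<open>V\<^sup>r\<close> can be factored out, leaving series whose sums are again in the
  subalgebra.
\<close>

lemma T_complete:
  assumes b: "\<And>r. b r \<in> T n"
    and step: "\<And>r. \<exists>y\<in>T n. \<exists>z\<in>T (n - 1). b (Suc r) \<ominus> b r = (V ^^ r) y \<oplus> d ((V ^^ r) z)"
  shows "\<exists>a\<in>T n. \<forall>r. \<exists>y\<in>T n. \<exists>z\<in>T (n - 1). a \<ominus> b r = (V ^^ r) y \<oplus> d ((V ^^ r) z)"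
proof -
  obtain y z where yz: "\<And>r. y r \<in> T n" "\<And>r. z r \<in> T (n - 1)"
    "\<And>r. b (Suc r) \<ominus> b r = (V ^^ r) (y r) \<oplus> d ((V ^^ r) (z r))"
    using step by metis
  have c: "b r \<in> carrier A" "y r \<in> carrier A" "z r \<in> carrier A" for r
    using b yz T_car by blast+
  have "b (Suc r) \<ominus> b r \<in> N r" for r
    unfolding yz(3) by (intro N_add N_V N_dV c)
  then obtain a where a: "a \<in> gr n" "\<And>r. a \<ominus> b r \<in> N r"
    using strict_complete[of b n, OF strict T_gr[OF b]] by blast
  have ac: "a \<in> carrier A" by (rule gr_carrier[OF a(1)])
  have "a \<in> T n" using a b by (intro T_limit) blast+
  moreover have "\<exists>u\<in>T n. \<exists>v\<in>T (n - 1). a \<ominus> b r = (V ^^ r) u \<oplus> d ((V ^^ r) v)" for r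
  proof -
    define ys where "ys s = y (r + s)" for s
    define zs where "zs s = z (r + s)" for s
    have ysT: "ys s \<in> T n" and zsT: "zs s \<in> T (n - 1)" for s by (simp_all add: ys_def zs_def yz)
    obtain u where u: "u \<in> T n" "\<And>t. u \<ominus> V_sum ys t \<in> N t" using V_series[of ys n, OF ysT] by blast
    obtain v where v: "v \<in> T (n - 1)" "\<And>t. v \<ominus> V_sum zs t \<in> N t" using V_series[of zs "n - 1", OF zsT] by blast
    have sc: "V_sum ys t \<in> carrier A" "V_sum zs t \<in> carrier A" "ys t \<in> carrier A" "zs t \<in> carrier A" for t
      using V_sum_T[of ys n, OF ysT] V_sum_T[of zs "n - 1", OF zsT] ysT zsT T_car by blast+
    have uc: "u \<in> carrier A" "v \<in> carrier A" using u v T_car by blast+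
    have partial: "b (r + t) = b r \<oplus> ((V ^^ r) (V_sum ys t) \<oplus> d ((V ^^ r) (V_sum zs t)))" for t
    proof (induction t)
      case 0
      then show ?case using c by (simp add: additive_zero[OF Vk_additive] additive_zero[OF d_additive])
    next
      case (Suc t)
      have "b (r + Suc t) = b (r + t) \<oplus> ((V ^^ (r + t)) (ys t) \<oplus> d ((V ^^ (r + t)) (zs t)))"
        using add_minus_cancel[OF c(1) c(1), of "r + t" "Suc (r + t)"] yz(3)[of "r + t"]
        by (simp add: ys_def zs_def)
      also have "\<dots> = b r \<oplus> ((V ^^ r) (V_sum ys (Suc t)) \<oplus> d ((V ^^ r) (V_sum zs (Suc t))))"
        unfolding Suc.IH using c sc
        by (simp add: additive_add[OF Vk_additive] d_add funpow_add Vk_closed d_closed a_ac)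
      finally show ?case .
    qed
    define w where "w = (V ^^ r) u \<oplus> d ((V ^^ r) v)"
    have wc: "w \<in> carrier A" using uc by (simp add: w_def Vk_closed d_closed)
    have "a \<ominus> (b r \<oplus> w) \<in> N t" for t
    proof (rule N_cong_trans[of a "b (r + t)"])
      show "a \<ominus> b (r + t) \<in> N t" using a(2)[of "r + t"] N_mono[of t "r + t"] by auto
      have Vcong: "(V ^^ r) (V_sum q t) \<ominus> (V ^^ r) x \<in> N t"
        if "x \<in> carrier A" "V_sum q t \<in> carrier A" "x \<ominus> V_sum q t \<in> N t" for q x
      proof -
        have "(V ^^ r) (\<ominus> (x \<ominus> V_sum q t)) \<in> N (r + t)" by (intro Vk_N N_neg that)
        moreover have "\<ominus> (x \<ominus> V_sum q t) = V_sum q t \<ominus> x"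
          using that by (simp add: a_minus_def minus_add a_comm)
        ultimately show ?thesis
          using that N_mono[of t "r + t"] by (auto simp: additive_minus[OF Vk_additive])
      qed
      have dcong: "d ((V ^^ r) (V_sum zs t)) \<ominus> d ((V ^^ r) v) \<in> N t"
        using d_N[OF Vcong[OF uc(2) sc(2) v(2)]] uc sc
        by (simp add: additive_minus[OF d_additive] Vk_closed)
      have "b r \<ominus> b r \<in> N t" using minus_eq_zero_iff[OF c(1) c(1), of r r] N_zero[of t] by simp
      then show "b (r + t) \<ominus> (b r \<oplus> w) \<in> N t"
        unfolding partial w_def using c sc uc
        by (intro N_cong_add Vcong dcong u(2)) (auto simp: Vk_closed d_closed)
    qed (use ac c wc in auto)
    then have "a \<ominus> (b r \<oplus> w) = \<zero>"
    proof (intro N_separated[of _ n])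
      show "a \<ominus> (b r \<oplus> w) \<in> gr n"
        unfolding w_def using a(1) T_gr[OF b] T_gr[OF u(1)] d_gr[OF Vk_gr[OF T_gr[OF v(1)]], of r]
        by (intro gr_minus gr_add Vk_gr) auto
    qed
    then have "a = b r \<oplus> w" using ac c wc by (simp add: minus_eq_zero_iff)
    then have "a \<ominus> b r = w" using c wc a_comm[of "b r" w] by (simp add: a_minus_def a_assoc r_neg)
    then show ?thesis unfolding w_def using u v by blast
  qed
  ultimately show ?thesis by blast
qed

end

text \<open>
  The copy of the subalgebra \<open>T\<close> of \<open>A\<close> along an injection \<open>e\<close> into another type.  It is needed because
  the test objects of the universal property have a prescribed type of elements.
\<close>

definition embedded_copy :: "'a dieudonne \<Rightarrow> (int \<Rightarrow> 'a set) \<Rightarrow> ('a \<Rightarrow> 'b) \<Rightarrow> 'b dieudonne" where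
  "embedded_copy A T e = \<lparr>carrier = e ` hspan A T,
     monoid.mult = (\<lambda>u v. e (inv_into UNIV e u \<otimes>\<^bsub>A\<^esub> inv_into UNIV e v)), monoid.one = e \<one>\<^bsub>A\<^esub>,
     ring.zero = e \<zero>\<^bsub>A\<^esub>, ring.add = (\<lambda>u v. e (inv_into UNIV e u \<oplus>\<^bsub>A\<^esub> inv_into UNIV e v)),
     grade = (\<lambda>n. e ` T n), diff = (\<lambda>u. e (diff A (inv_into UNIV e u))), frob = (\<lambda>u. e (frob A (inv_into UNIV e u)))\<rparr>"

locale embedded_subalgebra = closed_subalgebra +
  fixes e :: "'a \<Rightarrow> 'b"
  assumes inj_e: "inj e"
begin

abbreviation B :: "'b dieudonne" where "B \<equiv> embedded_copy A T e"

lemma e_inv [simp]: "inv_into UNIV e (e x) = x" using inj_e by simp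

lemma e_eq [simp]: "e x = e y \<longleftrightarrow> x = y" using inj_e by (auto dest: injD)

lemma embedded_copy_simps [simp]:
  "carrier B = e ` H" "e x \<otimes>\<^bsub>B\<^esub> e y = e (x \<otimes> y)" "\<one>\<^bsub>B\<^esub> = e \<one>" "\<zero>\<^bsub>B\<^esub> = e \<zero>"
  "e x \<oplus>\<^bsub>B\<^esub> e y = e (x \<oplus> y)" "grade B n = e ` T n" "diff B (e x) = e (d x)" "frob B (e x) = e (F x)"
  by (simp_all add: embedded_copy_def)

lemma B_abelian_group: "abelian_group B"
proof (rule abelian_groupI)
  fix u v w assume "u \<in> carrier B" "v \<in> carrier B" "w \<in> carrier B"
  then obtain x y z where xyz: "u = e x" "v = e y" "w = e z" "x \<in> H" "y \<in> H" "z \<in> H" by auto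
  then show "u \<oplus>\<^bsub>B\<^esub> v \<oplus>\<^bsub>B\<^esub> w = u \<oplus>\<^bsub>B\<^esub> (v \<oplus>\<^bsub>B\<^esub> w)" "u \<oplus>\<^bsub>B\<^esub> v = v \<oplus>\<^bsub>B\<^esub> u"
    using H_car by (simp_all add: a_ac)
next
  fix u assume "u \<in> carrier B"
  then obtain x where x: "u = e x" "x \<in> H" by auto
  then show "\<zero>\<^bsub>B\<^esub> \<oplus>\<^bsub>B\<^esub> u = u" using H_car by simp
  show "\<exists>y\<in>carrier B. y \<oplus>\<^bsub>B\<^esub> u = \<zero>\<^bsub>B\<^esub>"
    using x H_car H_neg by (intro bexI[of _ "e (\<ominus> x)"]) (auto simp: l_neg)
qed (auto intro: H_add hspan.zero)

lemma B_neg: assumes "x \<in> H" shows "\<ominus>\<^bsub>B\<^esub> e x = e (\<ominus> x)"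
proof -
  interpret B: abelian_group B by (rule B_abelian_group)
  show ?thesis
    by (rule B.minus_equality) (use assms H_car H_neg in \<open>auto simp: l_neg\<close>)
qed

lemma B_minus: "x \<in> H \<Longrightarrow> y \<in> H \<Longrightarrow> e x \<ominus>\<^bsub>B\<^esub> e y = e (x \<ominus> y)"
  by (simp add: a_minus_def B_neg)

lemma B_ring: "ring B"
proof (rule ringI)
  show "monoid B"
  proof (rule monoidI)
    show "\<one>\<^bsub>B\<^esub> \<in> carrier B" using T_H[OF T_one] by simp
  qed (use H_car H_mult in \<open>auto simp: m_assoc\<close>)
qed (use B_abelian_group H_car in \<open>auto simp: l_distr r_distr\<close>)

lemma B_smult: "[(k::nat)] \<cdot>\<^bsub>B\<^esub> e x = e ([k] \<cdot> x)"
  by (induction k) (simp_all add: add_pow_def nat_pow_def)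

lemma B_pow: "e x [^]\<^bsub>B\<^esub> (k::nat) = e (x [^] k)"
  by (induction k) (simp_all add: nat_pow_def)

lemma B_finsum:
  assumes "finite I" "\<And>n. n \<in> I \<Longrightarrow> f n \<in> H"
  shows "finsum B (\<lambda>n. e (f n)) I = e (finsum A f I)"
proof -
  interpret B: abelian_group B by (rule B_abelian_group)
  show ?thesis
    using assms
  proof (induction I)
    case (insert n I)
    have "f \<in> I \<rightarrow> carrier A" "f n \<in> carrier A" "(\<lambda>n. e (f n)) \<in> I \<rightarrow> carrier B" "e (f n) \<in> carrier B"
      using insert.prems H_car by auto
    then show ?case using insert by (simp del: embedded_copy_simps(1))
  qed simp
qed

lemma B_graded: "graded_group B"
  unfolding graded_group_def
proof (intro conjI allI ballI)
  interpret B: abelian_group B by (rule B_abelian_group)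
  show "abelian_group B" by (rule B_abelian_group)
  fix n
  show "subgroup (grade B n) (add_monoid B)"
  proof (rule B.add.subgroupI)
    show "grade B n \<noteq> {}" using T_zero[of n] by auto
    fix u assume "u \<in> grade B n"
    then obtain x where "u = e x" "x \<in> T n" by auto
    then show "\<ominus>\<^bsub>B\<^esub> u \<in> grade B n"
      using B_neg[OF T_H] T_neg by auto
  qed (use T_H T_add in auto)
next
  fix u assume "u \<in> carrier B"
  then obtain x where x: "u = e x" "x \<in> H" by auto
  note xc = H_car[OF x(2)]
  let ?P = "\<lambda>f. (\<forall>n. f n \<in> grade B n) \<and> finite {n. f n \<noteq> \<zero>\<^bsub>B\<^esub>} \<and> u = finsum B f {n. f n \<noteq> \<zero>\<^bsub>B\<^esub>}"
  show "\<exists>!f. ?P f"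
  proof (rule ex1I[of _ "\<lambda>n. e (component x n)"])
    have "finsum B (\<lambda>n. e (component x n)) {n. component x n \<noteq> \<zero>} = e x"
      using B_finsum[of "{n. component x n \<noteq> \<zero>}" "component x"] component_spec(2,3)[OF xc] T_H[OF H_component[OF x(2)]]
      by presburger
    then show "?P (\<lambda>n. e (component x n))"
      using component_spec(2)[OF xc] H_component[OF x(2)] x(1) by simp
    fix f assume f: "?P f"
    define g where "g n = inv_into UNIV e (f n)" for n
    have g: "f n = e (g n)" "g n \<in> T n" for n using f by (auto simp: g_def dest!: spec[of _ n])
    have ne: "{n. f n \<noteq> \<zero>\<^bsub>B\<^esub>} = {n. g n \<noteq> \<zero>}" by (simp add: g(1))
    then have fin: "finite {n. g n \<noteq> \<zero>}" using f by simp
    have "e x = finsum B (\<lambda>n. e (g n)) {n. g n \<noteq> \<zero>}"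
      using f x(1) unfolding ne by (simp add: g(1)[symmetric])
    also have "\<dots> = e (finsum A g {n. g n \<noteq> \<zero>})"
      by (rule B_finsum[OF fin]) (use T_H g in blast)
    finally have "x = finsum A g {n. g n \<noteq> \<zero>}" by simp
    then have "component x = g" using g T_gr by (intro component_unique[OF fin]) auto
    then show "f = (\<lambda>n. e (component x n))" using g by auto
  qed
qed

lemma B_graded_map:
  assumes "additive U" "\<And>n z. z \<in> T n \<Longrightarrow> U z \<in> T (n + k)" "\<And>x. W (e x) = e (U x)"
  shows "graded_map B k W"
  unfolding graded_map_def
proof (intro conjI allI)
  have "U x \<in> H" if "x \<in> H" for x
    by (rule H_additive[OF assms(1) _ that]) (use assms(2) in blast)
  then show "W \<in> hom (add_monoid B) (add_monoid B)"
    using H_car by (auto simp: hom_def assms(3) additive_add[OF assms(1)])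
  show "W ` grade B n \<subseteq> grade B (n + k)" for n using assms by auto
qed

lemma B_complex: "dieudonne_complex p B"
  unfolding dieudonne_complex_def
proof (intro conjI)
  show "graded_map B 1 (diff B)" by (rule B_graded_map[OF d_additive]) (auto intro: T_d)
  show "graded_map B 0 (frob B)" by (rule B_graded_map[OF F_additive]) (auto intro: T_F)
qed (use B_graded H_car in \<open>auto simp: d_d d_F B_smult\<close>)

lemma B_saturated: "saturated p B"
  unfolding saturated_def
proof (intro conjI allI ballI impI B_complex)
  fix n u assume u: "u \<in> grade B n" "[p] \<cdot>\<^bsub>B\<^esub> u = \<zero>\<^bsub>B\<^esub>"
  then show "u = \<zero>\<^bsub>B\<^esub>" using torsion_free T_car by (auto simp: B_smult)
next
  fix n
  show "bij_betw (frob B) (grade B n) {u \<in> grade B n. diff B u \<in> (\<lambda>v. [p] \<cdot>\<^bsub>B\<^esub> v) ` grade B (n + 1)}"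
    unfolding bij_betw_def
  proof (intro conjI equalityI subsetI)
    show "inj_on (frob B) (grade B n)"
      using F_inj T_car by (auto simp: inj_on_def)
    fix u assume "u \<in> frob B ` grade B n"
    then obtain x where x: "u = e (F x)" "x \<in> T n" by auto
    then have "diff B u = [p] \<cdot>\<^bsub>B\<^esub> e (F (d x))" by (simp add: B_smult d_F T_car)
    then show "u \<in> {u \<in> grade B n. diff B u \<in> (\<lambda>v. [p] \<cdot>\<^bsub>B\<^esub> v) ` grade B (n + 1)}"
      using x T_F T_d by auto
  next
    fix u assume "u \<in> {u \<in> grade B n. diff B u \<in> (\<lambda>v. [p] \<cdot>\<^bsub>B\<^esub> v) ` grade B (n + 1)}"
    then obtain x y where xy: "u = e x" "x \<in> T n" "y \<in> T (n + 1)" "d x = [p] \<cdot> y"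
      by (auto simp: B_smult)
    then obtain z where "z \<in> gr n" "x = F z" using F_surj T_gr by metis
    then show "u \<in> frob B ` grade B n" using xy T_F_inv by (auto intro!: image_eqI[of _ _ "e z"])
  qed
qed

lemma B_saturated_complex: "saturated_complex p B"
  using B_saturated prime_p by unfold_locales

lemma B_V: assumes "x \<in> H" shows "verschiebung p B (e x) = e (V x)"
proof -
  interpret B: saturated_complex p B by (rule B_saturated_complex)
  show ?thesis
    by (rule B.V_eqI) (use assms H_V H_car in \<open>auto simp: B_smult F_V\<close>)
qed

lemma B_Vk: "x \<in> H \<Longrightarrow> (verschiebung p B ^^ k) (e x) = e ((V ^^ k) x) \<and> (V ^^ k) x \<in> H"
  by (induction k) (auto simp: B_V H_V)

lemma B_strict: "strict p B"
proof -
  interpret B: saturated_complex p B by (rule B_saturated_complex)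
  show ?thesis
  proof (rule B.strictI)
    fix n u assume u: "u \<in> grade B n" "\<And>r. u \<in> V_fil p B r"
    then obtain x where x: "u = e x" "x \<in> T n" by auto
    have "x \<in> N r" for r
    proof -
      obtain a b where ab: "a \<in> H" "b \<in> H"
        "e x = (verschiebung p B ^^ r) (e a) \<oplus>\<^bsub>B\<^esub> diff B ((verschiebung p B ^^ r) (e b))"
        using u(2)[of r] x(1) unfolding B.N_iff by auto
      then have "x = (V ^^ r) a \<oplus> d ((V ^^ r) b)" using B_Vk by simp
      then show ?thesis using ab H_car N_iff by blast
    qed
    then show "u = \<zero>\<^bsub>B\<^esub>" using N_separated[OF T_gr[OF x(2)]] x by simp
  next
    fix n b assume b: "\<And>r. b r \<in> grade B n" "\<And>r. b (Suc r) \<ominus>\<^bsub>B\<^esub> b r \<in> V_fil p B r"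
    define c where "c r = inv_into UNIV e (b r)" for r
    have c: "b r = e (c r)" "c r \<in> T n" for r using b(1)[of r] by (auto simp: c_def)
    have "\<exists>y\<in>T n. \<exists>z\<in>T (n - 1). c (Suc r) \<ominus> c r = (V ^^ r) y \<oplus> d ((V ^^ r) z)" for r
    proof -
      have "b (Suc r) \<ominus>\<^bsub>B\<^esub> b r \<in> grade B n" by (rule B.gr_minus[OF b(1) b(1)])
      then obtain u v where uv: "u \<in> grade B n" "v \<in> grade B (n - 1)"
        "b (Suc r) \<ominus>\<^bsub>B\<^esub> b r = (verschiebung p B ^^ r) u \<oplus>\<^bsub>B\<^esub> diff B ((verschiebung p B ^^ r) v)"
        using B.N_homogeneous[OF _ b(2)] by metis
      then obtain y z where yz: "u = e y" "v = e z" "y \<in> T n" "z \<in> T (n - 1)" by auto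
      have "e (c (Suc r) \<ominus> c r) = e ((V ^^ r) y \<oplus> d ((V ^^ r) z))"
        using uv(3) B_Vk[OF T_H[OF yz(3)]] B_Vk[OF T_H[OF yz(4)]] yz(1,2)
        by (simp add: c(1) B_minus T_H[OF c(2)])
      then show ?thesis using yz by auto
    qed
    then obtain a where a: "a \<in> T n"
      "\<And>r. \<exists>y\<in>T n. \<exists>z\<in>T (n - 1). a \<ominus> c r = (V ^^ r) y \<oplus> d ((V ^^ r) z)"
      using T_complete[of c n, OF c(2)] by blast
    have "e a \<ominus>\<^bsub>B\<^esub> b r \<in> V_fil p B r" for r
    proof -
      obtain y z where yz: "y \<in> T n" "z \<in> T (n - 1)" "a \<ominus> c r = (V ^^ r) y \<oplus> d ((V ^^ r) z)"
        using a(2) by blast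
      have "e a \<ominus>\<^bsub>B\<^esub> b r = (verschiebung p B ^^ r) (e y) \<oplus>\<^bsub>B\<^esub> diff B ((verschiebung p B ^^ r) (e z))"
        using B_Vk[OF T_H[OF yz(1)]] B_Vk[OF T_H[OF yz(2)]] yz(3)
        by (simp add: c(1) B_minus T_H[OF c(2)] T_H[OF a(1)])
      then show ?thesis unfolding B.N_iff using T_H yz by (intro bexI[of _ "e y"] bexI[of _ "e z"]) auto
    qed
    then show "\<exists>a\<in>grade B n. \<forall>r. a \<ominus>\<^bsub>B\<^esub> b r \<in> V_fil p B r" using a(1) by auto
  qed
qed

lemma B_strict_algebra: "strict_algebra p B"
proof -
  have "cdga B"
    unfolding cdga_def
  proof (intro conjI allI ballI impI)
    show "graded_map B 1 (diff B)" using B_complex by (simp add: dieudonne_complex_def)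
    fix m n u v assume "u \<in> grade B m" "v \<in> grade B n"
    then obtain x y where xy: "u = e x" "v = e y" "x \<in> T m" "y \<in> T n" by auto
    then show "u \<otimes>\<^bsub>B\<^esub> v \<in> grade B (m + n)" using T_mult by auto
    show "v \<otimes>\<^bsub>B\<^esub> u = (if even (m * n) then u \<otimes>\<^bsub>B\<^esub> v else \<ominus>\<^bsub>B\<^esub> (u \<otimes>\<^bsub>B\<^esub> v))"
      using graded_comm[OF T_gr[OF xy(3)] T_gr[OF xy(4)]] T_H[OF T_mult[OF xy(3,4)]] xy
      by (simp add: B_neg)
  next
    fix m u assume "odd m" "u \<in> grade B m"
    then show "u \<otimes>\<^bsub>B\<^esub> u = \<zero>\<^bsub>B\<^esub>" using odd_square T_gr by auto
  next
    fix m u v assume "u \<in> grade B m" "v \<in> carrier B"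
    then obtain x y where xy: "u = e x" "v = e y" "x \<in> T m" "y \<in> H" by auto
    have "x \<otimes> d y \<in> H" using xy H_mult H_d T_H by blast
    then show "diff B (u \<otimes>\<^bsub>B\<^esub> v) = (diff B u \<otimes>\<^bsub>B\<^esub> v) \<oplus>\<^bsub>B\<^esub>
        (if even m then u \<otimes>\<^bsub>B\<^esub> diff B v else \<ominus>\<^bsub>B\<^esub> (u \<otimes>\<^bsub>B\<^esub> diff B v))"
      using leibniz[OF T_gr[OF xy(3)] H_car[OF xy(4)]] xy by (simp add: B_neg)
  qed (use B_ring B_graded T_one H_car d_d in auto)
  moreover have "frob B \<in> ring_hom B B"
    by (rule ring_hom_memI) (use H_F H_car in \<open>auto simp: F_mult F_add F_one\<close>)
  moreover have "\<exists>v\<in>grade B 0. frob B u = (u [^]\<^bsub>B\<^esub> p) \<oplus>\<^bsub>B\<^esub> ([p] \<cdot>\<^bsub>B\<^esub> v)" if u: "u \<in> grade B 0" for u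
  proof -
    obtain x where x: "u = e x" "x \<in> T 0" using u by auto
    obtain y where y: "y \<in> gr 0" "F x = x [^] p \<oplus> [p] \<cdot> y" using F_lift[OF T_gr[OF x(2)]] by blast
    note c = T_car[OF x(2)] gr_carrier[OF y(1)]
    have pw: "x [^] k \<in> T 0" for k :: nat
      by (induction k) (use T_one T_mult[OF _ x(2), of _ 0] in auto)
    have "[p] \<cdot> y = F x \<oplus> \<ominus> (x [^] p)"
      using y(2) c a_comm[of "x [^] p" "[p] \<cdot> y"] by (simp add: a_assoc r_neg)
    then have "[p] \<cdot> y \<in> T 0" using T_add[OF T_F[OF x(2)] T_neg[OF pw]] by simp
    then have "y \<in> T 0" using T_p_div y by blast
    then show ?thesis using x y by (intro bexI[of _ "e y"]) (auto simp: B_pow B_smult)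
  qed
  moreover have "grade B n = {\<zero>\<^bsub>B\<^esub>}" if "n < 0" for n
  proof -
    have "T n = {\<zero>}" using gr_negative[OF that] T_gr[of _ n] T_zero[of n] by blast
    then show ?thesis by simp
  qed
  ultimately have "strict_dieudonne_algebra p B"
    using B_complex B_strict by (simp add: strict_dieudonne_algebra_def dieudonne_algebra_def del: embedded_copy_simps)
  then show ?thesis using B_saturated_complex by (simp add: strict_algebra_def strict_algebra_axioms_def)
qed

end

section \<open>Generation by the universal property\<close>

context strict_algebra
begin

lemma V_gr0_ideal: "ideal (V ` gr 0) A0"
proof -
  interpret Z: cring A0 by (rule A0_cring)
  show ?thesis
  proof (rule idealI)
    show "ring A0" by (rule Z.ring_axioms)
    have *: "V x \<oplus> V y = V (x \<oplus> y)" if "x \<in> gr 0" "y \<in> gr 0" for x y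
      using that gr_carrier by (simp add: V_add)
    show "subgroup (V ` gr 0) (add_monoid A0)"
    proof (rule Z.add.subgroupI)
      show "V ` gr 0 \<subseteq> carrier A0" using V_gr by auto
      show "V ` gr 0 \<noteq> {}" using gr_zero[of 0] by blast
      fix u assume "u \<in> V ` gr 0"
      then obtain x where x: "x \<in> gr 0" "u = V x" by blast
      have "\<ominus>\<^bsub>A0\<^esub> u = V (\<ominus> x)"
        using x gr_carrier[OF x(1)] V_gr gr_neg
        by (intro Z.minus_equality) (auto simp: V_add[symmetric] l_neg additive_zero[OF V_additive])
      then show "\<ominus>\<^bsub>A0\<^esub> u \<in> V ` gr 0" using x gr_neg by simp
      fix v assume "v \<in> V ` gr 0"
      then obtain y where "y \<in> gr 0" "v = V y" by blast
      then show "u \<oplus>\<^bsub>A0\<^esub> v \<in> V ` gr 0" using x * gr_add by auto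
    qed
    fix a x assume "a \<in> V ` gr 0" "x \<in> carrier A0"
    then obtain y where y: "y \<in> gr 0" "a = V y" and x: "x \<in> gr 0" by auto
    note c = gr_carrier[OF y(1)] gr_carrier[OF x]
    show "a \<otimes>\<^bsub>A0\<^esub> x \<in> V ` gr 0"
      using Vk_projection[OF c, of 1] y mult_gr0[OF y(1) F_gr[OF x]] by simp
    show "x \<otimes>\<^bsub>A0\<^esub> a \<in> V ` gr 0"
      using Vk_projection_left[OF c, of 1] y mult_gr0[OF F_gr[OF x] y(1)] by simp
  qed
qed

definition vcoset :: "'a \<Rightarrow> 'a set" where "vcoset x = V ` gr 0 +> x"

lemma vcoset_A0: "V ` gr 0 +>\<^bsub>A0\<^esub> x = vcoset x"
  by (simp add: a_r_coset_def' vcoset_def)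

lemma vcoset_ring_hom: "vcoset \<in> ring_hom A0 (V_quot p A)"
proof -
  interpret I: ideal "V ` gr 0" A0 by (rule V_gr0_ideal)
  show ?thesis using I.rcos_ring_hom by (simp add: V_quot_def vcoset_A0 [abs_def])
qed

lemma V_quot_cring: "cring (V_quot p A)"
  unfolding V_quot_def by (rule ideal.quotient_is_cring[OF V_gr0_ideal A0_cring])

lemma V_quot_carrier: "carrier (V_quot p A) = vcoset ` gr 0"
  by (auto simp: V_quot_def FactRing_def A_RCOSETS_def' vcoset_A0[unfolded a_r_coset_def'] vcoset_def a_r_coset_def')

lemma vcoset_mem: "x \<in> carrier A \<Longrightarrow> x \<in> vcoset x"
  using additive_zero[OF V_additive] gr_zero[of 0]
  by (force simp: vcoset_def a_r_coset_def')

lemma vcoset_eq_iff: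
  assumes "x \<in> gr 0" "y \<in> gr 0" shows "vcoset x = vcoset y \<longleftrightarrow> x \<ominus> y \<in> V ` gr 0"
proof -
  interpret I: ideal "V ` gr 0" A0 by (rule V_gr0_ideal)
  interpret Z: cring A0 by (rule A0_cring)
  note c = gr_carrier[OF assms(1)] gr_carrier[OF assms(2)]
  have "vcoset x = vcoset y \<longleftrightarrow> x \<in> vcoset y"
    using I.a_repr_independence'[of x y] I.a_rcos_self[of x] assms by (auto simp: vcoset_A0)
  also have "\<dots> \<longleftrightarrow> x \<ominus> y \<in> V ` gr 0"
  proof
    assume "x \<in> vcoset y"
    then obtain z where z: "z \<in> gr 0" "x = V z \<oplus> y" by (auto simp: vcoset_def a_r_coset_def')
    then have "x \<ominus> y = V z" using c gr_carrier[OF z(1)] by (simp add: a_minus_def a_assoc r_neg V_closed)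
    then show "x \<ominus> y \<in> V ` gr 0" using z by blast
  next
    assume "x \<ominus> y \<in> V ` gr 0"
    moreover have "x = (x \<ominus> y) \<oplus> y" using c by (simp add: a_minus_def a_assoc l_neg)
    ultimately show "x \<in> vcoset y" unfolding vcoset_def a_r_coset_def' by blast
  qed
  finally show ?thesis .
qed

lemma vcoset_zero: "x \<in> gr 0 \<Longrightarrow> vcoset x = \<zero>\<^bsub>V_quot p A\<^esub> \<longleftrightarrow> x \<in> V ` gr 0"
  using vcoset_eq_iff[of x \<zero>] ring_hom_zero[OF vcoset_ring_hom] A0_cring V_quot_cring
  by (simp add: cring.axioms(1) minus_zero_right gr_carrier)

end

lemma dieudonne_hom_V:
  assumes A: "strict_algebra p A" and B: "strict_algebra p B" and f: "f \<in> dieudonne_hom A B"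
    and z: "z \<in> carrier A"
  shows "f (verschiebung p A z) = verschiebung p B (f z)"
proof -
  interpret A: strict_algebra p A by (rule A)
  interpret B: strict_algebra p B by (rule B)
  have h: "f \<in> ring_hom A B" and F: "\<And>x. x \<in> carrier A \<Longrightarrow> f (frob A x) = frob B (f x)"
    using f by (auto simp: dieudonne_hom_def)
  have s: "f ([(k::nat)] \<cdot>\<^bsub>A\<^esub> z) = [k] \<cdot>\<^bsub>B\<^esub> f z" for k
    by (induction k)
      (simp_all add: ring_hom_zero[OF h A.ring_axioms B.ring_axioms] ring_hom_add[OF h] z)
  show ?thesis
    using B.V_eqI[of "f z" "f (verschiebung p A z)"] z ring_hom_closed[OF h] A.V_closed[OF z] A.F_V[OF z] F[OF A.V_closed[OF z]] s[of p]
    by simp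
qed

lemma V_quot_map_vcoset:
  assumes A: "strict_algebra p A" and B: "strict_algebra p B" and f: "f \<in> dieudonne_hom A B"
    and c: "c \<in> grade A 0"
  shows "V_quot_map p B f (strict_algebra.vcoset p A c) = strict_algebra.vcoset p B (f c)"
proof -
  interpret A: strict_algebra p A by (rule A)
  interpret B: strict_algebra p B by (rule B)
  have h: "f \<in> ring_hom A B" and g: "\<And>n x. x \<in> grade A n \<Longrightarrow> f x \<in> grade B n"
    using f by (auto simp: dieudonne_hom_def)
  note fV = dieudonne_hom_V[OF A B f A.gr_carrier]
  show ?thesis
  proof (intro equalityI subsetI)
    fix u assume "u \<in> V_quot_map p B f (A.vcoset c)"
    then obtain w z where wz: "w \<in> grade B 0" "z \<in> grade A 0"
      "u = verschiebung p B w \<oplus>\<^bsub>B\<^esub> f (verschiebung p A z \<oplus>\<^bsub>A\<^esub> c)"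
      by (auto simp: V_quot_map_def set_add_def' A.vcoset_def a_r_coset_def')
    moreover have "w \<in> carrier B" "f z \<in> carrier B" "f c \<in> carrier B"
      using B.gr_carrier[OF wz(1)] B.gr_carrier[OF g[OF wz(2)]] B.gr_carrier[OF g[OF c]] by auto
    ultimately have "u = verschiebung p B (w \<oplus>\<^bsub>B\<^esub> f z) \<oplus>\<^bsub>B\<^esub> f c"
      using A.gr_carrier[OF c] A.gr_carrier[OF wz(2)] A.V_closed B.V_closed
      by (simp add: ring_hom_add[OF h] fV B.V_add B.a_assoc)
    then show "u \<in> B.vcoset (f c)"
      using B.gr_add[OF wz(1) g[OF wz(2)]] by (auto simp: B.vcoset_def a_r_coset_def')
  next
    fix u assume "u \<in> B.vcoset (f c)"
    then obtain w where w: "w \<in> grade B 0" "u = verschiebung p B w \<oplus>\<^bsub>B\<^esub> f c"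
      by (auto simp: B.vcoset_def a_r_coset_def')
    then show "u \<in> V_quot_map p B f (A.vcoset c)"
      using A.vcoset_mem[OF A.gr_carrier[OF c]] by (auto simp: V_quot_map_def set_add_def')
  qed
qed

context closed_subalgebra
begin

text \<open>
  Let \<open>B\<close> be a copy of the subalgebra and \<open>B'\<close> a copy of the whole of \<open>A\<close>.  The hypothesis on \<open>\<tau>\<close> says that \<open>\<rho>\<close> lifts to
  \<open>B\<close>, so universality gives a morphism \<open>A \<rightarrow> B \<subseteq> B'\<close>.  It induces the same map from \<open>R\<close> as
  the isomorphism \<open>A \<rightarrow> B'\<close>, hence coincides with it, and \<open>B = B'\<close>.
\<close>

theorem universal_generation:
  fixes R :: "('r, 'm) ring_scheme" and \<rho> :: "'r \<Rightarrow> 'a set"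
  assumes dRW: "saturated_dRW p R A \<rho>" and R: "ring R"
    and \<tau>: "\<And>r. r \<in> carrier R \<Longrightarrow> \<tau> r \<in> T 0 \<and> \<rho> r = vcoset (\<tau> r)"
  shows "T n = gr n"
proof -
  (* the test objects have elements of this type; constant functions are enough to hold a copy of A *)
  define e :: "'a \<Rightarrow> nat \<Rightarrow> 'a + 'r + nat" where "e a = (\<lambda>_. Inl a)" for a
  have e: "inj e" by (rule injI) (auto simp: e_def dest: fun_cong)
  interpret E: embedded_subalgebra p A T e
    using e by unfold_locales
  have full: "closed_subalgebra p A gr"
    by unfold_locales (auto intro: mult_gr d_gr F_gr one_gr)
  interpret E': embedded_subalgebra p A gr e
    using full e by (simp add: embedded_subalgebra_def embedded_subalgebra_axioms_def)
  interpret B: strict_algebra p "embedded_copy A T e" by (rule E.B_strict_algebra)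
  interpret B': strict_algebra p "embedded_copy A gr e" by (rule E'.B_strict_algebra)
  have A: "strict_algebra p A" by unfold_locales
  have \<rho>: "\<rho> \<in> ring_hom R (V_quot p A)" using dRW by (simp add: saturated_dRW_def)
  interpret R: ring R by (rule R)
  let ?B = "embedded_copy A T e" and ?B' = "embedded_copy A gr e"
  have VT: "e x \<in> verschiebung p ?B ` grade ?B 0" if x: "x \<in> V ` gr 0" "x \<in> T 0" for x
  proof -
    obtain z where z: "z \<in> gr 0" "x = V z" using x(1) by blast
    then have zT: "z \<in> T 0" using T_V_inv[of z 0] x(2) by simp
    have "e x = verschiebung p ?B (e z)" using z(2) E.B_V[OF T_H[OF zT]] by simp
    moreover have "e z \<in> grade ?B 0" using zT by simp
    ultimately show ?thesis by blast
  qed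
  have key: "B.vcoset (e x) = B.vcoset (e y)"
    if xy: "x \<in> T 0" "y \<in> T 0" "vcoset x = vcoset y" for x y
  proof -
    have "x \<ominus> y \<in> T 0" using xy by (simp add: a_minus_def T_add T_neg)
    moreover have "x \<ominus> y \<in> V ` gr 0" using xy vcoset_eq_iff[OF T_gr T_gr] by simp
    ultimately have "e (x \<ominus> y) \<in> verschiebung p ?B ` grade ?B 0" by (intro VT)
    moreover have "e x \<in> grade ?B 0" "e y \<in> grade ?B 0" using xy by simp_all
    ultimately show ?thesis
      using B.vcoset_eq_iff[of "e x" "e y"] E.B_minus[OF T_H[OF xy(1)] T_H[OF xy(2)]] by metis
  qed
  define \<sigma> where "\<sigma> = (\<lambda>r\<in>carrier R. B.vcoset (e (\<tau> r)))"
  have hom: "vcoset (x \<otimes> y) = vcoset x \<otimes>\<^bsub>V_quot p A\<^esub> vcoset y"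
    "vcoset (x \<oplus> y) = vcoset x \<oplus>\<^bsub>V_quot p A\<^esub> vcoset y" if "x \<in> gr 0" "y \<in> gr 0" for x y
    using ring_hom_mult[OF vcoset_ring_hom, of x y] ring_hom_add[OF vcoset_ring_hom, of x y] that by auto
  have homB: "B.vcoset (e (x \<otimes> y)) = B.vcoset (e x) \<otimes>\<^bsub>V_quot p ?B\<^esub> B.vcoset (e y)"
    "B.vcoset (e (x \<oplus> y)) = B.vcoset (e x) \<oplus>\<^bsub>V_quot p ?B\<^esub> B.vcoset (e y)" if "x \<in> T 0" "y \<in> T 0" for x y
    using ring_hom_mult[OF B.vcoset_ring_hom, of "e x" "e y"]
      ring_hom_add[OF B.vcoset_ring_hom, of "e x" "e y"] that by auto
  have "\<sigma> \<in> ring_hom R (V_quot p ?B)"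
  proof (rule ring_hom_memI)
    fix r assume r: "r \<in> carrier R"
    then have "e (\<tau> r) \<in> grade ?B 0" using \<tau> by simp
    then show "\<sigma> r \<in> carrier (V_quot p ?B)" using r by (simp add: \<sigma>_def B.V_quot_carrier del: E.embedded_copy_simps)
    fix s assume s: "s \<in> carrier R"
    have Ts: "\<tau> r \<in> T 0" "\<tau> s \<in> T 0" "\<tau> (r \<otimes>\<^bsub>R\<^esub> s) \<in> T 0" "\<tau> (r \<oplus>\<^bsub>R\<^esub> s) \<in> T 0"
      using \<tau> r s by auto
    have m: "\<tau> r \<otimes> \<tau> s \<in> T 0" using T_mult[OF Ts(1,2)] by simp
    have q: "vcoset (\<tau> (r \<otimes>\<^bsub>R\<^esub> s)) = vcoset (\<tau> r \<otimes> \<tau> s)" "vcoset (\<tau> (r \<oplus>\<^bsub>R\<^esub> s)) = vcoset (\<tau> r \<oplus> \<tau> s)"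
      using ring_hom_mult[OF \<rho> r s] ring_hom_add[OF \<rho> r s] \<tau> r s hom T_gr by auto
    note key[OF Ts(3) m q(1)] key[OF Ts(4) T_add[OF Ts(1,2)] q(2)]
    then show "\<sigma> (r \<otimes>\<^bsub>R\<^esub> s) = \<sigma> r \<otimes>\<^bsub>V_quot p ?B\<^esub> \<sigma> s" "\<sigma> (r \<oplus>\<^bsub>R\<^esub> s) = \<sigma> r \<oplus>\<^bsub>V_quot p ?B\<^esub> \<sigma> s"
      using r s homB[OF Ts(1,2)] by (simp_all add: \<sigma>_def)
  next
    have "vcoset (\<tau> \<one>\<^bsub>R\<^esub>) = vcoset \<one>"
      using ring_hom_one[OF \<rho>] ring_hom_one[OF vcoset_ring_hom] \<tau> by simp
    then have "B.vcoset (e (\<tau> \<one>\<^bsub>R\<^esub>)) = B.vcoset (e \<one>)" using \<tau> T_one by (intro key) auto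
    then show "\<sigma> \<one>\<^bsub>R\<^esub> = \<one>\<^bsub>V_quot p ?B\<^esub>"
      using ring_hom_one[OF B.vcoset_ring_hom] by (simp add: \<sigma>_def)
  qed
  moreover have "\<sigma> \<in> extensional (carrier R)" by (simp add: \<sigma>_def)
  moreover have "bij_betw (\<lambda>f. \<lambda>r\<in>carrier R. V_quot_map p ?B f (\<rho> r)) (dieudonne_hom A ?B)
      (extensional (carrier R) \<inter> ring_hom R (V_quot p ?B))"
    using dRW B.strict_alg unfolding saturated_dRW_def by blast
  ultimately have "\<sigma> \<in> (\<lambda>f. \<lambda>r\<in>carrier R. V_quot_map p ?B f (\<rho> r)) ` dieudonne_hom A ?B"
    unfolding bij_betw_def by blast
  then obtain f where f: "f \<in> dieudonne_hom A ?B"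
    "(\<lambda>r\<in>carrier R. V_quot_map p ?B f (\<rho> r)) = \<sigma>"
    by blast
  have sub: "H \<subseteq> E'.H" using H_car hspan_gr by auto
  have f': "f \<in> dieudonne_hom A ?B'"
  proof -
    have ops: "monoid.mult ?B' = monoid.mult ?B" "monoid.one ?B' = monoid.one ?B" "ring.add ?B' = ring.add ?B"
      "diff ?B' = diff ?B" "frob ?B' = frob ?B"
      by (simp_all add: embedded_copy_def)
    have "f x \<in> e ` H" if "x \<in> carrier A" for x
      using f(1) that by (auto simp: dieudonne_hom_def ring_hom_def)
    then have fc: "f x \<in> carrier ?B'" if "x \<in> carrier A" for x
      using that sub by fastforce
    have h: "f \<in> ring_hom A ?B" using f(1) by (simp add: dieudonne_hom_def)
    have "f \<in> ring_hom A ?B'"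
    proof (rule ring_hom_memI)
      show "f \<one> = \<one>\<^bsub>?B'\<^esub>" unfolding ops by (rule ring_hom_one[OF h])
      fix x assume x: "x \<in> carrier A"
      show "f x \<in> carrier ?B'" by (rule fc[OF x])
      fix y assume "y \<in> carrier A"
      note xy = x this
      show "f (x \<otimes> y) = f x \<otimes>\<^bsub>?B'\<^esub> f y" unfolding ops by (rule ring_hom_mult[OF h xy])
      show "f (x \<oplus> y) = f x \<oplus>\<^bsub>?B'\<^esub> f y" unfolding ops by (rule ring_hom_add[OF h xy])
    qed
    moreover have "f ` gr n \<subseteq> grade ?B' n" for n
    proof -
      have "f ` gr n \<subseteq> e ` T n" using f(1) by (simp add: dieudonne_hom_def)
      moreover have "e ` T n \<subseteq> e ` gr n" using T_gr by blast
      ultimately show ?thesis unfolding E'.embedded_copy_simps by (rule subset_trans)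
    qed
    ultimately show ?thesis using f(1) unfolding dieudonne_hom_def ops by blast
  qed
  define g where "g = restrict e (carrier A)"
  have g: "g \<in> dieudonne_hom A ?B'"
    unfolding dieudonne_hom_def
  proof (intro CollectI conjI IntI ballI allI)
    show "g \<in> ring_hom A ?B'"
      by (rule ring_hom_memI) (auto simp: g_def hspan_gr)
    show "g ` gr n \<subseteq> grade ?B' n" for n using gr_carrier by (auto simp: g_def)
  qed (auto simp: g_def d_closed F_closed)
  have "V_quot_map p ?B' f (\<rho> r) = V_quot_map p ?B' g (\<rho> r)" if r: "r \<in> carrier R" for r
  proof -
    have t: "\<tau> r \<in> T 0" "\<rho> r = vcoset (\<tau> r)" using \<tau> r by auto
    have ft: "f (\<tau> r) \<in> grade ?B 0" using f(1) T_gr t(1) unfolding dieudonne_hom_def by blast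
    then obtain y where y: "f (\<tau> r) = e y" "y \<in> T 0" by auto
    have "B.vcoset (e y) = B.vcoset (e (\<tau> r))"
      using fun_cong[OF f(2), of r] r t V_quot_map_vcoset[OF A B.strict_algebra_axioms f(1) T_gr[OF t(1)]] y(1)
      by (simp add: \<sigma>_def)
    then have "e (y \<ominus> \<tau> r) \<in> verschiebung p ?B ` grade ?B 0"
      using B.vcoset_eq_iff[of "e y" "e (\<tau> r)"] y(2) t(1) E.B_minus T_H by simp
    then obtain z where "z \<in> T 0" "e (y \<ominus> \<tau> r) = verschiebung p ?B (e z)" by auto
    then have z: "z \<in> gr 0" "y \<ominus> \<tau> r = V z" using E.B_V T_H T_gr by auto
    have "e (y \<ominus> \<tau> r) = verschiebung p ?B' (e z)" using z E'.B_V[OF E'.T_H[OF z(1)]] by simp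
    moreover have "e z \<in> grade ?B' 0" using z(1) by simp
    ultimately have "e (y \<ominus> \<tau> r) \<in> verschiebung p ?B' ` grade ?B' 0" by blast
    moreover have "e y \<in> grade ?B' 0" "e (\<tau> r) \<in> grade ?B' 0" using T_gr y(2) t(1) by simp_all
    ultimately have "B'.vcoset (e y) = B'.vcoset (e (\<tau> r))"
      using B'.vcoset_eq_iff[of "e y" "e (\<tau> r)"]
        E'.B_minus[OF E'.T_H[OF T_gr[OF y(2)]] E'.T_H[OF T_gr[OF t(1)]]] by metis
    then show ?thesis
      using V_quot_map_vcoset[OF A B'.strict_algebra_axioms f' T_gr[OF t(1)]]
        V_quot_map_vcoset[OF A B'.strict_algebra_axioms g T_gr[OF t(1)]] t y(1) T_car
      by (simp add: g_def)
  qed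
  moreover have "inj_on (\<lambda>f. \<lambda>r\<in>carrier R. V_quot_map p ?B' f (\<rho> r)) (dieudonne_hom A ?B')"
    using dRW B'.strict_alg unfolding saturated_dRW_def bij_betw_def by blast
  ultimately have "f = g"
    using f' g by (auto elim!: inj_onD intro!: restrict_ext)
  have "x \<in> H" if "x \<in> carrier A" for x
  proof -
    have "f x \<in> carrier ?B" using f(1) that by (auto simp: dieudonne_hom_def ring_hom_def)
    then show ?thesis using \<open>f = g\<close> that by (auto simp: g_def)
  qed
  then show ?thesis using H_gr T_gr gr_carrier by blast
qed

end

section \<open>Vanishing from dominated relations\<close>

context strict_algebra
begin

lemma Fk_d_teichmueller:
  assumes "x \<in> gr 0" "F x = x [^] p"
  shows "(F ^^ k) (d x) = x [^] (p ^ k - 1) \<otimes> d x"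
proof (induction k)
  case 0 then show ?case using gr_carrier[OF assms(1)] by (simp add: d_closed)
next
  case (Suc k)
  then show ?case using F_eta[OF assms, of "p ^ k"] p_pos by simp
qed

lemma form_eq_zero_mono:
  assumes "\<And>j. x j \<in> gr 0" "form x v m = \<zero>" "m \<le> n" shows "form x v n = \<zero>"
  using assms(3)
proof (induction n rule: dec_induct)
  case (step n)
  have "x n [^] (v n - 1) \<otimes> d (x n) \<in> carrier A" by (rule gr_carrier[OF eta_gr[OF assms(1)]])
  then show ?case using step by simp
qed (rule assms(2))

end

locale teichmueller_section = strict_algebra p A for p and A :: "'a dieudonne" (structure) +
  fixes R :: "('r, 'm) ring_scheme" and \<rho> :: "'r \<Rightarrow> 'a set" and \<tau> :: "'r \<Rightarrow> 'a"
  assumes R: "cring R" and \<rho>: "\<rho> \<in> ring_hom R (V_quot p A)"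
    and \<tau>_gr: "r \<in> carrier R \<Longrightarrow> \<tau> r \<in> gr 0"
    and F_\<tau>: "r \<in> carrier R \<Longrightarrow> F (\<tau> r) = \<tau> r [^] p"
    and \<rho>_\<tau>: "r \<in> carrier R \<Longrightarrow> \<rho> r = vcoset (\<tau> r)"
begin

interpretation R: cring R by (rule R)

lemma \<tau>_car: "r \<in> carrier R \<Longrightarrow> \<tau> r \<in> carrier A" using \<tau>_gr gr_carrier by blast

lemma \<tau>_eqI:
  assumes "r \<in> carrier R" "a \<in> gr 0" "F a = a [^] p" "vcoset a = \<rho> r" shows "\<tau> r = a"
proof (rule teichmueller_unique)
  show "\<tau> r \<ominus> a \<in> V ` gr 0"
    using vcoset_eq_iff[OF \<tau>_gr[OF assms(1)] assms(2)] \<rho>_\<tau>[OF assms(1)] assms(4) by simp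
qed (use assms \<tau>_gr F_\<tau> in auto)

lemma \<tau>_mult:
  assumes rs: "r \<in> carrier R" "s \<in> carrier R" shows "\<tau> (r \<otimes>\<^bsub>R\<^esub> s) = \<tau> r \<otimes> \<tau> s"
proof (rule \<tau>_eqI)
  interpret Z: cring A0 by (rule A0_cring)
  note g = \<tau>_gr[OF rs(1)] \<tau>_gr[OF rs(2)]
  show "\<tau> r \<otimes> \<tau> s \<in> gr 0" by (rule mult_gr0[OF g])
  have "(\<tau> r \<otimes> \<tau> s) [^] p = \<tau> r [^] p \<otimes> \<tau> s [^] p"
    using Z.nat_pow_distrib[of "\<tau> r" "\<tau> s" p] g by (simp add: A0_pow)
  then show "F (\<tau> r \<otimes> \<tau> s) = (\<tau> r \<otimes> \<tau> s) [^] p"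
    using rs by (simp add: F_mult \<tau>_car F_\<tau>)
  show "vcoset (\<tau> r \<otimes> \<tau> s) = \<rho> (r \<otimes>\<^bsub>R\<^esub> s)"
    using ring_hom_mult[OF vcoset_ring_hom, of "\<tau> r" "\<tau> s"] g ring_hom_mult[OF \<rho> rs] \<rho>_\<tau> rs by simp
qed (use rs in simp)

lemma \<tau>_one: "\<tau> \<one>\<^bsub>R\<^esub> = \<one>"
  using ring_hom_one[OF vcoset_ring_hom] ring_hom_one[OF \<rho>]
  by (intro \<tau>_eqI) (auto simp: one_gr F_one)

lemma \<tau>_pow: "r \<in> carrier R \<Longrightarrow> \<tau> (r [^]\<^bsub>R\<^esub> (k::nat)) = \<tau> r [^] k"
  by (induction k) (simp_all add: \<tau>_one \<tau>_mult)

lemma \<tau>_monomial: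
  assumes y: "\<And>j. y j \<in> carrier R"
  shows "monomial A0 (\<lambda>j. \<tau> (y j)) m n = \<tau> (monomial R y m n)" "monomial R y m n \<in> carrier R"
proof -
  show c: "monomial R y m n \<in> carrier R" for n by (induction n) (simp_all add: y)
  show "monomial A0 (\<lambda>j. \<tau> (y j)) m n = \<tau> (monomial R y m n)"
    by (induction n) (simp_all add: \<tau>_one \<tau>_mult \<tau>_pow y c A0_pow)
qed

lemma vcoset_add:
  "a \<in> gr 0 \<Longrightarrow> b \<in> gr 0 \<Longrightarrow> vcoset (a \<oplus> b) = vcoset a \<oplus>\<^bsub>V_quot p A\<^esub> vcoset b"
  using ring_hom_add[OF vcoset_ring_hom, of a b] by simp

text \<open>
  Termwise lifting of a sum: \<open>\<tau>\<close> is multiplicative, so it takes terms to terms, and \<open>vcoset\<close> is additive.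
\<close>

lemma lift_lower_terms:
  assumes y: "\<And>j. y j \<in> carrier R" and C: "C \<subseteq> carrier R" and r: "r \<in> lower_terms R C y n m0"
  shows "r \<in> carrier R \<and> (\<exists>a\<in>lower_terms A0 (\<tau> ` C) (\<lambda>j. \<tau> (y j)) n m0. a \<in> gr 0 \<and> vcoset a = \<rho> r)"
  using r
proof (induction rule: lower_terms.induct)
  case zero
  have "vcoset \<zero> = \<rho> \<zero>\<^bsub>R\<^esub>"
    using ring_hom_zero[OF \<rho> R.ring_axioms cring.axioms(1)[OF V_quot_cring]] vcoset_zero[OF gr_zero]
      additive_zero[OF V_additive] gr_zero[of 0] by (metis image_eqI)
  moreover have "\<zero> \<in> lower_terms A0 (\<tau> ` C) (\<lambda>j. \<tau> (y j)) n m0"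
    using lower_terms.zero[of A0] by simp
  ultimately show ?case by auto
next
  case (add c m r)
  then obtain a where a: "a \<in> lower_terms A0 (\<tau> ` C) (\<lambda>j. \<tau> (y j)) n m0" "a \<in> gr 0" "vcoset a = \<rho> r"
    and r: "r \<in> carrier R" by blast
  let ?s = "c \<otimes>\<^bsub>R\<^esub> monomial R y m n"
  have s: "c \<in> carrier R" "monomial R y m n \<in> carrier R" "?s \<in> carrier R"
    using add(1) C \<tau>_monomial(2)[OF y] by auto
  have eq: "\<tau> c \<otimes> monomial A0 (\<lambda>j. \<tau> (y j)) m n = \<tau> ?s"
    using s by (simp add: \<tau>_monomial(1)[OF y] \<tau>_mult)
  have "\<tau> ?s \<oplus> a \<in> lower_terms A0 (\<tau> ` C) (\<lambda>j. \<tau> (y j)) n m0"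
    using lower_terms.add[of "\<tau> c" "\<tau> ` C" n m m0 a A0, OF _ add(2,3) a(1)] add(1) eq by simp
  moreover have "vcoset (\<tau> ?s \<oplus> a) = \<rho> (?s \<oplus>\<^bsub>R\<^esub> r)"
    using vcoset_add[OF \<tau>_gr[OF s(3)] a(2)] a(3) \<rho>_\<tau>[OF s(3)] ring_hom_add[OF \<rho> s(3) r] by simp
  ultimately show ?case using s r gr_add[OF \<tau>_gr[OF s(3)] a(2)] by auto
qed

lemma lift_dominated:
  assumes y: "\<And>j. y j \<in> carrier R" and C: "C \<subseteq> carrier R" and r: "r \<in> dominated R C y n"
  obtains a where "a \<in> dominated A0 (\<tau> ` C) (\<lambda>j. \<tau> (y j)) n" "a \<in> gr 0" "vcoset a = \<rho> r"
proof -
  obtain c m0 b where b: "r = (c \<otimes>\<^bsub>R\<^esub> monomial R y m0 n) \<oplus>\<^bsub>R\<^esub> b" "c \<in> C" "\<forall>j\<ge>n. m0 j = 0"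
    "b \<in> lower_terms R C y n m0"
    using r unfolding dominated_def by blast
  obtain a where a: "a \<in> lower_terms A0 (\<tau> ` C) (\<lambda>j. \<tau> (y j)) n m0" "a \<in> gr 0" "vcoset a = \<rho> b"
    and bc: "b \<in> carrier R"
    using lift_lower_terms[OF y C b(4)] by blast
  let ?s = "c \<otimes>\<^bsub>R\<^esub> monomial R y m0 n"
  have s: "c \<in> carrier R" "monomial R y m0 n \<in> carrier R" "?s \<in> carrier R"
    using b(2) C \<tau>_monomial(2)[OF y] by auto
  have eq: "\<tau> ?s = \<tau> c \<otimes>\<^bsub>A0\<^esub> monomial A0 (\<lambda>j. \<tau> (y j)) m0 n"
    using s by (simp add: \<tau>_monomial(1)[OF y] \<tau>_mult)
  have "\<tau> ?s \<oplus>\<^bsub>A0\<^esub> a \<in> dominated A0 (\<tau> ` C) (\<lambda>j. \<tau> (y j)) n"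
    unfolding eq dominated_def using b(2,3) a(1) by blast
  moreover have "vcoset (\<tau> ?s \<oplus> a) = \<rho> r"
    using vcoset_add[OF \<tau>_gr[OF s(3)] a(2)] a(3) \<rho>_\<tau>[OF s(3)] ring_hom_add[OF \<rho> s(3) bc] b(1) by simp
  ultimately show ?thesis using that gr_add[OF \<tau>_gr[OF s(3)] a(2)] by simp
qed

definition generators :: "'a set" where
  "generators = {(V ^^ b) (\<tau> r) | b r. r \<in> carrier R}"

lemma generators_annihilating: "annihilating_generators p A generators"
proof
  fix g assume "g \<in> generators"
  then obtain b r where g: "g = (V ^^ b) (\<tau> r)" "r \<in> carrier R" by (auto simp: generators_def)
  show "g \<in> gr 0" using g Vk_gr \<tau>_gr by simp
  have "V g = (V ^^ Suc b) (\<tau> r)" using g by simp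
  then show "V g \<in> generators" unfolding generators_def using g(2) by blast
  show "\<exists>a\<in>gr 0. \<exists>g'\<in>generators. F (d g) = a \<otimes> d g'"
  proof (cases b)
    case 0
    have "F (d g) = \<tau> r [^] (p - 1) \<otimes> d g"
      using Fk_d_teichmueller[OF \<tau>_gr[OF g(2)] F_\<tau>[OF g(2)], of 1] g(1) 0 by simp
    then show ?thesis using pow_gr0[OF \<tau>_gr[OF g(2)]] \<open>g \<in> generators\<close> by blast
  next
    case (Suc c)
    let ?h = "(V ^^ c) (\<tau> r)"
    have h: "?h \<in> carrier A" "?h \<in> generators" using \<tau>_car g Vk_closed by (auto simp: generators_def)
    have "F (d g) = \<one> \<otimes> d ?h" using g(1) Suc h F_d_V by (simp add: d_closed)
    then show ?thesis using h(2) one_gr by blast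
  qed
qed

text \<open>
  A power of \<open>F\<close> removes all the \<open>V\<close>: \<open>F\<^sup>b (d V\<^sup>b [r]) = d [r]\<close>, and further applications of \<open>F\<close> only multiply
  \<open>d [r]\<close> by elements of degree \<open>0\<close>.
\<close>

lemma Theta_form:
  assumes "t \<in> annihilating_generators.Theta A generators m"
  shows "\<exists>k. \<exists>a\<in>gr 0. \<exists>y. (\<forall>j. y j \<in> carrier R) \<and>
    (F ^^ k) t = a \<otimes> form (\<lambda>j. \<tau> (y j)) (\<lambda>_. 1) m"
proof -
  interpret G: annihilating_generators p A generators 0 by (rule generators_annihilating)
  show ?thesis
    using assms
  proof (induction m arbitrary: t)
    case 0
    then show ?case using one_gr by (intro exI[of _ 0] bexI[of _ \<one>] exI[of _ "\<lambda>_. \<one>\<^bsub>R\<^esub>"]) auto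
  next
    case (Suc m)
    then obtain t' g where g: "t = t' \<otimes> d g" "t' \<in> G.Theta m" "g \<in> generators" by auto
    then obtain b r where t: "t = t' \<otimes> d ((V ^^ b) (\<tau> r))" "t' \<in> G.Theta m" "r \<in> carrier R"
      by (auto simp: generators_def)
    obtain k a y where IH: "a \<in> gr 0" "\<And>j. y j \<in> carrier R"
      "(F ^^ k) t' = a \<otimes> form (\<lambda>j. \<tau> (y j)) (\<lambda>_. 1) m"
      using Suc.IH[OF t(2)] by blast
    define x where "x = (\<lambda>j. \<tau> (y j))"
    have x: "\<And>j. x j \<in> gr 0" "\<And>j. F (x j) = x j [^] p" using IH(2) \<tau>_gr F_\<tau> by (auto simp: x_def)
    define f where "f = form x (\<lambda>_. 1) m"
    have f: "f \<in> gr (int m)" "f \<in> carrier A"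
      using form_gr[of x "\<lambda>_. 1" m, OF x(1)] gr_carrier by (auto simp: f_def)
    define c where "c = monomial A x (\<lambda>_. p ^ b - 1) m"
    have c: "c \<in> gr 0" using monomial_gr0[of x, OF x(1)] by (simp add: c_def)
    have "(F ^^ b) f = form x (\<lambda>_. p ^ b) m"
      using Fk_form[of x m "\<lambda>_. 1" b, OF x] by (simp add: f_def)
    also have "\<dots> = c \<otimes> f"
      using monomial_mult_form[of x m "\<lambda>_. 1" "\<lambda>_. p ^ b - 1", OF x(1)] p_pos by (simp add: c_def f_def)
    finally have Fb: "(F ^^ b) f = c \<otimes> f" .
    define q where "q = \<tau> r [^] (p ^ k - 1)"
    note \<tau>r = \<tau>_gr[OF t(3)] F_\<tau>[OF t(3)] \<tau>_car[OF t(3)]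
    have q: "q \<in> gr 0" using pow_gr0 \<tau>r by (simp add: q_def)
    have dr: "d (\<tau> r) \<in> carrier A" using \<tau>r d_closed by simp
    note cc = gr_carrier[OF IH(1)] gr_carrier[OF c] gr_carrier[OF q] f(2) dr G.Theta_car[OF t(2)]
    have "(F ^^ (b + k)) t' = (F ^^ b) a \<otimes> (c \<otimes> f)"
    proof -
      have "(F ^^ k) t' = a \<otimes> f" using IH(3) by (simp only: f_def x_def)
      then show ?thesis using cc by (simp add: funpow_add Fk_mult Fb)
    qed
    moreover have "(F ^^ (b + k)) (d ((V ^^ b) (\<tau> r))) = q \<otimes> d (\<tau> r)"
      using Fk_d_Vk[OF \<tau>r(3), of b] Fk_d_teichmueller[OF \<tau>r(1,2), of k]
      by (simp add: funpow_add[of k b] add.commute[of b] q_def)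
    ultimately have "(F ^^ (b + k)) t = ((F ^^ b) a \<otimes> (c \<otimes> f)) \<otimes> (q \<otimes> d (\<tau> r))"
      using t(1) cc \<tau>r by (simp add: Fk_mult d_closed Vk_closed)
    also have "\<dots> = ((F ^^ b) a \<otimes> c) \<otimes> ((f \<otimes> q) \<otimes> d (\<tau> r))"
      using cc by (simp add: m_assoc Fk_closed)
    also have "f \<otimes> q = q \<otimes> f" by (rule comm0[OF q f(1)])
    also have "((F ^^ b) a \<otimes> c) \<otimes> ((q \<otimes> f) \<otimes> d (\<tau> r)) = (((F ^^ b) a \<otimes> c) \<otimes> q) \<otimes> (f \<otimes> d (\<tau> r))"
      using cc by (simp add: m_assoc Fk_closed)
    also have "f \<otimes> d (\<tau> r) = form (\<lambda>j. \<tau> ((y(m := r)) j)) (\<lambda>_. 1) (Suc m)"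
      using form_cong[of m x "\<lambda>j. \<tau> ((y(m := r)) j)" "\<lambda>_. 1" "\<lambda>_. 1"] cc by (simp add: f_def x_def)
    finally have "(F ^^ (b + k)) t =
      (((F ^^ b) a \<otimes> c) \<otimes> q) \<otimes> form (\<lambda>j. \<tau> ((y(m := r)) j)) (\<lambda>_. 1) (Suc m)" .
    moreover have "((F ^^ b) a \<otimes> c) \<otimes> q \<in> gr 0" using IH(1) c q by (intro mult_gr0 Fk_gr)
    moreover have "\<forall>j. (y(m := r)) j \<in> carrier R" using IH(2) t(3) by simp
    ultimately show ?case by blast
  qed
qed

theorem vanishing_above:
  assumes dRW: "saturated_dRW p R A \<rho>"
    and van: "\<And>y. (\<And>j. y j \<in> carrier R) \<Longrightarrow> form (\<lambda>j. \<tau> (y j)) (\<lambda>_. 1) i = \<zero>"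
    and n: "n \<ge> int i"
  shows "gr n = {\<zero>}"
proof -
  interpret G: annihilating_generators p A generators "int i" by (rule generators_annihilating)
  have "t = \<zero>" if t: "t \<in> G.Theta m" and m: "int m \<ge> int i" for m t
  proof -
    obtain k a y where y: "a \<in> gr 0" "\<And>j. y j \<in> carrier R"
      "(F ^^ k) t = a \<otimes> form (\<lambda>j. \<tau> (y j)) (\<lambda>_. 1) m"
      using Theta_form[OF t] by blast
    have "form (\<lambda>j. \<tau> (y j)) (\<lambda>_. 1) m = \<zero>"
      using form_eq_zero_mono[of "\<lambda>j. \<tau> (y j)" "\<lambda>_. 1" i m] van[OF y(2)] \<tau>_gr[OF y(2)] m by simp
    then have "(F ^^ k) t = \<zero>" using y(3) gr_carrier[OF y(1)] by simp
    then show ?thesis using Fk_eq_zero G.Theta_car[OF t] by blast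
  qed
  then have "G.T n = {\<zero>}" using G.T_vanishes n by blast
  moreover have "G.T n = gr n"
  proof (rule G.T.universal_generation[OF dRW R.ring_axioms])
    fix r assume r: "r \<in> carrier R"
    have "\<tau> r \<in> generators" unfolding generators_def using r by (intro CollectI exI[of _ 0] exI[of _ r]) simp
    then show "\<tau> r \<in> G.T 0 \<and> \<rho> r = vcoset (\<tau> r)" using G.G_T \<rho>_\<tau> r by blast
  qed
  ultimately show ?thesis by simp
qed

text \<open>
  The Teichmueller representatives of the nonzero elements of \<open>k\<close> form a coefficient group because \<open>k\<close> is
  perfect, and a relation equal to \<open>0\<close> in \<open>R\<close> lifts to an element of \<open>V A\<^sup>0\<close>.
\<close>

lemma form_vanishes_if_dominated:
  assumes k: "perfect_field p k" and \<phi>: "\<phi> \<in> ring_hom k R"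
    and y: "\<And>j. y j \<in> carrier R"
    and dep: "\<zero>\<^bsub>R\<^esub> \<in> dominated R (\<phi> ` (carrier k - {\<zero>\<^bsub>k\<^esub>})) y i"
  shows "form (\<lambda>j. \<tau> (y j)) (\<lambda>_. 1) i = \<zero>"
proof -
  interpret k: field k using k by (simp add: perfect_field_def)
  let ?K = "carrier k - {\<zero>\<^bsub>k\<^esub>}"
  let ?C = "\<tau> ` \<phi> ` ?K"
  have \<phi>c: "\<phi> a \<in> carrier R" if "a \<in> ?K" for a using ring_hom_closed[OF \<phi>] that by auto
  have prod: "\<tau> (\<phi> a) \<otimes> \<tau> (\<phi> b) = \<tau> (\<phi> (a \<otimes>\<^bsub>k\<^esub> b))" if "a \<in> ?K" "b \<in> ?K" for a b
    using that \<phi>c \<tau>_mult ring_hom_mult[OF \<phi>, of a b] by simp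
  have one: "\<tau> (\<phi> \<one>\<^bsub>k\<^esub>) = \<one>" using \<tau>_one ring_hom_one[OF \<phi>] by simp
  have kmult: "a \<otimes>\<^bsub>k\<^esub> b \<in> ?K" if "a \<in> ?K" "b \<in> ?K" for a b
    using that by (auto simp: k.integral_iff)
  interpret C: coefficient_group p A ?C "\<lambda>j. \<tau> (y j)" i
  proof
    show "?C \<subseteq> gr 0" using \<phi>c \<tau>_gr by blast
    show "\<one> \<in> ?C" using one k.one_closed k.zero_not_one by (metis (no_types, lifting) Diff_iff image_eqI singletonD)
    show "\<tau> (y j) \<in> gr 0" "F (\<tau> (y j)) = \<tau> (y j) [^] p" for j using y \<tau>_gr F_\<tau> by auto
  next
    fix a b assume "a \<in> ?C" "b \<in> ?C"
    then obtain a' b' where ab: "a' \<in> ?K" "b' \<in> ?K" "a = \<tau> (\<phi> a')" "b = \<tau> (\<phi> b')" by blast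
    then show "a \<otimes> b \<in> ?C" using prod kmult by simp
  next
    fix c assume "c \<in> ?C"
    then obtain a where a: "a \<in> ?K" "c = \<tau> (\<phi> a)" by blast
    have "a \<in> (\<lambda>x. x [^]\<^bsub>k\<^esub> p) ` carrier k" using a k by (simp add: perfect_field_def)
    then obtain b where b: "b \<in> carrier k" "a = b [^]\<^bsub>k\<^esub> p" by blast
    then have bK: "b \<in> ?K" using a p_pos by (auto simp: k.nat_pow_zero)
    have \<phi>pow: "\<phi> (b [^]\<^bsub>k\<^esub> (n::nat)) = \<phi> b [^]\<^bsub>R\<^esub> n" for n
      by (induction n) (simp_all add: ring_hom_one[OF \<phi>] ring_hom_mult[OF \<phi>] b)
    have "c = F (\<tau> (\<phi> b))" using a b \<phi>c[OF bK] \<phi>pow \<tau>_pow F_\<tau> by simp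
    then show "\<exists>b\<in>?C. c = F b" using bK by blast
    have "inv\<^bsub>k\<^esub> a \<in> ?K" "inv\<^bsub>k\<^esub> a \<otimes>\<^bsub>k\<^esub> a = \<one>\<^bsub>k\<^esub>"
      using a k.field_Units k.Units_inv_Units[of a] k.Units_l_inv[of a] by auto
    then show "\<exists>b\<in>?C. b \<otimes> c = \<one>" using prod[of "inv\<^bsub>k\<^esub> a" a] a one by force
  qed
  have "\<phi> ` ?K \<subseteq> carrier R" using \<phi>c by blast
  then obtain a where a: "a \<in> dominated A0 ?C (\<lambda>j. \<tau> (y j)) i" "a \<in> gr 0" "vcoset a = \<rho> \<zero>\<^bsub>R\<^esub>"
    using lift_dominated[OF y _ dep] by blast
  have "vcoset a = \<zero>\<^bsub>V_quot p A\<^esub>"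
    using a(3) ring_hom_zero[OF \<rho> R.ring_axioms cring.axioms(1)[OF V_quot_cring]] by simp
  then have "a \<in> V ` gr 0" using vcoset_zero[OF a(2)] by simp
  then show ?thesis using C.form_vanishes[OF a(1)] by simp
qed

end

theorem saturated_dRW_vanishes_above:
  fixes R :: "('r, 'm) ring_scheme"
  assumes p: "Factorial_Ring.prime p" and k: "perfect_field p k" and R: "cring R"
    and \<phi>: "\<phi> \<in> ring_hom k R" and dRW: "saturated_dRW p R A \<rho>"
    and dep: "\<And>y. (\<And>j. y j \<in> carrier R) \<Longrightarrow>
      \<zero>\<^bsub>R\<^esub> \<in> dominated R (\<phi> ` (carrier k - {\<zero>\<^bsub>k\<^esub>})) y i"
    and n: "n \<ge> int i"
  shows "grade A n = {\<zero>\<^bsub>A\<^esub>}"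
proof -
  have sda: "strict_dieudonne_algebra p A" and \<rho>: "\<rho> \<in> ring_hom R (V_quot p A)"
    using dRW by (simp_all add: saturated_dRW_def)
  then have "saturated p A" by (simp add: strict_dieudonne_algebra_def strict_def)
  then interpret strict_algebra p A using p sda by unfold_locales
  have "\<exists>a. a \<in> gr 0 \<and> F a = a [^]\<^bsub>A\<^esub> p \<and> \<rho> r = vcoset a" if r: "r \<in> carrier R" for r
  proof -
    have "\<rho> r \<in> carrier (V_quot p A)" using ring_hom_closed[OF \<rho> r] .
    then obtain x where x: "x \<in> gr 0" "\<rho> r = vcoset x" unfolding V_quot_carrier by blast
    obtain a where "a \<in> gr 0" "F a = a [^]\<^bsub>A\<^esub> p" "a \<ominus>\<^bsub>A\<^esub> x \<in> V ` gr 0"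
      using teichmueller_exists[OF x(1)] by blast
    then show ?thesis using x vcoset_eq_iff[of a x] by auto
  qed
  then obtain \<tau> where \<tau>: "\<And>r. r \<in> carrier R \<Longrightarrow> \<tau> r \<in> gr 0 \<and> F (\<tau> r) = \<tau> r [^]\<^bsub>A\<^esub> p \<and> \<rho> r = vcoset (\<tau> r)"
    by metis
  interpret teichmueller_section p A R \<rho> \<tau>
    using strict_algebra_axioms R \<rho> \<tau>
    by (simp add: teichmueller_section_def teichmueller_section_axioms_def)
  show ?thesis
    using vanishing_above[OF dRW form_vanishes_if_dominated[OF k \<phi> _ dep] n] by blast
qed

section \<open>The fraction field\<close>

context "domain"
begin

lemma frac_rel_iff:
  "((a, s), (b, t)) \<in> frac_rel R \<longleftrightarrow> a \<in> carrier R \<and> b \<in> carrier R \<and>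
     s \<in> carrier R - {\<zero>} \<and> t \<in> carrier R - {\<zero>} \<and> a \<otimes> t = b \<otimes> s"
  by (simp add: frac_rel_def)

lemma equiv_frac_rel: "equiv (carrier R \<times> (carrier R - {\<zero>})) (frac_rel R)"
proof (rule equivI)
  show "frac_rel R \<subseteq> (carrier R \<times> (carrier R - {\<zero>})) \<times> (carrier R \<times> (carrier R - {\<zero>}))"
    by (auto simp: frac_rel_def)
  show "refl_on (carrier R \<times> (carrier R - {\<zero>})) (frac_rel R)"
    by (auto simp: refl_on_def frac_rel_def)
  show "sym (frac_rel R)" by (auto simp: sym_def frac_rel_def)
  show "trans (frac_rel R)"
  proof (rule transI, clarify)
    fix a s b t c u
    assume 1: "((a, s), (b, t)) \<in> frac_rel R" and 2: "((b, t), (c, u)) \<in> frac_rel R"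
    then have c: "a \<in> carrier R" "b \<in> carrier R" "c \<in> carrier R" "s \<in> carrier R" "t \<in> carrier R"
      "u \<in> carrier R" "t \<noteq> \<zero>" and e: "a \<otimes> t = b \<otimes> s" "b \<otimes> u = c \<otimes> t"
      by (auto simp: frac_rel_iff)
    have "t \<otimes> (a \<otimes> u) = (a \<otimes> t) \<otimes> u" using c by (simp add: m_ac)
    also have "\<dots> = (b \<otimes> u) \<otimes> s" using c e(1) by (simp add: m_ac)
    also have "\<dots> = t \<otimes> (c \<otimes> s)" using c e(2) by (simp add: m_ac)
    finally have "a \<otimes> u = c \<otimes> s" using c m_lcancel[of t "a \<otimes> u" "c \<otimes> s"] by simp
    then show "((a, s), (c, u)) \<in> frac_rel R" using 1 2 by (simp add: frac_rel_iff)
  qed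
qed

lemma mk_frac_eq_iff:
  assumes "a \<in> carrier R" "s \<in> carrier R - {\<zero>}" "b \<in> carrier R" "t \<in> carrier R - {\<zero>}"
  shows "mk_frac R a s = mk_frac R b t \<longleftrightarrow> a \<otimes> t = b \<otimes> s"
  using eq_equiv_class_iff[OF equiv_frac_rel, of "(a, s)" "(b, t)"] assms
  by (simp add: mk_frac_def frac_rel_iff)

abbreviation "K \<equiv> fraction_field R"

lemma K_carrierE:
  assumes "x \<in> carrier K"
  obtains a s where "a \<in> carrier R" "s \<in> carrier R" "s \<noteq> \<zero>" "x = mk_frac R a s"
  using assms by (auto simp: fraction_field_def)

lemma K_closed: "a \<in> carrier R \<Longrightarrow> s \<in> carrier R \<Longrightarrow> s \<noteq> \<zero> \<Longrightarrow> mk_frac R a s \<in> carrier K"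
  by (auto simp: fraction_field_def)

lemma K_zero: "\<zero>\<^bsub>K\<^esub> = mk_frac R \<zero> \<one>" and K_one: "\<one>\<^bsub>K\<^esub> = mk_frac R \<one> \<one>"
  by (simp_all add: fraction_field_def)

lemma K_mult:
  assumes "a \<in> carrier R" "s \<in> carrier R" "s \<noteq> \<zero>" "b \<in> carrier R" "t \<in> carrier R" "t \<noteq> \<zero>"
  shows "mk_frac R a s \<otimes>\<^bsub>K\<^esub> mk_frac R b t = mk_frac R (a \<otimes> b) (s \<otimes> t)"
proof -
  have "(\<lambda>(a, s) (b, t). mk_frac R (a \<otimes> b) (s \<otimes> t)) respects2 frac_rel R"
  proof (rule congruent2I'[of "frac_rel R" "frac_rel R"], clarify)
    fix a s a' s' b t b' t'
    assume "((a, s), (a', s')) \<in> frac_rel R" "((b, t), (b', t')) \<in> frac_rel R"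
    then have c: "a \<in> carrier R" "s \<in> carrier R" "s \<noteq> \<zero>" "b \<in> carrier R" "t \<in> carrier R" "t \<noteq> \<zero>"
      "a' \<in> carrier R" "s' \<in> carrier R" "s' \<noteq> \<zero>" "b' \<in> carrier R" "t' \<in> carrier R" "t' \<noteq> \<zero>"
      and e: "a \<otimes> s' = a' \<otimes> s" "b \<otimes> t' = b' \<otimes> t"
      by (auto simp: frac_rel_iff)
    have "(a \<otimes> b) \<otimes> (s' \<otimes> t') = (a \<otimes> s') \<otimes> (b \<otimes> t')" using c by (simp add: m_ac)
    also have "\<dots> = (a' \<otimes> b') \<otimes> (s \<otimes> t)" unfolding e using c by (simp add: m_ac)
    finally show "mk_frac R (a \<otimes> b) (s \<otimes> t) = mk_frac R (a' \<otimes> b') (s' \<otimes> t')"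
      using c by (subst mk_frac_eq_iff) (auto simp: integral_iff)
  qed
  from UN_equiv_class2[OF equiv_frac_rel equiv_frac_rel this, of "(a, s)" "(b, t)"] assms
  show ?thesis by (simp add: fraction_field_def mk_frac_def[of R a s] mk_frac_def[of R b t] case_prod_beta)
qed

lemma K_add:
  assumes "a \<in> carrier R" "s \<in> carrier R" "s \<noteq> \<zero>" "b \<in> carrier R" "t \<in> carrier R" "t \<noteq> \<zero>"
  shows "mk_frac R a s \<oplus>\<^bsub>K\<^esub> mk_frac R b t = mk_frac R (a \<otimes> t \<oplus> b \<otimes> s) (s \<otimes> t)"
proof -
  have "(\<lambda>(a, s) (b, t). mk_frac R (a \<otimes> t \<oplus> b \<otimes> s) (s \<otimes> t)) respects2 frac_rel R"
  proof (rule congruent2I'[of "frac_rel R" "frac_rel R"], clarify)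
    fix a s a' s' b t b' t'
    assume "((a, s), (a', s')) \<in> frac_rel R" "((b, t), (b', t')) \<in> frac_rel R"
    then have c: "a \<in> carrier R" "s \<in> carrier R" "s \<noteq> \<zero>" "b \<in> carrier R" "t \<in> carrier R" "t \<noteq> \<zero>"
      "a' \<in> carrier R" "s' \<in> carrier R" "s' \<noteq> \<zero>" "b' \<in> carrier R" "t' \<in> carrier R" "t' \<noteq> \<zero>"
      and e: "a \<otimes> s' = a' \<otimes> s" "b \<otimes> t' = b' \<otimes> t"
      by (auto simp: frac_rel_iff)
    have "(a \<otimes> t \<oplus> b \<otimes> s) \<otimes> (s' \<otimes> t') = (a \<otimes> s') \<otimes> (t \<otimes> t') \<oplus> (b \<otimes> t') \<otimes> (s \<otimes> s')"
      using c by (simp add: l_distr r_distr m_ac)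
    also have "\<dots> = (a' \<otimes> t' \<oplus> b' \<otimes> s') \<otimes> (s \<otimes> t)"
      unfolding e using c by (simp add: l_distr r_distr m_ac)
    finally show "mk_frac R (a \<otimes> t \<oplus> b \<otimes> s) (s \<otimes> t) = mk_frac R (a' \<otimes> t' \<oplus> b' \<otimes> s') (s' \<otimes> t')"
      using c by (subst mk_frac_eq_iff) (auto simp: integral_iff)
  qed
  from UN_equiv_class2[OF equiv_frac_rel equiv_frac_rel this, of "(a, s)" "(b, t)"] assms
  show ?thesis by (simp add: fraction_field_def mk_frac_def[of R a s] mk_frac_def[of R b t] case_prod_beta)
qed

lemma fraction_field_cring: "cring K"
proof (rule cringI)
  note ne = integral_iff
  show "abelian_group K"
  proof (rule abelian_groupI)
    fix x y z assume "x \<in> carrier K" "y \<in> carrier K" "z \<in> carrier K"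
    then obtain a s b t c u where c: "a \<in> carrier R" "s \<in> carrier R" "s \<noteq> \<zero>" "b \<in> carrier R"
      "t \<in> carrier R" "t \<noteq> \<zero>" "c \<in> carrier R" "u \<in> carrier R" "u \<noteq> \<zero>"
      and e: "x = mk_frac R a s" "y = mk_frac R b t" "z = mk_frac R c u"
      by (elim K_carrierE) blast
    show "x \<oplus>\<^bsub>K\<^esub> y \<in> carrier K" using c e by (simp add: K_add K_closed ne)
    show "x \<oplus>\<^bsub>K\<^esub> y \<oplus>\<^bsub>K\<^esub> z = x \<oplus>\<^bsub>K\<^esub> (y \<oplus>\<^bsub>K\<^esub> z)"
      using c by (simp add: e K_add ne l_distr r_distr m_ac a_ac)
    show "x \<oplus>\<^bsub>K\<^esub> y = y \<oplus>\<^bsub>K\<^esub> x" using c by (simp add: e K_add m_comm a_comm)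
  next
    fix x assume "x \<in> carrier K"
    then obtain a s where c: "a \<in> carrier R" "s \<in> carrier R" "s \<noteq> \<zero>" and e: "x = mk_frac R a s"
      by (elim K_carrierE) blast
    show "\<zero>\<^bsub>K\<^esub> \<oplus>\<^bsub>K\<^esub> x = x" using c by (simp add: e K_zero K_add)
    have "mk_frac R (\<ominus> a) s \<oplus>\<^bsub>K\<^esub> x = mk_frac R \<zero> (s \<otimes> s)"
      using c by (simp add: e K_add l_minus l_neg)
    also have "\<dots> = \<zero>\<^bsub>K\<^esub>" using c by (simp add: K_zero mk_frac_eq_iff ne)
    finally show "\<exists>y\<in>carrier K. y \<oplus>\<^bsub>K\<^esub> x = \<zero>\<^bsub>K\<^esub>"
      using c by (intro bexI[of _ "mk_frac R (\<ominus> a) s"] K_closed) auto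
  qed (simp add: K_zero K_closed)
  show "comm_monoid K"
  proof (rule comm_monoidI)
    fix x y z assume "x \<in> carrier K" "y \<in> carrier K" "z \<in> carrier K"
    then obtain a s b t c u where c: "a \<in> carrier R" "s \<in> carrier R" "s \<noteq> \<zero>" "b \<in> carrier R"
      "t \<in> carrier R" "t \<noteq> \<zero>" "c \<in> carrier R" "u \<in> carrier R" "u \<noteq> \<zero>"
      and e: "x = mk_frac R a s" "y = mk_frac R b t" "z = mk_frac R c u"
      by (elim K_carrierE) blast
    show "x \<otimes>\<^bsub>K\<^esub> y \<in> carrier K" using c e by (simp add: K_mult K_closed ne)
    show "x \<otimes>\<^bsub>K\<^esub> y \<otimes>\<^bsub>K\<^esub> z = x \<otimes>\<^bsub>K\<^esub> (y \<otimes>\<^bsub>K\<^esub> z)" using c by (simp add: e K_mult ne m_assoc)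
    show "x \<otimes>\<^bsub>K\<^esub> y = y \<otimes>\<^bsub>K\<^esub> x" using c by (simp add: e K_mult m_comm)
  next
    fix x assume "x \<in> carrier K"
    then obtain a s where c: "a \<in> carrier R" "s \<in> carrier R" "s \<noteq> \<zero>" and e: "x = mk_frac R a s"
      by (elim K_carrierE) blast
    show "\<one>\<^bsub>K\<^esub> \<otimes>\<^bsub>K\<^esub> x = x" using c by (simp add: e K_one K_mult)
  qed (simp add: K_one K_closed)
  fix x y z assume "x \<in> carrier K" "y \<in> carrier K" "z \<in> carrier K"
  then obtain a s b t c u where c: "a \<in> carrier R" "s \<in> carrier R" "s \<noteq> \<zero>" "b \<in> carrier R"
    "t \<in> carrier R" "t \<noteq> \<zero>" "c \<in> carrier R" "u \<in> carrier R" "u \<noteq> \<zero>"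
    and e: "x = mk_frac R a s" "y = mk_frac R b t" "z = mk_frac R c u"
    by (elim K_carrierE) blast
  show "(x \<oplus>\<^bsub>K\<^esub> y) \<otimes>\<^bsub>K\<^esub> z = x \<otimes>\<^bsub>K\<^esub> z \<oplus>\<^bsub>K\<^esub> y \<otimes>\<^bsub>K\<^esub> z"
    using c by (simp add: e K_add K_mult ne mk_frac_eq_iff l_distr r_distr m_ac)
qed

lemma fraction_field_embedding: "(\<lambda>a. mk_frac R a \<one>) \<in> ring_hom R K"
  by (rule ring_hom_memI) (simp_all add: K_closed K_mult K_add K_one)

lemma fraction_field_embedding_zero: "a \<in> carrier R \<Longrightarrow> mk_frac R a \<one> = \<zero>\<^bsub>K\<^esub> \<longleftrightarrow> a = \<zero>"
  by (simp add: K_zero mk_frac_eq_iff)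

end

lemma (in primeideal) residue_field:
  shows "cring (residue_field R I)" "to_residue_field R I \<in> ring_hom R (residue_field R I)"
    "a \<in> carrier R \<Longrightarrow> to_residue_field R I a = \<zero>\<^bsub>residue_field R I\<^esub> \<longleftrightarrow> a \<in> I"
proof -
  interpret Q: "domain" "R Quot I" by (rule quotient_is_domain)
  show "cring (residue_field R I)" unfolding residue_field_def by (rule Q.fraction_field_cring)
  have eq: "to_residue_field R I = (\<lambda>a. mk_frac (R Quot I) a \<one>\<^bsub>R Quot I\<^esub>) \<circ> (+>) I"
    by (auto simp: to_residue_field_def)
  show "to_residue_field R I \<in> ring_hom R (residue_field R I)"
    unfolding eq residue_field_def by (rule ring_hom_trans[OF rcos_ring_hom Q.fraction_field_embedding])
  assume a: "a \<in> carrier R"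
  have "I +> a \<in> carrier (R Quot I)" using ring_hom_closed[OF rcos_ring_hom a] .
  then have "to_residue_field R I a = \<zero>\<^bsub>residue_field R I\<^esub> \<longleftrightarrow> I +> a = \<zero>\<^bsub>R Quot I\<^esub>"
    unfolding to_residue_field_def residue_field_def by (rule Q.fraction_field_embedding_zero)
  also have "\<dots> \<longleftrightarrow> a \<in> I"
    using a a_rcos_self[of a] a_rcos_const by (auto simp: FactRing_def)
  finally show "to_residue_field R I a = \<zero>\<^bsub>residue_field R I\<^esub> \<longleftrightarrow> a \<in> I" .
qed

section \<open>Dominated relations at generic points\<close>

lemma (in ring) indexed_pset_finite_support:
  assumes "P \<in> indexed_pset S (carrier R)"
  shows "finite {m. P m \<noteq> \<zero>} \<and> (\<forall>m. P m \<in> carrier R) \<and> (\<forall>m. P m \<noteq> \<zero> \<longrightarrow> set_mset m \<subseteq> S)"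
  using assms
proof (induction rule: indexed_pset.induct)
  case (indexed_const c)
  have "{m. indexed_const c m \<noteq> \<zero>} \<subseteq> {{#}}" by (auto simp: indexed_const_def)
  then show ?case using indexed_const finite_subset by (auto simp: indexed_const_def)
next
  case (indexed_padd P Q)
  have "{m. indexed_padd P Q m \<noteq> \<zero>} \<subseteq> {m. P m \<noteq> \<zero>} \<union> {m. Q m \<noteq> \<zero>}"
    by (auto simp: indexed_padd_def)
  moreover have "finite ({m. P m \<noteq> \<zero>} \<union> {m. Q m \<noteq> \<zero>})" using indexed_padd by simp
  ultimately have "finite {m. indexed_padd P Q m \<noteq> \<zero>}" by (rule finite_subset)
  moreover have "set_mset m \<subseteq> S" if "indexed_padd P Q m \<noteq> \<zero>" for m
  proof -
    have "P m \<noteq> \<zero> \<or> Q m \<noteq> \<zero>" using that by (auto simp: indexed_padd_def)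
    then show ?thesis using indexed_padd by blast
  qed
  ultimately show ?case using indexed_padd by (auto simp: indexed_padd_def)
next
  case (indexed_pmult P i)
  have "{m. indexed_pmult P i m \<noteq> \<zero>} \<subseteq> add_mset i ` {m. P m \<noteq> \<zero>}"
  proof
    fix m assume "m \<in> {m. indexed_pmult P i m \<noteq> \<zero>}"
    then have "i \<in># m" "P (m - {#i#}) \<noteq> \<zero>" by (auto simp: indexed_pmult_def split: if_splits)
    then show "m \<in> add_mset i ` {m. P m \<noteq> \<zero>}" by (intro image_eqI[of _ _ "m - {#i#}"]) auto
  qed
  moreover have "finite (add_mset i ` {m. P m \<noteq> \<zero>})" using indexed_pmult by simp
  ultimately have "finite {m. indexed_pmult P i m \<noteq> \<zero>}" by (rule finite_subset)
  moreover have "set_mset m \<subseteq> S" if "indexed_pmult P i m \<noteq> \<zero>" for m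
  proof -
    have m: "i \<in># m" "P (m - {#i#}) \<noteq> \<zero>" using that by (auto simp: indexed_pmult_def split: if_splits)
    then have "set_mset (m - {#i#}) \<subseteq> S" using indexed_pmult by blast
    moreover have "m = add_mset i (m - {#i#})" using m(1) by simp
    ultimately show ?thesis using indexed_pmult by (metis insert_subset set_mset_add_mset_insert)
  qed
  ultimately show ?case using indexed_pmult by (auto simp: indexed_pmult_def)
qed

text \<open>
  Exponents beyond \<open>n\<close> are required to vanish because the lexicographic order on functions is total
  only between functions that differ in finitely many places.
\<close>

lemma ex_lexicographic_maximum:
  fixes E :: "'x \<Rightarrow> nat \<Rightarrow> nat"
  assumes "finite M" "M \<noteq> {}" "inj_on E M" "\<And>m j. m \<in> M \<Longrightarrow> j \<ge> n \<Longrightarrow> E m j = 0"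
  shows "\<exists>m0\<in>M. \<forall>m\<in>M - {m0}. less_fun (E m) (E m0)"
  using assms
proof (induction M rule: finite_ne_induct)
  case (insert a M)
  then obtain m0 where m0: "m0 \<in> M" "\<forall>m\<in>M - {m0}. less_fun (E m) (E m0)" by auto
  have "E a j = 0" "E m0 j = 0" if "j \<ge> n" for j
    using insert.prems(2)[of a j] insert.prems(2)[of m0 j] m0(1) that by auto
  then have "{j. E a j \<noteq> E m0 j} \<subseteq> {..<n}" by (auto simp: not_le[symmetric])
  then have "less_fun (E a) (E m0) \<or> E a = E m0 \<or> less_fun (E m0) (E a)"
    by (intro less_fun_trichotomy) (auto intro: finite_subset)
  moreover have "E a \<noteq> E m0" using insert.prems(1) insert.hyps m0(1) by (auto dest: inj_onD)
  ultimately show ?case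
  proof (elim disjE)
    assume "less_fun (E a) (E m0)"
    then show ?thesis using m0 by (intro bexI[of _ m0]) auto
  next
    assume "less_fun (E m0) (E a)"
    then show ?thesis using m0 less_fun_trans by (intro bexI[of _ a]) blast+
  qed simp
qed simp

context monomial_sums
begin

lemma finsum_dominated:
  assumes M: "finite M" "M \<noteq> {}" and E: "inj_on E M" "\<And>m j. m \<in> M \<Longrightarrow> j \<ge> n \<Longrightarrow> E m j = 0"
    and c: "\<And>m. m \<in> M \<Longrightarrow> c m \<in> C"
  shows "(\<Oplus>m\<in>M. c m \<otimes> monomial_of (E m)) \<in> dominated_sums"
proof -
  obtain m0 where m0: "m0 \<in> M" "\<And>m. m \<in> M - {m0} \<Longrightarrow> less_fun (E m) (E m0)"
    using ex_lexicographic_maximum[OF M E] by blast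
  have tc: "c m \<otimes> monomial_of (E m) \<in> carrier R" if "m \<in> M" for m
    using c[OF that] C_carrier monomial_closed by auto
  have "(\<Oplus>m\<in>N. c m \<otimes> monomial_of (E m)) \<in> lower_sums (E m0)" if "finite N" "N \<subseteq> M - {m0}" for N
    using that
  proof (induction N)
    case (insert m N)
    have "(\<Oplus>m\<in>insert m N. c m \<otimes> monomial_of (E m)) = c m \<otimes> monomial_of (E m) \<oplus> (\<Oplus>m\<in>N. c m \<otimes> monomial_of (E m))"
      using insert tc by (intro finsum_insert) auto
    then show ?case using insert c E(2) m0(2) by (auto intro!: lower_terms.add)
  qed (simp add: lower_terms.zero)
  then have l: "(\<Oplus>m\<in>M - {m0}. c m \<otimes> monomial_of (E m)) \<in> lower_sums (E m0)" using M by blast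
  have "(\<Oplus>m\<in>insert m0 (M - {m0}). c m \<otimes> monomial_of (E m)) =
      c m0 \<otimes> monomial_of (E m0) \<oplus> (\<Oplus>m\<in>M - {m0}. c m \<otimes> monomial_of (E m))"
    using M tc m0 by (intro finsum_insert) auto
  moreover have "insert m0 (M - {m0}) = M" using m0 by blast
  ultimately show ?thesis unfolding dominated_def using l c[OF m0(1)] E(2)[OF m0(1)] by auto
qed

end

lemma (in cring) monomial_finprod:
  assumes "\<And>j. x j \<in> carrier R"
  shows "monomial R x m n = (\<Otimes>j\<in>{..<n}. x j [^] m j)"
proof (induction n)
  case (Suc n)
  have "(\<Otimes>j\<in>insert n {..<n}. x j [^] m j) = x n [^] m n \<otimes> (\<Otimes>j\<in>{..<n}. x j [^] m j)"
    using assms by (intro finprod_insert) auto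
  moreover have "(\<Otimes>j\<in>{..<n}. x j [^] m j) \<in> carrier R" using assms by (intro finprod_closed) auto
  ultimately show ?case using Suc assms by (simp add: lessThan_Suc m_comm)
qed simp

lemma (in cring) monomial_single:
  assumes "\<And>j. x j \<in> carrier R" "a < n"
  shows "monomial R x (\<lambda>j. if j = a then 1 else 0) n = x a"
proof -
  have one: "monomial R x (\<lambda>j. if j = a then 1 else 0) l = \<one>" if "l \<le> a" for l
    using that by (induction l) simp_all
  show ?thesis using assms(2)
  proof (induction n)
    case (Suc n)
    then show ?case using assms(1) one[of n] by (cases "n = a") simp_all
  qed simp
qed

lemma monomial_ring_hom:
  assumes "h \<in> ring_hom R S" "ring R" "\<And>j. x j \<in> carrier R"
  shows "h (monomial R x m n) = monomial S (\<lambda>j. h (x j)) m n"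
proof -
  interpret ring R by fact
  have c: "monomial R x m n \<in> carrier R" for n by (induction n) (simp_all add: assms(3))
  have pow: "h (x j [^]\<^bsub>R\<^esub> (k::nat)) = h (x j) [^]\<^bsub>S\<^esub> k" for j k
    by (induction k) (simp_all add: ring_hom_one[OF assms(1)] ring_hom_mult[OF assms(1)] assms(3))
  show ?thesis
    by (induction n) (simp_all add: ring_hom_one[OF assms(1)] ring_hom_mult[OF assms(1)] c pow assms(3))
qed

lemma monomial_sums_field_image:
  assumes R: "cring R" and k: "field k" and \<phi>: "\<phi> \<in> ring_hom k R" and y: "\<And>j. y j \<in> carrier R"
  shows "monomial_sums R (\<phi> ` (carrier k - {\<zero>\<^bsub>k\<^esub>})) y"
proof -
  interpret R: cring R by (rule R)
  interpret k: field k by (rule k)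
  let ?K = "carrier k - {\<zero>\<^bsub>k\<^esub>}"
  show ?thesis
  proof
    show "\<one>\<^bsub>R\<^esub> \<in> \<phi> ` ?K" using ring_hom_one[OF \<phi>] by force
    fix a b assume "a \<in> \<phi> ` ?K" "b \<in> \<phi> ` ?K"
    then obtain a' b' where ab: "a' \<in> ?K" "b' \<in> ?K" "a = \<phi> a'" "b = \<phi> b'" by blast
    then have "a' \<otimes>\<^bsub>k\<^esub> b' \<in> ?K" by (auto simp: k.integral_iff)
    moreover have "a \<otimes>\<^bsub>R\<^esub> b = \<phi> (a' \<otimes>\<^bsub>k\<^esub> b')" using ab ring_hom_mult[OF \<phi>, of a' b'] by simp
    ultimately show "a \<otimes>\<^bsub>R\<^esub> b \<in> \<phi> ` ?K" by blast
  qed (use ring_hom_closed[OF \<phi>] y in auto)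
qed

text \<open>
  If two of the \<open>y j\<close> have the same image in the residue field, their difference is the required element: a set of
  images would not see the coincidence.  Otherwise the images form a set of \<open>n\<close> elements, which is
  algebraically dependent, and the values of a polynomial at these elements are the images of values at the \<open>y j\<close>.
\<close>

lemma dominated_in_prime:
  fixes R :: "('r, 'm) ring_scheme" and k :: "('k, 'n) ring_scheme"
  assumes R: "cring R" and k: "field k" and \<phi>: "\<phi> \<in> ring_hom k R" and P: "primeideal P R"
    and deg: "tr_deg k (residue_field R P) (\<lambda>a. to_residue_field R P (\<phi> a)) < enat n"
    and y: "\<And>j. y j \<in> carrier R"
  shows "\<exists>r\<in>P. r \<in> dominated R (\<phi> ` (carrier k - {\<zero>\<^bsub>k\<^esub>})) y n"
proof -
  interpret R: cring R by (rule R)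
  interpret k: field k by (rule k)
  interpret P: primeideal P R by (rule P)
  define L where "L = residue_field R P"
  define h where "h = to_residue_field R P"
  interpret L: cring L unfolding L_def by (rule P.residue_field)
  have h: "h \<in> ring_hom R L" unfolding h_def L_def by (rule P.residue_field)
  have h0: "h a = \<zero>\<^bsub>L\<^esub> \<longleftrightarrow> a \<in> P" if "a \<in> carrier R" for a
    unfolding h_def L_def using P.residue_field(3)[OF that] .
  interpret h: ring_hom_cring R L h by unfold_locales (rule h)
  let ?K = "carrier k - {\<zero>\<^bsub>k\<^esub>}"
  let ?C = "\<phi> ` ?K"
  have \<phi>c: "\<phi> a \<in> carrier R" if "a \<in> carrier k" for a using ring_hom_closed[OF \<phi> that] .
  interpret S: monomial_sums R ?C y n by (rule monomial_sums_field_image[OF R k \<phi> y])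
  define x where "x j = h (y j)" for j
  have x: "x j \<in> carrier L" for j using h y by (auto simp: x_def ring_hom_closed)
  show ?thesis
  proof (cases "inj_on x {..<n}")
    case False
    then obtain a b where ab: "a < b" "b < n" "x a = x b"
      unfolding inj_on_def by (metis lessThan_iff linorder_neqE_nat)
    let ?ea = "\<lambda>j. if j = a then 1 else 0 :: nat" and ?eb = "\<lambda>j. if j = b then 1 else 0 :: nat"
    have lt: "less_fun ?eb ?ea" unfolding less_fun_def using ab(1) by (intro exI[of _ a]) auto
    have m1: "\<phi> (\<ominus>\<^bsub>k\<^esub> \<one>\<^bsub>k\<^esub>) = \<ominus>\<^bsub>R\<^esub> \<one>\<^bsub>R\<^esub>"
    proof -
      have "\<phi> (\<ominus>\<^bsub>k\<^esub> \<one>\<^bsub>k\<^esub>) \<oplus>\<^bsub>R\<^esub> \<one>\<^bsub>R\<^esub> = \<zero>\<^bsub>R\<^esub>"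
        using ring_hom_add[OF \<phi>, of "\<ominus>\<^bsub>k\<^esub> \<one>\<^bsub>k\<^esub>" "\<one>\<^bsub>k\<^esub>"] ring_hom_one[OF \<phi>]
          ring_hom_zero[OF \<phi> k.ring_axioms R.ring_axioms] by (simp add: k.l_neg)
      then show ?thesis using R.minus_equality \<phi>c by force
    qed
    have m1K: "\<ominus>\<^bsub>k\<^esub> \<one>\<^bsub>k\<^esub> \<in> ?K"
      using k.minus_minus[OF k.one_closed] k.minus_zero k.zero_not_one by auto
    let ?r = "\<one>\<^bsub>R\<^esub> \<otimes>\<^bsub>R\<^esub> monomial R y ?ea n \<oplus>\<^bsub>R\<^esub>
      (\<phi> (\<ominus>\<^bsub>k\<^esub> \<one>\<^bsub>k\<^esub>) \<otimes>\<^bsub>R\<^esub> monomial R y ?eb n \<oplus>\<^bsub>R\<^esub> \<zero>\<^bsub>R\<^esub>)"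
    have "\<phi> (\<ominus>\<^bsub>k\<^esub> \<one>\<^bsub>k\<^esub>) \<otimes>\<^bsub>R\<^esub> monomial R y ?eb n \<oplus>\<^bsub>R\<^esub> \<zero>\<^bsub>R\<^esub> \<in> lower_terms R ?C y n ?ea"
      using m1K ab lt by (intro lower_terms.add lower_terms.zero) auto
    then have "?r \<in> dominated R ?C y n"
      unfolding dominated_def using S.C_one ab
      by (intro CollectI exI conjI) (rule refl, auto)
    moreover have "?r = y a \<ominus>\<^bsub>R\<^esub> y b"
      using R.monomial_single[OF y] ab y m1 by (simp add: R.l_minus a_minus_def)
    moreover have "y a \<ominus>\<^bsub>R\<^esub> y b \<in> P"
    proof -
      have "h (y a \<ominus>\<^bsub>R\<^esub> y b) = \<zero>\<^bsub>L\<^esub>"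
        using ab(3) y x by (simp add: a_minus_def x_def L.r_neg)
      then show ?thesis using h0[OF R.minus_closed[OF y y]] by blast
    qed
    ultimately show ?thesis by metis
  next
    case True
    let ?S = "x ` {..<n}" and ?\<iota> = "\<lambda>a. h (\<phi> a)"
    have "\<not> algebraically_independent k L ?\<iota> ?S"
    proof
      assume "algebraically_independent k L ?\<iota> ?S"
      then have "(if finite ?S then enat (card ?S) else \<infinity>) \<le> tr_deg k L ?\<iota>"
        unfolding tr_deg_def by (intro SUP_upper) simp
      then show False using deg True by (simp add: card_image h_def L_def)
    qed
    then obtain Q where Q: "Q \<in> k.indexed_pset ?S (carrier k)" "eval_indexed k L ?\<iota> Q = \<zero>\<^bsub>L\<^esub>"
      "Q \<noteq> (\<lambda>m. \<zero>\<^bsub>k\<^esub>)"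
      unfolding algebraically_independent_def using x by blast
    define M where "M = {m. Q m \<noteq> \<zero>\<^bsub>k\<^esub>}"
    have M: "finite M" "M \<noteq> {}" "\<And>m. Q m \<in> carrier k" "\<And>m. m \<in> M \<Longrightarrow> set_mset m \<subseteq> ?S"
      using k.indexed_pset_finite_support[OF Q(1)] Q(3) by (auto simp: M_def)
    define E where "E m j = (if j < n then count m (x j) else 0)" for m j
    have E_inj: "inj_on E M"
    proof (rule inj_onI, rule multiset_eqI)
      fix m m' z assume m: "m \<in> M" "m' \<in> M" "E m = E m'"
      show "count m z = count m' z"
      proof (cases "z \<in> ?S")
        case True
        then obtain j where "j < n" "z = x j" by auto
        then show ?thesis using fun_cong[OF m(3), of j] by (simp add: E_def)
      next
        case False
        then show ?thesis using M(4)[OF m(1)] M(4)[OF m(2)] by (metis count_inI subsetD)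
      qed
    qed
    let ?t = "\<lambda>m. \<phi> (Q m) \<otimes>\<^bsub>R\<^esub> monomial R y (E m) n"
    define r where "r = (\<Oplus>\<^bsub>R\<^esub>m\<in>M. ?t m)"
    have tc: "?t m \<in> carrier R" for m using \<phi>c M(3) S.monomial_closed by simp
    have "r \<in> dominated R ?C y n"
      unfolding r_def using M by (intro S.finsum_dominated E_inj) (auto simp: E_def M_def)
    moreover have "h r = \<zero>\<^bsub>L\<^esub>"
    proof -
      have "h (?t m) = ?\<iota> (Q m) \<otimes>\<^bsub>L\<^esub> (\<Otimes>\<^bsub>L\<^esub>z\<in>set_mset m. z [^]\<^bsub>L\<^esub> count m z)" if m: "m \<in> M" for m
      proof -
        have "h (monomial R y (E m) n) = monomial L x (E m) n"
          unfolding x_def by (rule monomial_ring_hom[OF h R.ring_axioms y])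
        also have "\<dots> = (\<Otimes>\<^bsub>L\<^esub>j\<in>{..<n}. x j [^]\<^bsub>L\<^esub> E m j)" by (rule L.monomial_finprod[OF x])
        also have "\<dots> = (\<Otimes>\<^bsub>L\<^esub>j\<in>{..<n}. x j [^]\<^bsub>L\<^esub> count m (x j))"
          using x by (intro L.finprod_cong') (auto simp: E_def)
        also have "\<dots> = (\<Otimes>\<^bsub>L\<^esub>z\<in>?S. z [^]\<^bsub>L\<^esub> count m z)"
          using x True by (subst L.finprod_reindex) auto
        also have "\<dots> = (\<Otimes>\<^bsub>L\<^esub>z\<in>set_mset m. z [^]\<^bsub>L\<^esub> count m z)"
          using x M(4)[OF m]
          by (intro L.finprod_mono_neutral_cong_right) (auto simp: not_in_iff)
        finally show ?thesis
          using ring_hom_mult[OF h \<phi>c[OF M(3)] S.monomial_closed] by simp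
      qed
      note ht = this
      have "h r = (\<Oplus>\<^bsub>L\<^esub>m\<in>M. h (?t m))"
        unfolding r_def using tc by (subst h.hom_finsum) (auto simp: o_def)
      also have "\<dots> = (\<Oplus>\<^bsub>L\<^esub>m\<in>M. ?\<iota> (Q m) \<otimes>\<^bsub>L\<^esub> (\<Otimes>\<^bsub>L\<^esub>z\<in>set_mset m. z [^]\<^bsub>L\<^esub> count m z))"
        using ring_hom_closed[OF h tc] by (intro L.finsum_cong') (auto simp: ht[symmetric])
      also have "\<dots> = \<zero>\<^bsub>L\<^esub>" using Q(2) by (simp add: eval_indexed_def M_def)
      finally show ?thesis .
    qed
    moreover have "r \<in> carrier R" unfolding r_def using tc by (intro R.finsum_closed) auto
    ultimately show ?thesis using h0[of r] by blast
  qed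
qed

section \<open>Prime ideals of Noetherian rings\<close>

context cring
begin

abbreviation "list_prod as \<equiv> foldr (\<otimes>) as \<one>"

lemma list_prod_closed: "set as \<subseteq> carrier R \<Longrightarrow> list_prod as \<in> carrier R"
  by (induction as) auto

lemma list_prod_append:
  "set as \<subseteq> carrier R \<Longrightarrow> set bs \<subseteq> carrier R \<Longrightarrow> list_prod (as @ bs) = list_prod as \<otimes> list_prod bs"
  by (induction as) (auto simp: list_prod_closed m_assoc)

text \<open>
  The product of the ideals in \<open>Ps\<close> is contained in \<open>I\<close>, expressed with products of elements.
\<close>

definition contains_prime_product :: "'a set \<Rightarrow> 'a set list \<Rightarrow> bool" where
  "contains_prime_product I Ps \<longleftrightarrow> (\<forall>P\<in>set Ps. primeideal P R) \<and>
     (\<forall>as. list_all2 (\<in>) as Ps \<longrightarrow> list_prod as \<in> I)"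

lemma members_carrier:
  assumes "list_all2 (\<in>) as Ps" "\<forall>P\<in>set Ps. primeideal P R" shows "set as \<subseteq> carrier R"
proof
  fix a assume "a \<in> set as"
  then obtain P where "P \<in> set Ps" "a \<in> P"
    using assms(1) by (metis in_set_conv_nth list_all2_conv_all_nth)
  then show "a \<in> carrier R" using assms(2) ideal.Icarr primeideal.axioms(1) by metis
qed

end

text \<open>
  Noetherian induction.  A maximal counterexample \<open>J\<close> is not prime, so \<open>a b \<in> J\<close> for some \<open>a, b\<close> outside \<open>J\<close>;
  the larger ideals \<open>J + (a)\<close> and \<open>J + (b)\<close> contain products of primes, and their product lies in
  \<open>J\<close>.
\<close>

lemma (in noetherian_ring) ex_prime_product:
  assumes R: "cring R" and I: "ideal I R"
  shows "\<exists>Ps. cring.contains_prime_product R I Ps"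
proof (rule ccontr)
  interpret cring R by (rule R)
  assume nI: "\<nexists>Ps. contains_prime_product I Ps"
  define \<B> where "\<B> = {J. ideal J R \<and> (\<nexists>Ps. contains_prime_product J Ps)}"
  have "\<exists>J\<in>\<B>. \<forall>J'\<in>\<B>. J \<subseteq> J' \<longrightarrow> J' = J"
  proof (rule subset_Zorn_nonempty)
    show "\<B> \<noteq> {}" using I nI by (auto simp: \<B>_def)
    fix \<C> assume C: "\<C> \<noteq> {}" "subset.chain \<B> \<C>"
    then have "subset.chain {I. ideal I R} \<C>" by (auto simp: \<B>_def subset_chain_def)
    then show "\<Union>\<C> \<in> \<B>" using ideal_chain_is_trivial[OF C(1)] C(2) by (auto simp: subset_chain_def)
  qed
  then obtain J where J: "ideal J R" "\<nexists>Ps. contains_prime_product J Ps"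
    and max: "\<And>J'. ideal J' R \<Longrightarrow> J \<subseteq> J' \<Longrightarrow> J' \<noteq> J \<Longrightarrow> \<exists>Ps. contains_prime_product J' Ps"
    unfolding \<B>_def by blast
  interpret J: ideal J R by (rule J(1))
  have "carrier R \<noteq> J"
  proof
    assume "carrier R = J"
    then have "contains_prime_product J []" by (auto simp: contains_prime_product_def)
    then show False using J(2) by blast
  qed
  moreover have "\<not> primeideal J R"
  proof
    assume P: "primeideal J R"
    have "list_prod as \<in> J" if "list_all2 (\<in>) as [J]" for as
      using that J.a_Hcarr by (auto simp: list_all2_Cons2)
    then have "contains_prime_product J [J]" using P by (simp add: contains_prime_product_def)
    then show False using J(2) by blast
  qed
  ultimately obtain a b where ab: "a \<in> carrier R" "b \<in> carrier R" "a \<otimes> b \<in> J" "a \<notin> J" "b \<notin> J"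
    using primeidealI[OF J(1) R] by blast
  have ext: "\<exists>Ps. contains_prime_product (J <+>\<^bsub>R\<^esub> PIdl c) Ps" if c: "c \<in> carrier R" "c \<notin> J" for c
  proof (rule max)
    show "ideal (J <+>\<^bsub>R\<^esub> PIdl c) R" by (rule add_ideals[OF J(1) cgenideal_ideal[OF c(1)]])
    interpret Q: ideal "PIdl c" R by (rule cgenideal_ideal[OF c(1)])
    have sum: "u \<oplus> v \<in> J <+>\<^bsub>R\<^esub> PIdl c" if "u \<in> J" "v \<in> PIdl c" for u v
      using that unfolding set_add_def' by blast
    show "J \<subseteq> J <+>\<^bsub>R\<^esub> PIdl c"
    proof
      fix u assume "u \<in> J"
      then show "u \<in> J <+>\<^bsub>R\<^esub> PIdl c" using sum[OF _ Q.zero_closed, of u] J.a_Hcarr by simp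
    qed
    have "c \<in> J <+>\<^bsub>R\<^esub> PIdl c" using sum[OF J.zero_closed cgenideal_self[OF c(1)]] c(1) by simp
    then show "J <+>\<^bsub>R\<^esub> PIdl c \<noteq> J" using c(2) by blast
  qed
  obtain Ps Qs where Ps: "contains_prime_product (J <+>\<^bsub>R\<^esub> PIdl a) Ps"
    and Qs: "contains_prime_product (J <+>\<^bsub>R\<^esub> PIdl b) Qs"
    using ext ab by blast
  have "contains_prime_product J (Ps @ Qs)"
    unfolding contains_prime_product_def
  proof (intro conjI allI impI)
    show pr: "\<forall>P\<in>set (Ps @ Qs). primeideal P R"
      using Ps Qs by (auto simp: contains_prime_product_def)
    fix as assume "list_all2 (\<in>) as (Ps @ Qs)"
    then obtain us vs where uv: "as = us @ vs" "list_all2 (\<in>) us Ps" "list_all2 (\<in>) vs Qs"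
      by (auto simp: list_all2_append2)
    have c: "set us \<subseteq> carrier R" "set vs \<subseteq> carrier R"
      using members_carrier uv Ps Qs by (auto simp: contains_prime_product_def)
    have "list_prod us \<in> J <+>\<^bsub>R\<^esub> PIdl a"
      using Ps uv(2) unfolding contains_prime_product_def by blast
    then obtain i qi where i': "i \<in> J" "qi \<in> PIdl a" "list_prod us = i \<oplus> qi"
      unfolding set_add_def' by blast
    obtain s where "s \<in> carrier R" "qi = s \<otimes> a" using i'(2) unfolding cgenideal_def by blast
    note i = i'(1) this(1) i'(3)[unfolded this(2)]
    have "list_prod vs \<in> J <+>\<^bsub>R\<^esub> PIdl b"
      using Qs uv(3) unfolding contains_prime_product_def by blast
    then obtain j qj where j': "j \<in> J" "qj \<in> PIdl b" "list_prod vs = j \<oplus> qj"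
      unfolding set_add_def' by blast
    obtain t where "t \<in> carrier R" "qj = t \<otimes> b" using j'(2) unfolding cgenideal_def by blast
    note j = j'(1) this(1) j'(3)[unfolded this(2)]
    have ijc: "i \<in> carrier R" "j \<in> carrier R" using i j J.a_Hcarr by auto
    have "list_prod as = i \<otimes> (j \<oplus> t \<otimes> b) \<oplus> (s \<otimes> a) \<otimes> j \<oplus> (s \<otimes> t) \<otimes> (a \<otimes> b)"
      using list_prod_append[OF c] uv(1) i j ijc ab by (simp add: l_distr r_distr m_ac a_ac)
    moreover have "i \<otimes> (j \<oplus> t \<otimes> b) \<in> J" "(s \<otimes> a) \<otimes> j \<in> J" "(s \<otimes> t) \<otimes> (a \<otimes> b) \<in> J"
      using i j ab ijc J.I_l_closed J.I_r_closed by auto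
    ultimately show "list_prod as \<in> J" using J.a_closed by simp
  qed
  then show False using J(2) by blast
qed

section \<open>Generic points\<close>

lemma zariski_topology:
  "openin (zariski R) U \<longleftrightarrow> (\<exists>S\<subseteq>carrier R. U = {P \<in> Spec R. \<not> S \<subseteq> P})"
  unfolding zariski_def by (simp add: topology_inverse'[OF istopology_zariski])

lemma topspace_zariski: "topspace (zariski R) = Spec R"
proof -
  have "openin (zariski R) (Spec R)"
  proof -
    have "\<not> carrier R \<subseteq> P" if "P \<in> Spec R" for P
      using that primeideal.I_notcarr ideal.Icarr primeideal.axioms(1) unfolding Spec_def
      by (metis mem_Collect_eq subsetI subset_antisym)
    then have "Spec R = {P \<in> Spec R. \<not> carrier R \<subseteq> P}" by blast
    then show ?thesis unfolding zariski_topology by blast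
  qed
  moreover have "U \<subseteq> Spec R" if "openin (zariski R) U" for U
    using that unfolding zariski_topology by blast
  ultimately show ?thesis unfolding topspace_def by blast
qed

lemma closedin_zariski:
  "closedin (zariski R) C \<longleftrightarrow> (\<exists>S\<subseteq>carrier R. C = {P \<in> Spec R. S \<subseteq> P})"
proof -
  have "Spec R - {P \<in> Spec R. \<not> S \<subseteq> P} = {P \<in> Spec R. S \<subseteq> P}"
    "Spec R - {P \<in> Spec R. S \<subseteq> P} = {P \<in> Spec R. \<not> S \<subseteq> P}" for S by auto
  then show ?thesis
    unfolding closedin_def topspace_zariski zariski_topology
    by (metis (no_types, lifting) Diff_Diff_Int Int_absorb1 mem_Collect_eq subsetI)
qed

lemma closure_of_point:
  assumes "\<eta> \<in> Spec R" shows "zariski R closure_of {\<eta>} = {Q \<in> Spec R. \<eta> \<subseteq> Q}"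
proof -
  have "\<eta> \<subseteq> carrier R"
    using assms ideal.Icarr primeideal.axioms(1) unfolding Spec_def by fastforce
  then have "(\<forall>S\<subseteq>carrier R. \<not> S \<subseteq> Q \<longrightarrow> \<not> S \<subseteq> \<eta>) \<longleftrightarrow> \<eta> \<subseteq> Q" for Q by blast
  then show ?thesis
    unfolding closure_of_def topspace_zariski zariski_topology using assms by blast
qed

lemma irreducible_in_Union:
  assumes "finite \<F>" "irreducible_in U Z" "\<And>C. C \<in> \<F> \<Longrightarrow> closedin U C" "Z \<subseteq> \<Union>\<F>"
  shows "\<exists>C\<in>\<F>. Z \<subseteq> C"
  using assms(1,3,4)
proof (induction \<F>)
  case empty then show ?case using assms(2) by (auto simp: irreducible_in_def)
next
  case (insert C \<F>)
  have "closedin U C" "closedin U (\<Union>\<F>)" "Z \<subseteq> C \<union> \<Union>\<F>"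
    using insert by (auto intro: closedin_Union)
  then have "Z \<subseteq> C \<or> Z \<subseteq> \<Union>\<F>" using assms(2) unfolding irreducible_in_def by blast
  then show ?case using insert by auto
qed

text \<open>
  If a product of finitely many primes is zero, every prime contains one of them.  So the inclusion-minimal ones
  among them are minimal among all primes, and their closures are the irreducible components.
\<close>

lemma generic_point_below:
  assumes R: "cring R" and Ps: "cring.contains_prime_product R {\<zero>\<^bsub>R\<^esub>} Ps" and P: "P \<in> set Ps"
  shows "\<exists>\<eta>\<in>generic_points R. \<eta> \<subseteq> P"
proof -
  interpret cring R by (rule R)
  have prime: "primeideal Q R" if "Q \<in> set Ps" for Q
    using Ps that by (simp add: contains_prime_product_def)
  have above: "\<exists>P'\<in>set Ps. P' \<subseteq> Q" if "Q \<in> Spec R" for Q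
  proof (rule ccontr)
    interpret Q: primeideal Q R using that by (simp add: Spec_def)
    assume "\<not> (\<exists>P'\<in>set Ps. P' \<subseteq> Q)"
    then have "\<forall>P'\<in>set Ps. \<exists>a. a \<in> P' \<and> a \<notin> Q" by blast
    then obtain f where f: "\<And>P'. P' \<in> set Ps \<Longrightarrow> f P' \<in> P' \<and> f P' \<notin> Q" by metis
    have "list_prod (map f Qs) \<notin> Q" if "set Qs \<subseteq> set Ps" for Qs
      using that
    proof (induction Qs)
      case Nil
      show ?case using Q.one_imp_carrier Q.I_notcarr by auto
    next
      case (Cons P' Qs)
      have c: "f P'' \<in> carrier R" if "P'' \<in> set Ps" for P''
        using f[OF that] prime[OF that] ideal.Icarr primeideal.axioms(1) by metis
      have "list_prod (map f Qs) \<in> carrier R" using Cons.prems c by (intro list_prod_closed) auto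
      moreover have "f P' \<in> carrier R" "f P' \<notin> Q" using Cons.prems c f by auto
      moreover have "list_prod (map f Qs) \<notin> Q" using Cons by simp
      ultimately show ?case using Q.I_prime by auto
    qed
    moreover have "list_all2 (\<in>) (map f Ps) Ps"
      using f by (simp add: list_all2_conv_all_nth)
    then have "list_prod (map f Ps) \<in> {\<zero>\<^bsub>R\<^esub>}" using Ps unfolding contains_prime_product_def by blast
    ultimately show False using Q.zero_closed by fastforce
  qed
  obtain \<eta> where \<eta>: "\<eta> \<in> set Ps" "\<eta> \<subseteq> P" "\<And>Q. Q \<in> set Ps \<Longrightarrow> Q \<subseteq> \<eta> \<Longrightarrow> Q = \<eta>"
    using finite_has_minimal2[OF finite_set P] by metis
  have \<eta>S: "\<eta> \<in> Spec R" using prime \<eta>(1) by (simp add: Spec_def)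
  let ?Z = "{Q \<in> Spec R. \<eta> \<subseteq> Q}"
  have "irreducible_component (zariski R) ?Z"
    unfolding irreducible_component_def
  proof (intro conjI allI impI)
    show "irreducible_in (zariski R) ?Z"
      unfolding irreducible_in_def topspace_zariski
    proof (intro conjI allI impI)
      show "?Z \<noteq> {}" using \<eta>S by blast
      fix C D assume CD: "closedin (zariski R) C \<and> closedin (zariski R) D \<and> ?Z \<subseteq> C \<union> D"
      then have "\<eta> \<in> C \<or> \<eta> \<in> D" using \<eta>S by blast
      then show "?Z \<subseteq> C \<or> ?Z \<subseteq> D" using CD unfolding closedin_zariski by blast
    qed blast
    fix Z' assume Z': "irreducible_in (zariski R) Z' \<and> ?Z \<subseteq> Z'"
    have sub: "Z' \<subseteq> Spec R" using Z' by (simp add: irreducible_in_def topspace_zariski)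
    let ?F = "(\<lambda>P'. {Q \<in> Spec R. P' \<subseteq> Q}) ` set Ps"
    have "closedin (zariski R) C" if "C \<in> ?F" for C
      using that prime ideal.Icarr primeideal.axioms(1) unfolding closedin_zariski
      by (smt (verit, best) image_iff subsetI)
    moreover have "Z' \<subseteq> \<Union>?F" using sub above by blast
    ultimately obtain P' where P': "P' \<in> set Ps" "Z' \<subseteq> {Q \<in> Spec R. P' \<subseteq> Q}"
      using irreducible_in_Union[of ?F "zariski R" Z'] Z' by auto
    then have "P' \<subseteq> \<eta>" using Z' \<eta>S by blast
    then have "P' = \<eta>" using \<eta>(3) P'(1) by blast
    then show "Z' = ?Z" using P'(2) Z' by blast
  qed
  then have "\<eta> \<in> generic_points R"
    unfolding generic_points_def using \<eta>S closure_of_point[OF \<eta>S] by blast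
  then show ?thesis using \<eta>(2) by blast
qed

text \<open>
  One dominated relation for each prime of a product that is zero; their product is the relation sought.  For
  the zero ring the product is empty and the relation is \<open>\<one> = \<zero>\<close>.
\<close>

theorem zero_dominated_of_tr_deg:
  fixes R :: "('r, 'm) ring_scheme" and k :: "('k, 'n) ring_scheme"
  assumes R: "cring R" "noetherian_ring R" and k: "field k" and \<phi>: "\<phi> \<in> ring_hom k R"
    and deg: "\<And>\<eta>. \<eta> \<in> generic_points R \<Longrightarrow>
      tr_deg k (residue_field R \<eta>) (\<lambda>a. to_residue_field R \<eta> (\<phi> a)) < enat n"
    and y: "\<And>j. y j \<in> carrier R"
  shows "\<zero>\<^bsub>R\<^esub> \<in> dominated R (\<phi> ` (carrier k - {\<zero>\<^bsub>k\<^esub>})) y n"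
proof -
  interpret cring R by (rule R(1))
  let ?C = "\<phi> ` (carrier k - {\<zero>\<^bsub>k\<^esub>})"
  interpret S: monomial_sums R ?C y n by (rule monomial_sums_field_image[OF R(1) k \<phi> y])
  obtain Ps where Ps: "contains_prime_product {\<zero>\<^bsub>R\<^esub>} Ps"
    using noetherian_ring.ex_prime_product[OF R(2,1) zeroideal] by blast
  have "\<exists>r\<in>P. r \<in> dominated R ?C y n" if P: "P \<in> set Ps" for P
  proof -
    obtain \<eta> where \<eta>: "\<eta> \<in> generic_points R" "\<eta> \<subseteq> P" using generic_point_below[OF R(1) Ps P] by blast
    then have "primeideal \<eta> R" by (simp add: generic_points_def Spec_def)
    from dominated_in_prime[of R k \<phi> \<eta> n y, OF R(1) k \<phi> this deg[OF \<eta>(1)] y]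
    show ?thesis using \<eta>(2) by blast
  qed
  then obtain f where f: "\<And>P. P \<in> set Ps \<Longrightarrow> f P \<in> P \<and> f P \<in> dominated R ?C y n" by metis
  have "list_prod (map f Qs) \<in> dominated R ?C y n" if "set Qs \<subseteq> set Ps" for Qs
    using that by (induction Qs) (simp_all add: S.dominated_one S.dominated_mult f)
  moreover have "list_all2 (\<in>) (map f Ps) Ps" using f by (simp add: list_all2_conv_all_nth)
  then have "list_prod (map f Ps) = \<zero>\<^bsub>R\<^esub>" using Ps unfolding contains_prime_product_def by blast
  ultimately show ?thesis by (metis order_refl)
qed

section \<open>Concentration in degrees bounded by the transcendence degrees\<close>

theorem theorem2:
  fixes p :: nat
    and k :: "('k, 'm) ring_scheme"
    and R :: "('r, 'n) ring_scheme"
    and \<phi> :: "'k \<Rightarrow> 'r"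
    and A :: "'a dieudonne"
    and \<rho> :: "'r \<Rightarrow> 'a set"
  assumes "Factorial_Ring.prime p"
    and "perfect_field p k"
    and "cring R" and "noetherian_ring R"
    and "\<phi> \<in> ring_hom k R"
    and "saturated_dRW p R A \<rho>"
  \<comment> \<open>For the zero ring the supremum is \<open>-\<infinity>\<close>.\<close>
  shows "\<forall>i::int.
    \<not> (0 \<le> i \<and>
       ereal (of_int i) \<le> (SUP \<eta>\<in>generic_points R.
         ereal_of_enat (tr_deg k (residue_field R \<eta>) (\<lambda>a. to_residue_field R \<eta> (\<phi> a)))))
    \<longrightarrow> grade A i = {\<zero>\<^bsub>A\<^esub>}"
proof (intro allI impI)
  fix i :: int
  let ?deg = "\<lambda>\<eta>. tr_deg k (residue_field R \<eta>) (\<lambda>a. to_residue_field R \<eta> (\<phi> a))"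
  assume i: "\<not> (0 \<le> i \<and> ereal (of_int i) \<le> (SUP \<eta>\<in>generic_points R. ereal_of_enat (?deg \<eta>)))"
  show "grade A i = {\<zero>\<^bsub>A\<^esub>}"
  proof (cases "i < 0")
    case True
    have "dieudonne_algebra p A"
      using assms(6) by (simp add: saturated_dRW_def strict_dieudonne_algebra_def)
    then show ?thesis using True by (simp add: dieudonne_algebra_def)
  next
    case False
    then obtain n where n: "i = int n" using nonneg_int_cases by (metis not_less)
    have "?deg \<eta> < enat n" if "\<eta> \<in> generic_points R" for \<eta>
    proof -
      have "ereal_of_enat (?deg \<eta>) \<le> (SUP \<eta>\<in>generic_points R. ereal_of_enat (?deg \<eta>))"
        by (rule SUP_upper[OF that])
      also have "\<dots> < ereal (real n)" using i n by (simp add: not_le)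
      also have "ereal (real n) = ereal_of_enat (enat n)" by simp
      finally show ?thesis by (simp only: ereal_of_enat_less_iff)
    qed
    moreover have "field k" using assms(2) by (simp add: perfect_field_def)
    ultimately have "\<zero>\<^bsub>R\<^esub> \<in> dominated R (\<phi> ` (carrier k - {\<zero>\<^bsub>k\<^esub>})) y n"
      if "\<And>j. y j \<in> carrier R" for y
      using zero_dominated_of_tr_deg assms(3-5) that by blast
    then show ?thesis
      using saturated_dRW_vanishes_above[OF assms(1-3,5,6), of n i] n by simp
  qed
qed

end
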